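(* Let $x\in\mathcal E_{\varepsilon_1,\varepsilon_3}$ (with window function $g$) for some small $\varepsilon_1,\varepsilon_3>0$. Fix $b\in\mathbb R$, let the scale $a$ range over $[a_1(b),a_2(b)]$, and let $\tilde\varepsilon_1,\tilde\varepsilon_2>0$. For $k\in\{1,\dots,K\}$ let $$V_b=V_b^{(k)}:=\big\{a:(a,b)\in O_k,\ |\widetilde W_x(a,b)|>\tilde\varepsilon_1,\ \big|\partial_a\big(a\widetilde W_x^{g_1}(a,b)/\widetilde W_x(a,b)\big)\big|>\tilde\varepsilon_2\big\},$$ $$U_b=U_b^{(k)}:=\big\{a:(a,b)\in O_k,\ |\widetilde W_x(a,b)|>\tilde\varepsilon_1,\ \big|\partial_a\big(a\widetilde W_x^{g_1}(a,b)/\widetilde W_x(a,b)\big)\big|\le\tilde\varepsilon_2\big\}.$$ With the notation of the context, the following hold. (a) Suppose $\tilde\varepsilon_1\ge a_2(b)\sigma(b)\Pi_0(a_2(b),b)+\tau_0\sum_{k=1}^KA_k(b)$. Then for $(a,b)$ with $|\widetilde W_x(a,b)|>\tilde\varepsilon_1$ there exists $k\in\{1,\dots,K\}$ such that $(a,b)\in O_k$. (b$_1$) For $a\in V_b^{(k)}$, $$|\omega_x^{\rm 2adp}(a,b)-\phi_k'(b)|<{\rm Bd}_1',$$ where $${\rm Bd}_1':=\max_{1\le k\le K}\ \sup_{a\in V_b^{(k)}}\Big\{\frac{|{\rm Res}_1|}{2\pi\tilde\varepsilon_1}+\frac1{2\pi\tilde\varepsilon_1^3\tilde\varepsilon_2}\,a|\widetilde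 W_x^{g_1}(a,b)|\big(|\partial_a\widetilde W_x(a,b)|\,|{\rm Res}_1|+\tilde\varepsilon_1|{\rm Res}_2|\big)\Big\}.$$ (b$_2$) Suppose $(a,b)$ satisfies $|\widetilde W_x(a,b)|>\tilde\varepsilon_1$ and $(a,b)\in O_k$. Then $$\omega_x^{\rm adp,c}(a,b)-\phi_k'(b)=\phi_k''(b)\,a\sigma(b)\frac{\widetilde W_x^{g_1}(a,b)}{\widetilde W_x(a,b)}+\frac{{\rm Res}_1}{i2\pi\widetilde W_x(a,b)}.$$ Thus, for $a\in U_b^{(k)}$, $$|\omega_x^{\rm adp}(a,b)-\phi_k'(b)|<{\rm Bd}_2':=\max_{1\le k\le K}\ \sup_{a\in U_b^{(k)}}\Big\{\frac1{\tilde\varepsilon_1}|\phi_k''(b)|\,a\sigma(b)\,|\widetilde W_x^{g_1}(a,b)|+\frac1{2\pi\tilde\varepsilon_1}|{\rm Res}_1|\Big\}.$$ (c) Let $k\in\{1,\dots,K\}$. Suppose $\tilde\varepsilon_1$ satisfies the condition in (a), and that (i) ${\rm Bd}_1'\le\frac12L_k(b)$ and (ii) ${\rm Bd}_2'\le\frac12L_k(b)$. Then for any $\tilde\varepsilon_3=\tilde\varepsilon_3(b)>0$ with $\max\{{\rm Bd}_1',{\rm Bd}_2'\}\le\tilde\varepsilon_3\le\frac12L_k(b)$, $$\Big|\lim_{\lambda\to0}\frac1{c_\psi^k(b)}\int_{|\xi-\phi_k'(b)|<\tilde\varepsilon_3}S^{\rm 2adp,\lambda}_{x,\tilde\varepsilon_1,\tilde\varepsilon_2}(\xi,b)\,d\xi-x_k(b)\Big|\le\frac1{|c_\psi^k(b)|}\widetilde{\rm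 Bd}_k',$$ where $$\widetilde{\rm Bd}_k':=\tilde\varepsilon_1\ln\frac{u_k(b)}{l_k(b)}+\sigma(b)K\varepsilon_1I_1\big(u_k(b)-l_k(b)\big)+\frac\pi9\varepsilon_3I_3\big(u_k(b)-l_k(b)\big)^3\sigma^3(b)\sum_{j=1}^KA_j(b)+\sum_{\ell\ne k}A_\ell(b)M_{\ell,k}(b).$$
   Context: Fixed data: $\mu>0$; $g$ in the Schwartz class, with either $\widehat g$ supported in $[-\alpha,\alpha]$, or $|\widehat g|$ even and decreasing on $[0,\infty)$ with $|\widehat g(\alpha)|=\tau_0$; $0<\tau_0<1$ a given small threshold; $\sigma:\mathbb R\to(0,\infty)$ differentiable with $\sigma(b)>\alpha/\mu$. Here $\widehat f(\xi)=\int f(t)e^{-i2\pi\xi t}dt$. Suprema over empty sets are $0$. Adaptive CWT: for a Schwartz function $w$, $a>0$: $\widetilde W^w_x(a,b):=\int_{\mathbb R}x(b+at)\frac1{\sigma(b)}w\big(\frac t{\sigma(b)}\big)e^{-i2\pi\mu t}dt$; $\widetilde W_x:=\widetilde W_x^g$; $g_1(t):=tg(t)$, $g_3(t):=tg'(t)$. Signals: $x(t)=\sum_{k=1}^Kx_k(t)$, $x_k(t)=A_k(t)e^{i2\pi\phi_k(t)}$, $A_k,\phi_k$ real-valued, $A_k>0$, $\phi_k'>0$, $\phi_{k-1}'<\phi_k'$, $A_k\in C^2(\mathbb R)\cap L_\infty(\mathbb R)$, $\phi_k\in C^3(\mathbb R)$, $\phi_k''\in L_\infty(\mathbb R)$,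 $\inf_{2\le k\le K,\,t}\frac{\phi_k'(t)-\phi_{k-1}'(t)}{\phi_k'(t)+\phi_{k-1}'(t)}>0$. For $j\ge0$, $$G_{j,k}(a,b):=\int_{\mathbb R}e^{i2\pi(\phi_k'(b)at+\frac12\phi_k''(b)a^2t^2)}\frac{t^j}{\sigma(b)^{j+1}}g\Big(\frac t{\sigma(b)}\Big)e^{-i2\pi\mu t}dt .$$ Zones: it is assumed that there are functions $0<l_k(b)<u_k(b)$ such that, with $O_k:=\{(a,b):l_k(b)<a<u_k(b),\,b\in\mathbb R\}$, one has $|G_{0,k}(a,b)|\le\tau_0$ for $(a,b)\notin O_k$, and that $x$ is well-separated: $u_k(b)\le l_{k-1}(b)$ for $b\in\mathbb R$, $2\le k\le K$ (so the $O_k$ are pairwise disjoint). $\mathcal E_{\varepsilon_1,\varepsilon_3}$ is the set of all such $x$ satisfying in addition $|A_k'(t)|\le\varepsilon_1$, $|\phi_k^{(3)}(t)|\le\varepsilon_3$ for all $t\in\mathbb R$, $1\le k\le K$. Scales are restricted to $a\in[a_1(b),a_2(b)]$, where $0<a_1(b)\le l_K(b)$ and $u_1(b)\le a_2(b)<\infty$. Phase transformations (all functions evaluated at $(a,b)$): where $\widetilde W_x\ne0$, $$\omega_x^{\rm adp,c}(a,b):=\frac{\partial_b\widetilde W_x}{i2\pi\widetilde W_x}+\frac{\sigma'(b)}{i2\pi\sigma(b)}+\frac{\sigma'(b)}{\sigma(b)}\frac{\widetilde W_x^{g_3}}{i2\pi\widetilde W_x},\qquad\omega_x^{\rm adp}:={\rm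 Re}\,\omega_x^{\rm adp,c};$$ where in addition $\partial_a\big(a\widetilde W_x^{g_1}/\widetilde W_x\big)\ne0$, $$\omega_x^{\rm 2adp,c}(a,b):=\frac{\partial_b\widetilde W_x}{i2\pi\widetilde W_x}+\frac{\sigma'(b)}{i2\pi\sigma(b)}\Big(1+\frac{\widetilde W_x^{g_3}}{\widetilde W_x}\Big)-a\frac{\widetilde W_x^{g_1}}{i2\pi\widetilde W_x}R_0(a,b),\qquad\omega_x^{\rm 2adp}:={\rm Re}\,\omega_x^{\rm 2adp,c},$$ $$R_0(a,b):=\frac1{\partial_a\big(a\widetilde W_x^{g_1}/\widetilde W_x\big)}\Big\{\partial_a\Big(\frac{\partial_b\widetilde W_x}{\widetilde W_x}\Big)+\frac{\sigma'(b)}{\sigma(b)}\partial_a\Big(\frac{\widetilde W_x^{g_3}}{\widetilde W_x}\Big)\Big\}.$$ For $\gamma_2>0$, where $\widetilde W_x\neq0$: $\omega^{\rm 2adp}_{x,\gamma_2}:=\omega_x^{\rm 2adp}$ if $\big|\partial_a\big(a\widetilde W_x^{g_1}/\widetilde W_x\big)\big|>\gamma_2$ and $\omega^{\rm 2adp}_{x,\gamma_2}:=\omega_x^{\rm adp}$ if $\big|\partial_a\big(a\widetilde W_x^{g_1}/\widetilde W_x\big)\big|\le\gamma_2$. Second-order adaptive WSST of the second type, for $\gamma_1,\gamma_2,\lambda>0$ and a fixed compactly supported function $h$ with certain smoothness (say continuous) and $\int_{\mathbb R}h=1$: $$S^{\rm 2adp,\lambda}_{x,\gamma_1,\gamma_2}(\xi,b):=\int_{\{a\in[a_1(b),a_2(b)]:\,|\widetilde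 W_x(a,b)|>\gamma_1\}}\widetilde W_x(a,b)\frac1\lambda h\Big(\frac{\xi-\omega^{\rm 2adp}_{x,\gamma_2}(a,b)}\lambda\Big)\frac{da}a.$$ Residuals: $x_{\rm r}(a,b,t):=x(b+at)-\sum_{k=1}^Kx_k(b)e^{i2\pi(\phi_k'(b)at+\frac12\phi_k''(b)(at)^2)}$; for a Schwartz function $w$ put ${\rm res}[w]:=\int_{\mathbb R}x_{\rm r}(a,b,t)\frac1{\sigma(b)}w\big(\frac t{\sigma(b)}\big)e^{-i2\pi\mu t}dt$, and ${\rm res}_0={\rm res}[g]$, ${\rm res}_1={\rm res}[tg]$, ${\rm res}_2={\rm res}[t^2g]$, ${\rm res}_0'={\rm res}[g']$, ${\rm res}_1'={\rm res}[tg']$, ${\rm res}_2'={\rm res}[t^2g']$, ${\rm res}_1''={\rm res}[tg'']$ (here e.g. $tg$ denotes $t\mapsto tg(t)$). For each $k$ (all sums over $\ell\in\{1,\dots,K\}\setminus\{k\}$): $B_k:=\sum_{\ell\ne k}x_\ell(b)(\phi_\ell'(b)-\phi_k'(b))G_{0,\ell}(a,b)$, $D_k:=\sum_{\ell\ne k}x_\ell(b)(\phi_\ell''(b)-\phi_k''(b))G_{1,\ell}(a,b)$, $E_k:=\sum_{\ell\ne k}x_\ell(b)(\phi_\ell'(b)-\phi_k'(b))\big(\phi_\ell'(b)G_{1,\ell}(a,b)+\phi_\ell''(b)a\sigma(b)G_{2,\ell}(a,b)\big)$, $F_k:=\sum_{\ell\ne k}x_\ell(b)(\phi_\ell''(b)-\phi_k''(b))\big(\phi_\ell'(b)G_{2,\ell}(a,b)+\phi_\ell''(b)a\sigma(b)G_{3,\ell}(a,b)\big)$.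 Then (depending on $k,a,b$) $${\rm Res}_1:=i2\pi B_k+i2\pi a\sigma(b)D_k+i2\pi\Big(\frac\mu a-\phi_k'(b)\Big){\rm res}_0-\frac{{\rm res}_0'}{a\sigma(b)}-i2\pi\phi_k''(b)a\sigma(b)\,{\rm res}_1,$$ $${\rm Res}_2:=-4\pi^2\sigma(b)E_k+i2\pi\sigma(b)D_k-4\pi^2a\sigma^2(b)F_k+\frac{i2\pi}{a^2}(a\phi_k'(b)-2\mu)({\rm res}_0+{\rm res}_1')$$ $$\quad+i2\pi\sigma(b)\Big(\phi_k''(b)-\frac{i2\pi\mu}{a^2}(a\phi_k'(b)-\mu)\Big){\rm res}_1-i2\pi\sigma(b)\phi_k''(b)\big(i2\pi\mu\sigma(b)\,{\rm res}_2-{\rm res}_2'\big)+\frac1{a^2\sigma(b)}(2\,{\rm res}_0'+{\rm res}_1'').$$ Constants: $I_n:=\int_{\mathbb R}|t^ng(t)|dt$; $\Pi_0(a,b):=K\varepsilon_1I_1+\frac\pi3\varepsilon_3I_3a^2\sigma^2(b)\sum_{k=1}^KA_k(b)$; $M_{\ell,k}(b):=\int_{l_k(b)}^{u_k(b)}|G_{0,\ell}(a,b)|\frac{da}a$; $c_\psi^k(b):=\int_{l_k(b)}^{u_k(b)}G_{0,k}(a,b)\frac{da}a$. $L_k(b):=\min\{\phi_k'(b)-\phi_{k-1}'(b),\ \phi_{k+1}'(b)-\phi_k'(b)\}$, terms with the undefined $\phi_0'$ or $\phi_{K+1}'$ being omitted.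
   Formalization: In (b1),(b2) the strict inequality is relaxed to allow equality when the bound Bd' is 0 (a pure tone gives 0<0); in (c) the factor (u_k−l_k)^3 is corrected to u_k^3−l_k^3, since the literal bound fails; c_psi^k(b)≠0 is made explicit. *)

theory Defs
  imports "HOL-Analysis.Analysis"
begin

text \<open>
  All data of the problem are collected in one record: the modulation frequency, the window, the
  scale-dependent width function, the number of components with their amplitudes and phases, the
  boundary functions of the zones, and the endpoints of the range of scales.  Components are
  indexed by \<open>{1..K}\<close>; values of the indexed fields at other indices are irrelevant.
\<close>

record awsst =
  freq :: real                              \<comment> \<open>\<open>\<mu>\<close>\<close>
  win :: "real \<Rightarrow> complex"                  \<comment> \<open>\<open>g\<close>\<close>
  sig :: "real \<Rightarrow> real"                     \<comment> \<open>\<open>\<sigma>\<close>\<close>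
  ncomp :: nat                              \<comment> \<open>\<open>K\<close>\<close>
  amp :: "nat \<Rightarrow> real \<Rightarrow> real"              \<comment> \<open>\<open>A\<^sub>k\<close>\<close>
  phs :: "nat \<Rightarrow> real \<Rightarrow> real"              \<comment> \<open>\<open>\<phi>\<^sub>k\<close>\<close>
  lo :: "nat \<Rightarrow> real \<Rightarrow> real"               \<comment> \<open>\<open>l\<^sub>k\<close>\<close>
  up :: "nat \<Rightarrow> real \<Rightarrow> real"               \<comment> \<open>\<open>u\<^sub>k\<close>\<close>
  amin :: "real \<Rightarrow> real"                    \<comment> \<open>\<open>a\<^sub>1\<close>\<close>
  amax :: "real \<Rightarrow> real"                    \<comment> \<open>\<open>a\<^sub>2\<close>\<close>

definition vderiv :: "(real \<Rightarrow> complex) \<Rightarrow> real \<Rightarrow> complex" where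
  "vderiv f t = vector_derivative f (at t)"

definition schwartz :: "(real \<Rightarrow> complex) \<Rightarrow> bool" where
  "schwartz f \<longleftrightarrow>
     (\<forall>n t. (vderiv ^^ n) f differentiable (at t)) \<and>
     (\<forall>m n. bounded (range (\<lambda>t. of_real (t ^ m) * (vderiv ^^ n) f t)))"

definition fourier :: "(real \<Rightarrow> complex) \<Rightarrow> real \<Rightarrow> complex" where
  "fourier f \<xi> = (LBINT t. f t * cis (- (2 * pi * \<xi> * t)))"

definition C_diff :: "nat \<Rightarrow> (real \<Rightarrow> real) \<Rightarrow> bool" where
  "C_diff n f \<longleftrightarrow>
     (\<forall>j<n. \<forall>t. (deriv ^^ j) f field_differentiable (at t)) \<and>
     continuous_on UNIV ((deriv ^^ n) f)"

definition phs1 :: "awsst \<Rightarrow> nat \<Rightarrow> real \<Rightarrow> real" where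
  "phs1 S k = deriv (phs S k)"

definition phs2 :: "awsst \<Rightarrow> nat \<Rightarrow> real \<Rightarrow> real" where
  "phs2 S k = (deriv ^^ 2) (phs S k)"

definition phs3 :: "awsst \<Rightarrow> nat \<Rightarrow> real \<Rightarrow> real" where
  "phs3 S k = (deriv ^^ 3) (phs S k)"

definition xcomp :: "awsst \<Rightarrow> nat \<Rightarrow> real \<Rightarrow> complex" where
  "xcomp S k t = of_real (amp S k t) * cis (2 * pi * phs S k t)"

definition signal :: "awsst \<Rightarrow> real \<Rightarrow> complex" where
  "signal S t = (\<Sum>k=1..ncomp S. xcomp S k t)"

definition acwt :: "awsst \<Rightarrow> (real \<Rightarrow> complex) \<Rightarrow> real \<Rightarrow> real \<Rightarrow> complex" where
  "acwt S w a b =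
     (LBINT t. signal S (b + a * t) * of_real (1 / sig S b) * w (t / sig S b)
                 * cis (- (2 * pi * freq S * t)))"

abbreviation W :: "awsst \<Rightarrow> real \<Rightarrow> real \<Rightarrow> complex" where
  "W S \<equiv> acwt S (win S)"

definition Wg1 :: "awsst \<Rightarrow> real \<Rightarrow> real \<Rightarrow> complex" where
  "Wg1 S = acwt S (\<lambda>t. of_real t * win S t)"

definition Wg3 :: "awsst \<Rightarrow> real \<Rightarrow> real \<Rightarrow> complex" where
  "Wg3 S = acwt S (\<lambda>t. of_real t * vderiv (win S) t)"

definition chirpG :: "awsst \<Rightarrow> nat \<Rightarrow> nat \<Rightarrow> real \<Rightarrow> real \<Rightarrow> complex" where
  "chirpG S j k a b =
     (LBINT t. cis (2 * pi * (phs1 S k b * a * t + 1/2 * phs2 S k b * a\<^sup>2 * t\<^sup>2))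
                 * of_real (t ^ j / sig S b ^ (j + 1)) * win S (t / sig S b)
                 * cis (- (2 * pi * freq S * t)))"

definition zone :: "awsst \<Rightarrow> nat \<Rightarrow> (real \<times> real) set" where
  "zone S k = {(a, b). lo S k b < a \<and> a < up S k b}"

definition window_setting :: "awsst \<Rightarrow> real \<Rightarrow> real \<Rightarrow> bool" where
  "window_setting S \<alpha> \<tau>0 \<longleftrightarrow>
     0 < freq S \<and> 0 < \<alpha> \<and> 0 < \<tau>0 \<and> \<tau>0 < 1 \<and> schwartz (win S) \<and>
     ((\<forall>\<xi>. \<xi> \<notin> {-\<alpha>..\<alpha>} \<longrightarrow> fourier (win S) \<xi> = 0) \<or>
      (\<forall>\<xi>. cmod (fourier (win S) (- \<xi>)) = cmod (fourier (win S) \<xi>)) \<and>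
      antimono_on {0..} (\<lambda>\<xi>. cmod (fourier (win S) \<xi>)) \<and>
      cmod (fourier (win S) \<alpha>) = \<tau>0) \<and>
     (\<forall>b. sig S differentiable (at b)) \<and>
     (\<forall>b. sig S b > \<alpha> / freq S)"

text \<open>
  The infimum below is taken in the extended reals, so that it is \<open>\<infinity>\<close> for a single component.
\<close>

definition signal_class :: "awsst \<Rightarrow> real \<Rightarrow> real \<Rightarrow> real \<Rightarrow> bool" where
  "signal_class S \<tau>0 \<epsilon>1 \<epsilon>3 \<longleftrightarrow>
     1 \<le> ncomp S \<and>
     (\<forall>k\<in>{1..ncomp S}.
        (\<forall>t. 0 < amp S k t \<and> 0 < phs1 S k t) \<and>
        C_diff 2 (amp S k) \<and> bounded (range (amp S k)) \<and>
        C_diff 3 (phs S k) \<and> bounded (range (phs2 S k))) \<and>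
     (\<forall>k\<in>{2..ncomp S}. \<forall>t. phs1 S (k - 1) t < phs1 S k t) \<and>
     0 < (INF (k, t)\<in>{2..ncomp S} \<times> UNIV.
            ereal ((phs1 S k t - phs1 S (k - 1) t) / (phs1 S k t + phs1 S (k - 1) t))) \<and>
     (\<forall>k\<in>{1..ncomp S}. \<forall>b. 0 < lo S k b \<and> lo S k b < up S k b) \<and>
     (\<forall>k\<in>{1..ncomp S}. \<forall>a b. 0 < a \<and> (a, b) \<notin> zone S k \<longrightarrow> cmod (chirpG S 0 k a b) \<le> \<tau>0) \<and>
     (\<forall>k\<in>{2..ncomp S}. \<forall>b. up S k b \<le> lo S (k - 1) b) \<and>
     (\<forall>k\<in>{1..ncomp S}. \<forall>t. \<bar>deriv (amp S k) t\<bar> \<le> \<epsilon>1 \<and> \<bar>phs3 S k t\<bar> \<le> \<epsilon>3)"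

definition scale_range :: "awsst \<Rightarrow> bool" where
  "scale_range S \<longleftrightarrow>
     (\<forall>b. 0 < amin S b \<and> amin S b \<le> lo S (ncomp S) b \<and> up S 1 b \<le> amax S b)"

text \<open>
  The expressions defining the phase transformations are meaningful where the transform, and for
  the second-order one also \<open>dratio\<close>, does not vanish; elsewhere their values are never used.
\<close>

definition Wda :: "awsst \<Rightarrow> real \<Rightarrow> real \<Rightarrow> complex" where
  "Wda S a b = vderiv (\<lambda>a. W S a b) a"

definition Wdb :: "awsst \<Rightarrow> real \<Rightarrow> real \<Rightarrow> complex" where
  "Wdb S a b = vderiv (\<lambda>b. W S a b) b"

definition dratio :: "awsst \<Rightarrow> real \<Rightarrow> real \<Rightarrow> complex" where
  "dratio S a b = vderiv (\<lambda>a. of_real a * Wg1 S a b / W S a b) a"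

definition omega1c :: "awsst \<Rightarrow> real \<Rightarrow> real \<Rightarrow> complex" where
  "omega1c S a b =
     Wdb S a b / (\<i> * 2 * pi * W S a b)
     + of_real (deriv (sig S) b) / (\<i> * 2 * pi * of_real (sig S b))
     + of_real (deriv (sig S) b / sig S b) * (Wg3 S a b / (\<i> * 2 * pi * W S a b))"

definition omega1 :: "awsst \<Rightarrow> real \<Rightarrow> real \<Rightarrow> real" where
  "omega1 S a b = Re (omega1c S a b)"

definition R0 :: "awsst \<Rightarrow> real \<Rightarrow> real \<Rightarrow> complex" where
  "R0 S a b =
     1 / dratio S a b *
     (vderiv (\<lambda>a. Wdb S a b / W S a b) a
      + of_real (deriv (sig S) b / sig S b) * vderiv (\<lambda>a. Wg3 S a b / W S a b) a)"

definition omega2c :: "awsst \<Rightarrow> real \<Rightarrow> real \<Rightarrow> complex" where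
  "omega2c S a b =
     Wdb S a b / (\<i> * 2 * pi * W S a b)
     + of_real (deriv (sig S) b) / (\<i> * 2 * pi * of_real (sig S b)) * (1 + Wg3 S a b / W S a b)
     - of_real a * (Wg1 S a b / (\<i> * 2 * pi * W S a b)) * R0 S a b"

definition omega2 :: "awsst \<Rightarrow> real \<Rightarrow> real \<Rightarrow> real" where
  "omega2 S a b = Re (omega2c S a b)"

definition omega2_thr :: "awsst \<Rightarrow> real \<Rightarrow> real \<Rightarrow> real \<Rightarrow> real" where
  "omega2_thr S \<gamma>2 a b =
     (if cmod (dratio S a b) > \<gamma>2 then omega2 S a b else omega1 S a b)"

definition sst2 ::
  "awsst \<Rightarrow> (real \<Rightarrow> complex) \<Rightarrow> real \<Rightarrow> real \<Rightarrow> real \<Rightarrow> real \<Rightarrow> real \<Rightarrow> complex" where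
  "sst2 S h \<gamma>1 \<gamma>2 \<delta> \<xi> b =
     (LBINT a:{a \<in> {amin S b..amax S b}. cmod (W S a b) > \<gamma>1}.
        W S a b * of_real (1 / \<delta>) * h ((\<xi> - omega2_thr S \<gamma>2 a b) / \<delta>) * of_real (1 / a))"

definition xres :: "awsst \<Rightarrow> real \<Rightarrow> real \<Rightarrow> real \<Rightarrow> complex" where
  "xres S a b t =
     signal S (b + a * t)
     - (\<Sum>k=1..ncomp S.
          xcomp S k b * cis (2 * pi * (phs1 S k b * a * t + 1/2 * phs2 S k b * (a * t)\<^sup>2)))"

definition res :: "awsst \<Rightarrow> (real \<Rightarrow> complex) \<Rightarrow> real \<Rightarrow> real \<Rightarrow> complex" where
  "res S w a b =
     (LBINT t. xres S a b t * of_real (1 / sig S b) * w (t / sig S b)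
                 * cis (- (2 * pi * freq S * t)))"

text \<open>
  \<open>resd S j d\<close> is the residual for the window \<open>t \<mapsto> t\<^sup>j g\<^sup>(\<^sup>d\<^sup>)(t)\<close>; the number of primes in the
  usual notation is \<open>d\<close>.
\<close>

definition resd :: "awsst \<Rightarrow> nat \<Rightarrow> nat \<Rightarrow> real \<Rightarrow> real \<Rightarrow> complex" where
  "resd S j d = res S (\<lambda>t. of_real (t ^ j) * (vderiv ^^ d) (win S) t)"

definition sumB :: "awsst \<Rightarrow> nat \<Rightarrow> real \<Rightarrow> real \<Rightarrow> complex" where
  "sumB S k a b =
     (\<Sum>l\<in>{1..ncomp S} - {k}.
        xcomp S l b * of_real (phs1 S l b - phs1 S k b) * chirpG S 0 l a b)"

definition sumD :: "awsst \<Rightarrow> nat \<Rightarrow> real \<Rightarrow> real \<Rightarrow> complex" where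
  "sumD S k a b =
     (\<Sum>l\<in>{1..ncomp S} - {k}.
        xcomp S l b * of_real (phs2 S l b - phs2 S k b) * chirpG S 1 l a b)"

definition sumE :: "awsst \<Rightarrow> nat \<Rightarrow> real \<Rightarrow> real \<Rightarrow> complex" where
  "sumE S k a b =
     (\<Sum>l\<in>{1..ncomp S} - {k}.
        xcomp S l b * of_real (phs1 S l b - phs1 S k b) *
        (of_real (phs1 S l b) * chirpG S 1 l a b
         + of_real (phs2 S l b * a * sig S b) * chirpG S 2 l a b))"

definition sumF :: "awsst \<Rightarrow> nat \<Rightarrow> real \<Rightarrow> real \<Rightarrow> complex" where
  "sumF S k a b =
     (\<Sum>l\<in>{1..ncomp S} - {k}.
        xcomp S l b * of_real (phs2 S l b - phs2 S k b) *
        (of_real (phs1 S l b) * chirpG S 2 l a b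
         + of_real (phs2 S l b * a * sig S b) * chirpG S 3 l a b))"

definition Res1 :: "awsst \<Rightarrow> nat \<Rightarrow> real \<Rightarrow> real \<Rightarrow> complex" where
  "Res1 S k a b =
     \<i> * 2 * pi * sumB S k a b
     + \<i> * 2 * pi * of_real (a * sig S b) * sumD S k a b
     + \<i> * 2 * pi * of_real (freq S / a - phs1 S k b) * resd S 0 0 a b
     - resd S 0 1 a b / of_real (a * sig S b)
     - \<i> * 2 * pi * of_real (phs2 S k b * a * sig S b) * resd S 1 0 a b"

definition Res2 :: "awsst \<Rightarrow> nat \<Rightarrow> real \<Rightarrow> real \<Rightarrow> complex" where
  "Res2 S k a b =
     - 4 * of_real (pi\<^sup>2 * sig S b) * sumE S k a b
     + \<i> * 2 * pi * of_real (sig S b) * sumD S k a b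
     - 4 * of_real (pi\<^sup>2 * a * (sig S b)\<^sup>2) * sumF S k a b
     + \<i> * 2 * pi / of_real (a\<^sup>2) * of_real (a * phs1 S k b - 2 * freq S)
         * (resd S 0 0 a b + resd S 1 1 a b)
     + \<i> * 2 * pi * of_real (sig S b)
         * (of_real (phs2 S k b)
            - \<i> * 2 * pi * of_real (freq S) / of_real (a\<^sup>2) * of_real (a * phs1 S k b - freq S))
         * resd S 1 0 a b
     - \<i> * 2 * pi * of_real (sig S b * phs2 S k b)
         * (\<i> * 2 * pi * of_real (freq S * sig S b) * resd S 2 0 a b - resd S 2 1 a b)
     + 1 / of_real (a\<^sup>2 * sig S b) * (2 * resd S 0 1 a b + resd S 1 2 a b)"

definition Imom :: "awsst \<Rightarrow> nat \<Rightarrow> real" where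
  "Imom S n = (LBINT t. cmod (of_real (t ^ n) * win S t))"

definition Pi0 :: "awsst \<Rightarrow> real \<Rightarrow> real \<Rightarrow> real \<Rightarrow> real \<Rightarrow> real" where
  "Pi0 S \<epsilon>1 \<epsilon>3 a b =
     real (ncomp S) * \<epsilon>1 * Imom S 1
     + pi / 3 * \<epsilon>3 * Imom S 3 * a\<^sup>2 * (sig S b)\<^sup>2 * (\<Sum>k=1..ncomp S. amp S k b)"

definition Mcross :: "awsst \<Rightarrow> nat \<Rightarrow> nat \<Rightarrow> real \<Rightarrow> real" where
  "Mcross S l k b = (LBINT a:{lo S k b..up S k b}. cmod (chirpG S 0 l a b) / a)"

definition cpsi :: "awsst \<Rightarrow> nat \<Rightarrow> real \<Rightarrow> complex" where
  "cpsi S k b = (LBINT a:{lo S k b..up S k b}. chirpG S 0 k a b / of_real a)"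

text \<open>The gap to the neighbouring instantaneous frequencies; \<open>\<infinity>\<close> stands for an omitted term.\<close>

definition Lgap :: "awsst \<Rightarrow> nat \<Rightarrow> real \<Rightarrow> ereal" where
  "Lgap S k b =
     min (if 2 \<le> k then ereal (phs1 S k b - phs1 S (k - 1) b) else \<infinity>)
         (if k < ncomp S then ereal (phs1 S (k + 1) b - phs1 S k b) else \<infinity>)"

definition Vset :: "awsst \<Rightarrow> real \<Rightarrow> real \<Rightarrow> nat \<Rightarrow> real \<Rightarrow> real set" where
  "Vset S e1 e2 k b = {a. (a, b) \<in> zone S k \<and> cmod (W S a b) > e1 \<and> cmod (dratio S a b) > e2}"

definition Uset :: "awsst \<Rightarrow> real \<Rightarrow> real \<Rightarrow> nat \<Rightarrow> real \<Rightarrow> real set" where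
  "Uset S e1 e2 k b = {a. (a, b) \<in> zone S k \<and> cmod (W S a b) > e1 \<and> cmod (dratio S a b) \<le> e2}"

text \<open>
  Suprema over empty sets are \<open>0\<close>.  For nonempty index sets, the suprema used below are finite,
  the functions involved being continuous on the compact interval between the zone boundaries.
\<close>

definition sup0 :: "real set \<Rightarrow> real" where
  "sup0 X = (if X = {} then 0 else Sup X)"

definition Bd1 :: "awsst \<Rightarrow> real \<Rightarrow> real \<Rightarrow> real \<Rightarrow> real" where
  "Bd1 S e1 e2 b =
     (MAX k\<in>{1..ncomp S}. sup0 ((\<lambda>a.
        cmod (Res1 S k a b) / (2 * pi * e1)
        + 1 / (2 * pi * e1 ^ 3 * e2) * a * cmod (Wg1 S a b)
            * (cmod (Wda S a b) * cmod (Res1 S k a b) + e1 * cmod (Res2 S k a b)))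
        ` Vset S e1 e2 k b))"

definition Bd2 :: "awsst \<Rightarrow> real \<Rightarrow> real \<Rightarrow> real \<Rightarrow> real" where
  "Bd2 S e1 e2 b =
     (MAX k\<in>{1..ncomp S}. sup0 ((\<lambda>a.
        1 / e1 * \<bar>phs2 S k b\<bar> * a * sig S b * cmod (Wg1 S a b)
        + 1 / (2 * pi * e1) * cmod (Res1 S k a b))
        ` Uset S e1 e2 k b))"

text \<open>
  The third summand comes from integrating \<open>\<pi>/3 \<epsilon>\<^sub>3 I\<^sub>3 a\<^sup>2 \<sigma>\<^sup>3 \<Sum>A\<^sub>j\<close> over the zone, whence the
  difference of cubes; the cube of the difference would not give a valid bound.
\<close>

definition Bdk :: "awsst \<Rightarrow> real \<Rightarrow> real \<Rightarrow> real \<Rightarrow> nat \<Rightarrow> real \<Rightarrow> real" where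
  "Bdk S \<epsilon>1 \<epsilon>3 e1 k b =
     e1 * ln (up S k b / lo S k b)
     + sig S b * real (ncomp S) * \<epsilon>1 * Imom S 1 * (up S k b - lo S k b)
     + pi / 9 * \<epsilon>3 * Imom S 3 * ((up S k b) ^ 3 - (lo S k b) ^ 3) * (sig S b) ^ 3
         * (\<Sum>j=1..ncomp S. amp S j b)
     + (\<Sum>l\<in>{1..ncomp S} - {k}. amp S l b * Mcross S l k b)"

definition threshold_ok :: "awsst \<Rightarrow> real \<Rightarrow> real \<Rightarrow> real \<Rightarrow> real \<Rightarrow> real \<Rightarrow> bool" where
  "threshold_ok S \<tau>0 \<epsilon>1 \<epsilon>3 e1 b \<longleftrightarrow>
     e1 \<ge> amax S b * sig S b * Pi0 S \<epsilon>1 \<epsilon>3 (amax S b) b + \<tau>0 * (\<Sum>k=1..ncomp S. amp S k b)"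

end

theory Submission
  imports Defs "HOL-Probability.Sinc_Integral"
begin

text \<open>
  After the substitution \<open>t = \<sigma>(b) s\<close> every transform in the statement becomes an oscillatory integral
  \<open>osc y w p r = \<integral> y(p s) w(s) exp(-2\<pi>i r s) ds\<close> with \<open>p = a \<sigma>(b)\<close> and \<open>r = \<mu> \<sigma>(b)\<close>, where \<open>y\<close> is the
  shifted signal, a chirp, or their difference, the residual.  Differentiation under the integral and
  integration by parts show that \<open>\<partial>\<^sub>b W + (\<sigma>'/\<sigma>)(W + W\<^sup>g\<^sup>3)\<close> is the transform \<open>Wx'\<close> of the derivative of
  the signal.  Splitting the signal into chirps and residual gives
  \<open>Wx' = 2\<pi>i \<phi>\<^sub>k' W + 2\<pi>i \<phi>\<^sub>k'' a \<sigma> W\<^sup>g\<^sup>1 + Res\<^sub>1\<close>, which is the first-order identity; dividing by \<open>W\<close> and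
  differentiating in \<open>a\<close>, with \<open>\<partial>\<^sub>a Res\<^sub>1 = Res\<^sub>2\<close>, shows that \<open>R\<^sub>0\<close> is \<open>2\<pi>i \<phi>\<^sub>k'' \<sigma>\<close> up to a residual, which gives
  the second-order error.

  For the recovery, Fubini's theorem and dominated convergence concentrate the squeezed transform, in
  the limit, on the scales whose frequency lies within \<open>\<epsilon>\<^sub>3\<close> of \<open>\<phi>\<^sub>k'\<close>.  The error bounds and the gap
  condition identify these scales as those of zone \<open>k\<close>, and never put a frequency exactly at distance \<open>\<epsilon>\<^sub>3\<close>,
  where only part of the mass of \<open>h\<close> would be seen.
\<close>

section \<open>Schwartz functions and differentiation under the integral\<close>

text \<open>Two regularity limits shape the proof. The width \<open>sig\<close> is differentiable,
  with no continuity of its derivative assumed, so difference quotients at the single point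
  \<open>b\<close> must be dominated. The phases have bounded second derivatives but possibly
  unbounded first ones, so the signal is bounded while its derivative may grow linearly. A transform
  of the signal can thus be differentiated once directly; for second derivatives the derivative is
  first moved from the signal onto the window, which can be repeated because the window is Schwartz.

  The strict bounds by \<open>Bd1\<close> and \<open>Bd2\<close> cannot hold at an admissible scale
  when the bound is zero. Strictness comes from \<open>e1 < cmod (W S a b)\<close>: replacing a
  denominator by a smaller one strictly increases a quotient unless its numerator is zero. Hence the
  estimates carry the alternative that bound and error both vanish; in the recovery it is absorbed
  by \<open>0 < e3\<close>.\<close>

lemma vderiv_eqI: "(f has_vector_derivative f') (at t) \<Longrightarrow> vderiv f t = f'"
  by (simp add: vderiv_def vector_derivative_at)

lemma schwartz_has_vderiv:
  assumes "schwartz w"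
  shows "(w has_vector_derivative vderiv w t) (at t)"
proof -
  have "(vderiv ^^ 0) w differentiable (at t)"
    using assms unfolding schwartz_def by blast
  then show ?thesis
    by (simp add: vderiv_def vector_derivative_works[symmetric])
qed

lemma schwartz_continuous: "schwartz w \<Longrightarrow> continuous_on UNIV w"
  by (meson continuous_at_imp_continuous_on has_vector_derivative_continuous schwartz_has_vderiv)

lemma schwartz_vderiv:
  assumes "schwartz w"
  shows "schwartz (vderiv w)"
proof -
  have "(vderiv ^^ n) (vderiv w) = (vderiv ^^ Suc n) w" for n
    by (simp add: funpow_swap1)
  then show ?thesis
    using assms unfolding schwartz_def by metis
qed

lemma schwartz_times_id:
  assumes "schwartz w"
  shows "schwartz (\<lambda>t. of_real t * w t)"
proof -
  have d: "((vderiv ^^ n) w has_vector_derivative (vderiv ^^ Suc n) w t) (at t)" for n t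
    using assms unfolding schwartz_def by (simp add: vderiv_def vector_derivative_works[symmetric])
  \<comment> \<open>Leibniz' rule with the factor \<open>t\<close>, whose derivatives of order two
    and higher vanish. At \<open>n = 0\<close> the truncated \<open>n - 1\<close> is harmless, its
    coefficient being \<open>0\<close>.\<close>
  have eq: "(vderiv ^^ n) (\<lambda>t. of_real t * w t)
      = (\<lambda>t. of_real t * (vderiv ^^ n) w t + of_nat n * (vderiv ^^ (n - 1)) w t)" for n
  proof (induction n)
    case (Suc n)
    have "((\<lambda>t. of_real t * (vderiv ^^ n) w t + of_nat n * (vderiv ^^ (n - 1)) w t)
        has_vector_derivative
          of_real t * (vderiv ^^ Suc n) w t + of_nat (Suc n) * (vderiv ^^ n) w t) (at t)" for t
    proof (cases n)
      case 0
      show ?thesis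
        unfolding 0 by (auto intro!: derivative_eq_intros d[of 0, simplified] simp: algebra_simps)
    next
      case (Suc m)
      show ?thesis
        unfolding Suc
        by (auto intro!: derivative_eq_intros d d[of m, simplified] simp: algebra_simps simp del: funpow.simps)
           (simp_all add: algebra_simps)
    qed
    then have "vderiv (\<lambda>t. of_real t * (vderiv ^^ n) w t + of_nat n * (vderiv ^^ (n - 1)) w t)
        = (\<lambda>t. of_real t * (vderiv ^^ Suc n) w t + of_nat (Suc n) * (vderiv ^^ n) w t)"
      by (intro ext vderiv_eqI)
    then show ?case
      using Suc by simp
  qed simp
  have diff: "(vderiv ^^ n) w differentiable (at t)" for n t
    using assms unfolding schwartz_def by blast
  have bdd: "bounded (range (\<lambda>t. of_real (t ^ m) * (vderiv ^^ n) w t))" for m n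
    using assms unfolding schwartz_def by blast
  show ?thesis
    unfolding schwartz_def eq
  proof (intro conjI allI)
    fix n t
    have "(\<lambda>t. complex_of_real t) differentiable at t"
      by (auto intro!: differentiableI derivative_eq_intros)
    then show "(\<lambda>t. of_real t * (vderiv ^^ n) w t + of_nat n * (vderiv ^^ (n - 1)) w t)
        differentiable at t"
      by (intro differentiable_add differentiable_mult differentiable_const diff)
  next
    fix m n
    have "bounded ((\<lambda>p. fst p + of_nat n * snd p) `
        (range (\<lambda>t. of_real (t ^ Suc m) * (vderiv ^^ n) w t)
          \<times> range (\<lambda>t. of_real (t ^ m) * (vderiv ^^ (n - 1)) w t)))"
      by (intro bounded_linear_image bounded_Times bdd bounded_linear_add
            bounded_linear_fst bounded_linear_const_mult bounded_linear_snd)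
    then show "bounded (range (\<lambda>t. of_real (t ^ m) *
        (of_real t * (vderiv ^^ n) w t + of_nat n * (vderiv ^^ (n - 1)) w t)))"
      by (rule bounded_subset) (force simp: algebra_simps image_iff)
  qed
qed

lemma schwartz_times_power:
  assumes "schwartz w"
  shows "schwartz (\<lambda>t. of_real (t ^ j) * w t)"
proof (induction j)
  case (Suc j)
  from schwartz_times_id[OF this] show ?case
    by (simp add: mult.assoc)
qed (simp add: assms)

lemma schwartz_funpow_vderiv:
  assumes "schwartz w"
  shows "schwartz ((vderiv ^^ n) w)"
  by (induction n) (auto simp: assms schwartz_vderiv)

lemma vderiv_times_id:
  assumes "schwartz w"
  shows "vderiv (\<lambda>t. of_real t * w t) = (\<lambda>t. w t + of_real t * vderiv w t)"
  by (intro ext vderiv_eqI)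
     (auto intro!: derivative_eq_intros schwartz_has_vderiv[OF assms])

lemma schwartz_bounded:
  assumes "schwartz w"
  obtains C where "\<And>t. cmod (w t) \<le> C"
proof -
  have "bounded (range (\<lambda>t. of_real (t ^ 0) * (vderiv ^^ 0) w t))"
    using assms unfolding schwartz_def by blast
  then show ?thesis
    using that by (auto simp: bounded_iff)
qed

text \<open>Boundedness of \<open>w\<close> and of \<open>t^2 * w\<close> gives domination by a
  multiple of \<open>1 / (1 + t^2)\<close>.\<close>

lemma schwartz_integrable:
  assumes "schwartz w"
  shows "integrable lborel w"
proof -
  obtain C where C: "\<And>t. cmod (w t) \<le> C"
    using schwartz_bounded[OF assms] by blast
  obtain D where D: "\<And>t. cmod (of_real (t ^ 2) * w t) \<le> D"
    using schwartz_bounded[OF schwartz_times_power[OF assms]] by blast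
  have "integrable lborel (\<lambda>x::real. (C + D) * inverse (1 + x\<^sup>2))"
    using integrable_inverse_1_plus_square by (simp add: set_integrable_def)
  then show ?thesis
  proof (rule Bochner_Integration.integrable_bound)
    show "w \<in> borel_measurable lborel"
      using schwartz_continuous[OF assms] by (simp add: borel_measurable_continuous_onI)
    have "norm (w x) \<le> norm ((C + D) * inverse (1 + x\<^sup>2))" for x
    proof -
      have "cmod (w x) * (1 + x\<^sup>2) \<le> C + D"
        using C[of x] D[of x] by (simp add: norm_mult norm_power algebra_simps)
      moreover have "0 < 1 + x\<^sup>2"
        by (simp add: add_pos_nonneg)
      ultimately show ?thesis
        by (simp add: divide_simps abs_mult)
    qed
    then show "AE x in lborel. norm (w x) \<le> norm ((C + D) * inverse (1 + x\<^sup>2))"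
      by simp
  qed
qed

lemma schwartz_tendsto_0:
  assumes "schwartz w"
  shows "(w \<longlongrightarrow> 0) at_infinity"
proof -
  obtain D where D: "\<And>t. cmod (of_real (t ^ 1) * w t) \<le> D"
    using schwartz_bounded[OF schwartz_times_power[OF assms]] by blast
  have lim: "((\<lambda>t::real. D * norm (inverse t)) \<longlongrightarrow> 0) at_infinity"
    by (intro tendsto_mult_right_zero tendsto_norm_zero tendsto_inverse_0)
  have "\<forall>\<^sub>F t in at_infinity. cmod (w t) \<le> D * norm (inverse t)"
    unfolding eventually_at_infinity
    using D by (intro exI[of _ 1]) (auto simp: norm_mult divide_simps mult.commute)
  then show ?thesis
    using lim by (rule Lim_null_comparison)
qed

text \<open>Dominated convergence runs along sequences of difference quotients, not along the
  remainder by which the derivative is defined.\<close>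

lemma has_vector_derivative_iff_quotient:
  "(f has_vector_derivative D) (at c) \<longleftrightarrow>
    ((\<lambda>u. (1 / (u - c)) *\<^sub>R (f u - f c)) \<longlongrightarrow> D) (at c)"
proof -
  have "norm (f u - f c - (u - c) *\<^sub>R D) / norm (u - c)
      = norm ((1 / (u - c)) *\<^sub>R (f u - f c) - D)" if "u \<noteq> c" for u
  proof -
    have "(1 / (u - c)) *\<^sub>R (f u - f c) - D = (1 / (u - c)) *\<^sub>R (f u - f c - (u - c) *\<^sub>R D)"
      using that by (simp add: scaleR_diff_right)
    then show ?thesis
      by (simp add: divide_inverse mult.commute)
  qed
  then have "((\<lambda>u. norm (f u - f c - (u - c) *\<^sub>R D) / norm (u - c)) \<longlongrightarrow> 0) (at c) \<longleftrightarrow>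
      ((\<lambda>u. norm ((1 / (u - c)) *\<^sub>R (f u - f c) - D)) \<longlongrightarrow> 0) (at c)"
    by (intro tendsto_cong) (auto simp: eventually_at_filter)
  then show ?thesis
    unfolding has_vector_derivative_def has_derivative_iff_norm
    by (simp add: bounded_linear_scaleR_left tendsto_norm_zero_iff
          LIM_zero_iff)
qed

text \<open>The difference quotients are dominated, so that the integral is differentiable at a single
  point even where the integrand is not differentiable nearby.\<close>

lemma has_vector_derivative_lebesgue_integral:
  fixes f :: "real \<Rightarrow> 'a \<Rightarrow> complex"
  assumes "0 < d"
    and int: "\<And>u. \<bar>u - c\<bar> < d \<Longrightarrow> integrable M (f u)"
    and der: "\<And>s. ((\<lambda>u. f u s) has_vector_derivative f' s) (at c)"
    and [measurable]: "f' \<in> borel_measurable M"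
    and lip: "\<And>u s. \<bar>u - c\<bar> < d \<Longrightarrow> cmod (f u s - f c s) \<le> \<bar>u - c\<bar> * G s"
    and G: "integrable M G"
  shows "((\<lambda>u. integral\<^sup>L M (f u)) has_vector_derivative integral\<^sup>L M f') (at c)"
proof -
  have "((\<lambda>u. (1 / (u - c)) *\<^sub>R (integral\<^sup>L M (f u) - integral\<^sup>L M (f c)))
      \<longlongrightarrow> integral\<^sup>L M f') (at c)"
    unfolding tendsto_at_iff_sequentially
  proof (intro allI impI)
    fix X :: "nat \<Rightarrow> real"
    assume X: "\<forall>i. X i \<in> UNIV - {c}" "X \<longlonglongrightarrow> c"
    obtain N where N: "\<And>n. N \<le> n \<Longrightarrow> \<bar>X n - c\<bar> < d"
      using LIMSEQ_D[OF X(2) \<open>0 < d\<close>] by auto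
    \<comment> \<open>Dropping the first \<open>N\<close> terms keeps every quotient in the
      neighbourhood where integrability and domination hold.\<close>
    define q where "q n s = (1 / (X (n + N) - c)) *\<^sub>R (f (X (n + N)) s - f c s)" for n s
    have q: "integral\<^sup>L M (q n)
        = (1 / (X (n + N) - c)) *\<^sub>R (integral\<^sup>L M (f (X (n + N))) - integral\<^sup>L M (f c))" for n
      unfolding q_def using int N[of "n + N"] int[of c] \<open>0 < d\<close> by simp
    have meas: "f u \<in> borel_measurable M" if "\<bar>u - c\<bar> < d" for u
      using int[OF that] by auto
    have "(\<lambda>n. integral\<^sup>L M (q n)) \<longlonglongrightarrow> integral\<^sup>L M f'"
    proof (rule integral_dominated_convergence[OF _ _ G])
      show "q n \<in> borel_measurable M" for n
        unfolding q_def using meas[OF N[of "n + N"]] meas[of c] \<open>0 < d\<close> by auto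
      have "(\<lambda>n. q n s) \<longlonglongrightarrow> f' s" for s
      proof -
        have "((\<lambda>u. (1 / (u - c)) *\<^sub>R (f u s - f c s)) \<longlongrightarrow> f' s) (at c)"
          using der[of s] by (simp add: has_vector_derivative_iff_quotient)
        then have "((\<lambda>u. (1 / (u - c)) *\<^sub>R (f u s - f c s)) \<circ> X) \<longlonglongrightarrow> f' s"
          using X unfolding tendsto_at_iff_sequentially by blast
        then show ?thesis
          unfolding q_def using LIMSEQ_ignore_initial_segment[of _ "f' s" N]
          by (fastforce simp: comp_def)
      qed
      then show "AE s in M. (\<lambda>n. q n s) \<longlonglongrightarrow> f' s"
        by simp
      have "norm (q n s) \<le> G s" for n s
        using lip[OF N[of "n + N"], of s] X(1)[rule_format, of "n + N"]
        by (simp add: q_def divide_simps mult.commute)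
      then show "AE s in M. norm (q n s) \<le> G s" for n
        by simp
    qed simp
    then have "(\<lambda>n. ((\<lambda>u. (1 / (u - c)) *\<^sub>R (integral\<^sup>L M (f u) - integral\<^sup>L M (f c))) \<circ> X) (n + N))
        \<longlonglongrightarrow> integral\<^sup>L M f'"
      by (simp add: q comp_def)
    then show "((\<lambda>u. (1 / (u - c)) *\<^sub>R (integral\<^sup>L M (f u) - integral\<^sup>L M (f c))) \<circ> X)
        \<longlonglongrightarrow> integral\<^sup>L M f'"
      by (rule LIMSEQ_offset)
  qed
  then show ?thesis
    by (simp add: has_vector_derivative_iff_quotient)
qed

section \<open>Oscillatory integrals\<close>

definition lin_growth :: "(real \<Rightarrow> complex) \<Rightarrow> bool" where
  "lin_growth y \<longleftrightarrow> continuous_on UNIV y \<and> (\<exists>C. \<forall>u. cmod (y u) \<le> C * (1 + \<bar>u\<bar>))"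

text \<open>Signals and chirps are bounded, but their derivatives contain the frequency, which can
  grow linearly. The derivative of a tame function is therefore only put into the larger class,
  where it is still integrable against a Schwartz window.\<close>

definition tame :: "(real \<Rightarrow> complex) \<Rightarrow> (real \<Rightarrow> complex) \<Rightarrow> bool" where
  "tame y y' \<longleftrightarrow>
     (\<forall>u. (y has_vector_derivative y' u) (at u)) \<and> (\<exists>C. \<forall>u. cmod (y u) \<le> C) \<and> lin_growth y'"

definition osc :: "(real \<Rightarrow> complex) \<Rightarrow> (real \<Rightarrow> complex) \<Rightarrow> real \<Rightarrow> real \<Rightarrow> complex" where
  "osc y w p r = (LBINT s. y (p * s) * w s * cis (- (2 * pi * r * s)))"

lemma lin_growthI:
  assumes "continuous_on UNIV y" "\<And>u. cmod (y u) \<le> C * (1 + \<bar>u\<bar>)"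
  shows "lin_growth y"
  using assms unfolding lin_growth_def by blast

lemma lin_growthE:
  assumes "lin_growth y"
  obtains C where "0 \<le> C" "\<And>u. cmod (y u) \<le> C * (1 + \<bar>u\<bar>)"
proof -
  obtain C where C: "\<And>u. cmod (y u) \<le> C * (1 + \<bar>u\<bar>)"
    using assms unfolding lin_growth_def by blast
  moreover have "0 \<le> C"
    using order_trans[OF norm_ge_zero C[of 0]] by simp
  ultimately show ?thesis
    using that by blast
qed

lemma tameD:
  assumes "tame y y'"
  shows "(y has_vector_derivative y' u) (at u)" "lin_growth y'" "continuous_on UNIV y"
  using assms unfolding tame_def
  by (auto intro!: continuous_at_imp_continuous_on has_vector_derivative_continuous)

lemma tame_boundE:
  assumes "tame y y'"
  obtains C where "0 \<le> C" "\<And>u. cmod (y u) \<le> C"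
proof -
  obtain C where C: "\<And>u. cmod (y u) \<le> C"
    using assms unfolding tame_def by blast
  then show ?thesis
    using that[of C] norm_ge_zero[of "y 0"] order_trans by blast
qed

lemma tame_lin_growth:
  assumes "tame y y'"
  shows "lin_growth y"
proof -
  obtain C where "0 \<le> C" "\<And>u. cmod (y u) \<le> C"
    using tame_boundE[OF assms] by blast
  then have "cmod (y u) \<le> C * (1 + \<bar>u\<bar>)" for u
    by (simp add: add_increasing2 distrib_left)
  then show ?thesis
    using tameD(3)[OF assms] by (rule lin_growthI[rotated])
qed

lemma lin_growth_add:
  assumes "lin_growth y" "lin_growth z"
  shows "lin_growth (\<lambda>u. y u + z u)"
proof -
  obtain C D where C: "\<And>u. cmod (y u) \<le> C * (1 + \<bar>u\<bar>)" and D: "\<And>u. cmod (z u) \<le> D * (1 + \<bar>u\<bar>)"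
    using assms unfolding lin_growth_def by blast
  have "cmod (y u + z u) \<le> (C + D) * (1 + \<bar>u\<bar>)" for u
    using norm_triangle_le[OF add_mono[OF C[of u] D[of u]]] by (simp only: distrib_right)
  then show ?thesis
    using assms unfolding lin_growth_def by (blast intro: continuous_on_add)
qed

lemma lin_growth_cmult:
  assumes "lin_growth y"
  shows "lin_growth (\<lambda>u. c * y u)"
proof -
  obtain C where C: "\<And>u. cmod (y u) \<le> C * (1 + \<bar>u\<bar>)"
    using assms unfolding lin_growth_def by blast
  have "cmod (c * y u) \<le> (cmod c * C) * (1 + \<bar>u\<bar>)" for u
    using mult_left_mono[OF C[of u] norm_ge_zero[of c]] by (simp add: norm_mult mult.assoc)
  then show ?thesis
    using assms unfolding lin_growth_def by (blast intro: continuous_on_mult_left)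
qed

lemma lin_growth_sum:
  "finite I \<Longrightarrow> (\<And>i. i \<in> I \<Longrightarrow> lin_growth (y i)) \<Longrightarrow> lin_growth (\<lambda>u. \<Sum>i\<in>I. y i u)"
proof (induction I rule: finite_induct)
  case empty
  show ?case by (rule lin_growthI[of _ 0]) auto
qed (simp add: lin_growth_add)

lemma lin_growth_shift:
  assumes "lin_growth y"
  shows "lin_growth (\<lambda>u. y (b + u))"
proof -
  obtain C where C: "0 \<le> C" "\<And>u. cmod (y u) \<le> C * (1 + \<bar>u\<bar>)"
    using lin_growthE[OF assms] by blast
  have "cmod (y (b + u)) \<le> (C * (1 + \<bar>b\<bar>)) * (1 + \<bar>u\<bar>)" for u
  proof -
    have "1 + \<bar>b + u\<bar> \<le> (1 + \<bar>b\<bar>) * (1 + \<bar>u\<bar>)"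
      using abs_triangle_ineq[of b u] mult_nonneg_nonneg[of "\<bar>b\<bar>" "\<bar>u\<bar>"]
      unfolding distrib_left distrib_right by linarith
    from mult_left_mono[OF this C(1)] C(2)[of "b + u"] show ?thesis
      by (simp add: mult.assoc)
  qed
  moreover have "continuous_on UNIV (\<lambda>u. y (b + u))"
    using assms unfolding lin_growth_def
    by (auto intro!: continuous_on_compose2[of UNIV y] continuous_intros)
  ultimately show ?thesis
    by (rule lin_growthI[rotated])
qed

lemma tame_add: "tame y y' \<Longrightarrow> tame z z' \<Longrightarrow> tame (\<lambda>u. y u + z u) (\<lambda>u. y' u + z' u)"
  unfolding tame_def
  by (auto intro!: has_vector_derivative_add lin_growth_add)
     (meson add_mono norm_triangle_le)

lemma tame_cmult:
  assumes "tame y y'"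
  shows "tame (\<lambda>u. c * y u) (\<lambda>u. c * y' u)"
proof -
  obtain C where "\<And>u. cmod (y u) \<le> C"
    using tame_boundE[OF assms] by blast
  then have "cmod (c * y u) \<le> cmod c * C" for u
    by (simp add: norm_mult mult_left_mono)
  then show ?thesis
    using assms unfolding tame_def
    by (auto intro!: has_vector_derivative_mult_right lin_growth_cmult)
qed

lemma tame_diff: "tame y y' \<Longrightarrow> tame z z' \<Longrightarrow> tame (\<lambda>u. y u - z u) (\<lambda>u. y' u - z' u)"
  using tame_add[of y y' "\<lambda>u. (-1) * z u" "\<lambda>u. (-1) * z' u"] tame_cmult[of z z' "-1"] by simp

lemma tame_sum:
  "finite I \<Longrightarrow> (\<And>i. i \<in> I \<Longrightarrow> tame (y i) (y' i)) \<Longrightarrow>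
    tame (\<lambda>u. \<Sum>i\<in>I. y i u) (\<lambda>u. \<Sum>i\<in>I. y' i u)"
proof (induction I rule: finite_induct)
  case empty
  show ?case by (auto simp: tame_def intro: exI[of _ 0] lin_growthI[of _ 0])
qed (simp add: tame_add)

lemma tame_shift:
  assumes "tame y y'"
  shows "tame (\<lambda>u. y (b + u)) (\<lambda>u. y' (b + u))"
proof -
  have "((\<lambda>u. y (b + u)) has_vector_derivative y' (b + u)) (at u)" for u
  proof -
    have "((\<lambda>u. b + u) has_vector_derivative 1) (at u)"
      by (auto intro!: derivative_eq_intros)
    from vector_diff_chain_at[OF this tameD(1)[OF assms]] show ?thesis
      by (simp add: comp_def)
  qed
  then show ?thesis
    using assms lin_growth_shift[of y' b] unfolding tame_def by auto
qed

section \<open>Lipschitz estimates, differentiation of oscillatory integrals, integration by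
  parts\<close>

lemma tame_lipschitz:
  assumes "tame y y'"
  obtains C where "0 \<le> C" "\<And>u v. cmod (y v - y u) \<le> C * (1 + \<bar>u\<bar> + \<bar>v\<bar>) * \<bar>v - u\<bar>"
proof -
  obtain C where C: "0 \<le> C" "\<And>u. cmod (y' u) \<le> C * (1 + \<bar>u\<bar>)"
    using lin_growthE[OF tameD(2)[OF assms]] by blast
  have "cmod (y v - y u) \<le> C * (1 + \<bar>u\<bar> + \<bar>v\<bar>) * norm (v - u)" for u v
  proof (rule differentiable_bound[of "closed_segment u v"])
    fix x assume "x \<in> closed_segment u v"
    then have x: "\<bar>x\<bar> \<le> \<bar>u\<bar> + \<bar>v\<bar>"
      by (auto simp: closed_segment_eq_real_ivl split: if_splits)
    show "(y has_derivative (\<lambda>h. h *\<^sub>R y' x)) (at x within closed_segment u v)"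
      using tameD(1)[OF assms] unfolding has_vector_derivative_def by (rule has_derivative_at_withinI)
    have "C * (1 + \<bar>x\<bar>) \<le> C * (1 + \<bar>u\<bar> + \<bar>v\<bar>)"
      using C(1) x by (intro mult_left_mono) auto
    with C(2)[of x] have "cmod (y' x) \<le> C * (1 + \<bar>u\<bar> + \<bar>v\<bar>)"
      by linarith
    then show "onorm (\<lambda>h. h *\<^sub>R y' x) \<le> C * (1 + \<bar>u\<bar> + \<bar>v\<bar>)"
      by (intro onorm_le) (simp add: mult.commute[of _ "cmod _"] mult_right_mono)
  qed auto
  then show ?thesis
    using that C(1) by simp
qed

lemma cmod_cis_diff_le: "cmod (cis v - cis u) \<le> \<bar>v - u\<bar>"
proof -
  have "cmod (cis v - cis u) \<le> 1 * norm (v - u)"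
  proof (rule differentiable_bound[of UNIV])
    show "(cis has_derivative (\<lambda>h. h *\<^sub>R (\<i> * cis x))) (at x within UNIV)" for x
      by (auto intro!: derivative_eq_intros)
    show "onorm (\<lambda>h. h *\<^sub>R (\<i> * cis x)) \<le> 1" for x
      by (intro onorm_le) (simp add: norm_mult)
  qed auto
  then show ?thesis by simp
qed

text \<open>Near \<open>c\<close> the difference quotient is within \<open>1\<close> of
  \<open>D\<close>. Only increments from \<open>c\<close> itself are controlled, which suffices for
  the width function.\<close>

lemma has_real_derivative_local_lipschitz:
  assumes "(f has_real_derivative D) (at c)"
  obtains d where "0 < d" "\<And>u. \<bar>u - c\<bar> < d \<Longrightarrow> \<bar>f u - f c\<bar> \<le> (\<bar>D\<bar> + 1) * \<bar>u - c\<bar>"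
proof -
  have "((\<lambda>u. (f u - f c) / (u - c)) \<longlongrightarrow> D) (at c)"
    using assms by (rule has_field_derivativeD)
  from tendstoD[OF this zero_less_one] obtain d where "0 < d"
    and d: "\<And>u. u \<noteq> c \<Longrightarrow> dist u c < d \<Longrightarrow> dist ((f u - f c) / (u - c)) D < 1"
    unfolding eventually_at by blast
  have "\<bar>f u - f c\<bar> \<le> (\<bar>D\<bar> + 1) * \<bar>u - c\<bar>" if "\<bar>u - c\<bar> < d" for u
  proof (cases "u = c")
    case False
    have "\<bar>(f u - f c) / (u - c)\<bar> \<le> \<bar>D\<bar> + 1"
      using d[OF False] that unfolding dist_real_def by linarith
    then show ?thesis
      using False by (simp add: abs_divide pos_divide_le_eq)
  qed simp
  then show ?thesis
    using that \<open>0 < d\<close> by blast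
qed

text \<open>One factor \<open>1 + |s|\<close> pays for the linear growth of the Lipschitz constant
  in \<open>tame_lipschitz\<close>, the other for the increment of an argument
  \<open>p + q * s\<close>.\<close>

lemma norm_schwartz_weight_integrable:
  assumes "schwartz w"
  shows "integrable lborel (\<lambda>s. (1 + \<bar>s\<bar>)\<^sup>2 * cmod (w s))"
proof -
  have "(\<lambda>s. (1 + \<bar>s\<bar>)\<^sup>2 * cmod (w s))
      = (\<lambda>s. cmod (of_real (s ^ 0) * w s) + 2 * cmod (of_real (s ^ 1) * w s)
          + cmod (of_real (s ^ 2) * w s))"
    by (auto simp: norm_mult norm_power power2_sum algebra_simps)
  moreover have "integrable lborel (\<lambda>s. cmod (of_real (s ^ 0) * w s)
      + 2 * cmod (of_real (s ^ 1) * w s) + cmod (of_real (s ^ 2) * w s))"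
    by (intro Bochner_Integration.integrable_add integrable_norm integrable_mult_right
          schwartz_integrable schwartz_times_power assms)
  ultimately show ?thesis
    by simp
qed

lemma lin_growth_integrable:
  assumes "lin_growth y" "schwartz w"
  shows "integrable lborel (\<lambda>s. y (p + q * s) * w s * cis (r * s))"
proof -
  obtain C where C: "0 \<le> C" "\<And>u. cmod (y u) \<le> C * (1 + \<bar>u\<bar>)"
    using lin_growthE[OF assms(1)] by blast
  let ?D = "C * (1 + \<bar>p\<bar> + \<bar>q\<bar>)"
  have "integrable lborel (\<lambda>s. ?D * ((1 + \<bar>s\<bar>)\<^sup>2 * cmod (w s)))"
    by (intro integrable_mult_right norm_schwartz_weight_integrable assms)
  then show ?thesis
  proof (rule Bochner_Integration.integrable_bound)
    have "continuous_on UNIV (\<lambda>s. y (p + q * s) * w s * cis (r * s))"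
      using assms schwartz_continuous[OF assms(2)] unfolding lin_growth_def
      by (auto intro!: continuous_intros continuous_on_compose2[of UNIV y])
    then show "(\<lambda>s. y (p + q * s) * w s * cis (r * s)) \<in> borel_measurable lborel"
      by (simp add: borel_measurable_continuous_onI)
    have "cmod (y (p + q * s) * w s * cis (r * s)) \<le> ?D * ((1 + \<bar>s\<bar>)\<^sup>2 * cmod (w s))" for s
    proof -
      have "1 + \<bar>p + q * s\<bar> \<le> 1 + \<bar>p\<bar> + \<bar>q\<bar> * \<bar>s\<bar>"
        using abs_triangle_ineq[of p "q * s"] by (simp add: abs_mult)
      also have "\<dots> \<le> (1 + \<bar>p\<bar> + \<bar>q\<bar>) * (1 + \<bar>s\<bar>)"
        by (simp add: algebra_simps)
      also have "\<dots> \<le> (1 + \<bar>p\<bar> + \<bar>q\<bar>) * (1 + \<bar>s\<bar>)\<^sup>2"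
        by (intro mult_left_mono self_le_power) auto
      finally have "C * (1 + \<bar>p + q * s\<bar>) \<le> C * ((1 + \<bar>p\<bar> + \<bar>q\<bar>) * (1 + \<bar>s\<bar>)\<^sup>2)"
        using C(1) by (rule mult_left_mono)
      then have "cmod (y (p + q * s)) \<le> C * ((1 + \<bar>p\<bar> + \<bar>q\<bar>) * (1 + \<bar>s\<bar>)\<^sup>2)"
        using C(2)[of "p + q * s"] by linarith
      from mult_right_mono[OF this, of "cmod (w s)"] show ?thesis
        by (simp add: norm_mult mult.assoc)
    qed
    moreover have "0 \<le> ?D * ((1 + \<bar>s\<bar>)\<^sup>2 * cmod (w s))" for s
      using C(1) by simp
    ultimately show "AE s in lborel. norm (y (p + q * s) * w s * cis (r * s))
        \<le> norm (?D * ((1 + \<bar>s\<bar>)\<^sup>2 * cmod (w s)))"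
      by (intro AE_I2) (metis abs_of_nonneg real_norm_def)
  qed
qed

lemma osc_integrable:
  assumes "lin_growth y" "schwartz w"
  shows "integrable lborel (\<lambda>s. y (p * s) * w s * cis (- (2 * pi * r * s)))"
  using lin_growth_integrable[OF assms, of 0 p "- (2 * pi * r)"] by simp

lemma osc_add:
  assumes "lin_growth y" "lin_growth z" "schwartz w"
  shows "osc (\<lambda>u. y u + z u) w p r = osc y w p r + osc z w p r"
  using osc_integrable[OF assms(1,3)] osc_integrable[OF assms(2,3)]
  by (simp add: osc_def distrib_right)

lemma osc_cmult: "osc (\<lambda>u. c * y u) w p r = c * osc y w p r"
  by (simp add: osc_def mult.assoc)

lemma osc_sum:
  assumes "finite I" "\<And>i. i \<in> I \<Longrightarrow> lin_growth (y i)" "schwartz w"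
  shows "osc (\<lambda>u. \<Sum>i\<in>I. y i u) w p r = (\<Sum>i\<in>I. osc (y i) w p r)"
  using assms osc_integrable[OF assms(2,3)] by (simp add: osc_def sum_distrib_right)

text \<open>A factor evaluated at \<open>p * s\<close> splits into the scale and a moment of the
  window; this is how the quadratic phase of a chirp raises the moment.\<close>

lemma osc_times_id: "osc (\<lambda>u. of_real u * y u) w p r = of_real p * osc y (\<lambda>s. of_real s * w s) p r"
  by (simp add: osc_def mult_ac flip: integral_mult_right_zero)

lemma osc_window_add:
  assumes "lin_growth y" "schwartz v" "schwartz w"
  shows "osc y (\<lambda>s. v s + w s) p r = osc y v p r + osc y w p r"
  using osc_integrable[OF assms(1,2)] osc_integrable[OF assms(1,3)]
  by (simp add: osc_def distrib_right distrib_left)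

text \<open>Covers both derivatives: for the scale only \<open>q\<close> varies, while for the time
  \<open>b\<close> the shift \<open>b\<close>, the dilation \<open>a * sig S b\<close> and the
  modulation by \<open>sig S b\<close> move together. The increment splits into that of
  \<open>y\<close> and that of the oscillating factor.\<close>

lemma has_vector_derivative_modulated:
  assumes y: "tame y y'" and w: "schwartz w"
    and p: "(p has_real_derivative p') (at c)"
    and q: "(q has_real_derivative q') (at c)"
    and r: "(r has_real_derivative r') (at c)"
  shows "((\<lambda>u. LBINT s. y (p u + q u * s) * w s * cis (r u * s)) has_vector_derivative
    (LBINT s. (of_real (p' + q' * s) * y' (p c + q c * s)
        + \<i> * of_real (r' * s) * y (p c + q c * s)) * w s * cis (r c * s))) (at c)"
proof -
  obtain C where C: "0 \<le> C" "\<And>u v. cmod (y v - y u) \<le> C * (1 + \<bar>u\<bar> + \<bar>v\<bar>) * \<bar>v - u\<bar>"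
    using tame_lipschitz[OF y] by blast
  obtain B where B: "0 \<le> B" "\<And>u. cmod (y u) \<le> B"
    using tame_boundE[OF y] by blast
  obtain dp where dp: "0 < dp" "\<And>u. \<bar>u - c\<bar> < dp \<Longrightarrow> \<bar>p u - p c\<bar> \<le> (\<bar>p'\<bar> + 1) * \<bar>u - c\<bar>"
    using has_real_derivative_local_lipschitz[OF p] by blast
  obtain dq where dq: "0 < dq" "\<And>u. \<bar>u - c\<bar> < dq \<Longrightarrow> \<bar>q u - q c\<bar> \<le> (\<bar>q'\<bar> + 1) * \<bar>u - c\<bar>"
    using has_real_derivative_local_lipschitz[OF q] by blast
  obtain dr where dr: "0 < dr" "\<And>u. \<bar>u - c\<bar> < dr \<Longrightarrow> \<bar>r u - r c\<bar> \<le> (\<bar>r'\<bar> + 1) * \<bar>u - c\<bar>"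
    using has_real_derivative_local_lipschitz[OF r] by blast
  \<comment> \<open>The \<open>1\<close> in the minimum gives \<open>L * |u - c| <= L\<close>, which
    bounds the moved argument independently of \<open>u\<close>; \<open>M\<close> then bounds the
    growth factor of \<open>tame_lipschitz\<close> by \<open>M * (1 + |s|)\<close>.\<close>
  define d where "d = min 1 (min dp (min dq dr))"
  define L where "L = \<bar>p'\<bar> + \<bar>q'\<bar> + \<bar>r'\<bar> + 1"
  define M where "M = 1 + 2 * \<bar>p c\<bar> + 2 * \<bar>q c\<bar> + L"
  have L: "0 \<le> L" and M: "0 \<le> M"
    by (auto simp: L_def M_def)
  have lip: "\<bar>p u - p c\<bar> \<le> L * \<bar>u - c\<bar>" "\<bar>q u - q c\<bar> \<le> L * \<bar>u - c\<bar>" "\<bar>r u - r c\<bar> \<le> L * \<bar>u - c\<bar>"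
    if "\<bar>u - c\<bar> < d" for u
  proof -
    have "(\<bar>p'\<bar> + 1) * \<bar>u - c\<bar> \<le> L * \<bar>u - c\<bar>" "(\<bar>q'\<bar> + 1) * \<bar>u - c\<bar> \<le> L * \<bar>u - c\<bar>"
      "(\<bar>r'\<bar> + 1) * \<bar>u - c\<bar> \<le> L * \<bar>u - c\<bar>"
      by (intro mult_right_mono; simp add: L_def)+
    with dp(2)[of u] dq(2)[of u] dr(2)[of u] that
    show "\<bar>p u - p c\<bar> \<le> L * \<bar>u - c\<bar>" "\<bar>q u - q c\<bar> \<le> L * \<bar>u - c\<bar>" "\<bar>r u - r c\<bar> \<le> L * \<bar>u - c\<bar>"
      by (auto simp: d_def)
  qed
  \<comment> \<open>The coefficient \<open>C * M * L\<close> accounts for the increment of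
    \<open>y\<close>, and \<open>B * L\<close> for that of the oscillating factor.\<close>
  define G where "G s = (C * M * L + B * L) * ((1 + \<bar>s\<bar>)\<^sup>2 * cmod (w s))" for s
  have cy: "continuous_on UNIV y" and cy': "continuous_on UNIV y'" and cw: "continuous_on UNIV w"
    using tameD[OF y] schwartz_continuous[OF w] by (auto simp: lin_growth_def)
  show ?thesis
  proof (rule has_vector_derivative_lebesgue_integral[where d = d and G = G])
    show "0 < d"
      using dp dq dr by (simp add: d_def)
    show "integrable lborel (\<lambda>s. y (p u + q u * s) * w s * cis (r u * s))" for u
      by (intro lin_growth_integrable tame_lin_growth[OF y] w)
    show "integrable lborel G"
      unfolding G_def by (intro integrable_mult_right norm_schwartz_weight_integrable w)
    have "continuous_on UNIV (\<lambda>s. (of_real (p' + q' * s) * y' (p c + q c * s)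
        + \<i> * of_real (r' * s) * y (p c + q c * s)) * w s * cis (r c * s))"
      using cw by (auto intro!: continuous_intros continuous_on_compose2[OF cy]
            continuous_on_compose2[OF cy'])
    then show "(\<lambda>s. (of_real (p' + q' * s) * y' (p c + q c * s)
        + \<i> * of_real (r' * s) * y (p c + q c * s)) * w s * cis (r c * s)) \<in> borel_measurable lborel"
      by (simp add: borel_measurable_continuous_onI)
    show "((\<lambda>u. y (p u + q u * s) * w s * cis (r u * s)) has_vector_derivative
        (of_real (p' + q' * s) * y' (p c + q c * s)
        + \<i> * of_real (r' * s) * y (p c + q c * s)) * w s * cis (r c * s)) (at c)" for s
    proof -
      have "((\<lambda>u. p u + q u * s) has_real_derivative p' + q' * s) (at c)"
        by (auto intro!: derivative_eq_intros p q)
      then have 1: "((\<lambda>u. y (p u + q u * s)) has_vector_derivative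
          (p' + q' * s) *\<^sub>R y' (p c + q c * s)) (at c)"
        using vector_diff_chain_at[of "\<lambda>u. p u + q u * s" "p' + q' * s" c y] tameD(1)[OF y]
        by (simp add: comp_def has_real_derivative_iff_has_vector_derivative)
      have "((\<lambda>u. r u * s) has_real_derivative r' * s) (at c)"
        by (auto intro!: derivative_eq_intros r)
      then have 2: "((\<lambda>u. cis (r u * s)) has_vector_derivative
          (r' * s) *\<^sub>R (\<i> * cis (r c * s))) (at c)"
        using has_derivative_cis[of "\<lambda>u. r u * s" "(*) (r' * s)"]
        by (simp add: has_vector_derivative_def has_field_derivative_def mult.commute)
      show ?thesis
        by (rule has_vector_derivative_eq_rhs,
            rule has_vector_derivative_mult[OF has_vector_derivative_mult_left[OF 1] 2])
           (simp add: scaleR_conv_of_real algebra_simps)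
    qed
    fix u s :: real assume u: "\<bar>u - c\<bar> < d"
    have Lu: "L * \<bar>u - c\<bar> \<le> L"
      using u L mult_left_mono[of "\<bar>u - c\<bar>" 1 L] by (simp add: d_def)
    have pq: "\<bar>(p u - p c) + (q u - q c) * s\<bar> \<le> L * \<bar>u - c\<bar> * (1 + \<bar>s\<bar>)"
    proof -
      have "\<bar>(q u - q c) * s\<bar> \<le> L * \<bar>u - c\<bar> * \<bar>s\<bar>"
        unfolding abs_mult by (rule mult_right_mono[OF lip(2)[OF u] abs_ge_zero])
      then show ?thesis
        using abs_triangle_ineq[of "p u - p c" "(q u - q c) * s"] lip(1)[OF u]
        unfolding distrib_left by linarith
    qed
    have "L * \<bar>u - c\<bar> * (1 + \<bar>s\<bar>) \<le> L * (1 + \<bar>s\<bar>)"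
      using Lu by (intro mult_right_mono) auto
    moreover have qc: "\<bar>p c + q c * s\<bar> \<le> \<bar>p c\<bar> + \<bar>q c\<bar> * \<bar>s\<bar>"
      using abs_triangle_ineq[of "p c" "q c * s"] by (simp add: abs_mult)
    moreover have "\<bar>p u + q u * s\<bar> \<le> \<bar>(p u - p c) + (q u - q c) * s\<bar> + \<bar>p c + q c * s\<bar>"
      using abs_triangle_ineq[of "(p u - p c) + (q u - q c) * s" "p c + q c * s"]
      by (simp add: left_diff_distrib)
    ultimately have "\<bar>p u + q u * s\<bar> \<le> L * (1 + \<bar>s\<bar>) + (\<bar>p c\<bar> + \<bar>q c\<bar> * \<bar>s\<bar>)"
      using pq by linarith
    moreover have "1 + A + B \<le> 1 + (X + 2 * Y)" if "A \<le> Y" "B \<le> X + Y" for A B X Y :: real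
      using that by linarith
    ultimately have "1 + \<bar>p c + q c * s\<bar> + \<bar>p u + q u * s\<bar>
        \<le> 1 + (L * (1 + \<bar>s\<bar>) + 2 * (\<bar>p c\<bar> + \<bar>q c\<bar> * \<bar>s\<bar>))"
      using qc by blast
    also have "\<dots> \<le> M * (1 + \<bar>s\<bar>)"
      by (simp add: M_def algebra_simps)
    finally have "cmod (y (p u + q u * s) - y (p c + q c * s))
        \<le> C * (M * (1 + \<bar>s\<bar>)) * (L * \<bar>u - c\<bar> * (1 + \<bar>s\<bar>))"
      using pq C(1) L M
      by (intro order_trans[OF C(2)] mult_mono mult_left_mono) (auto simp: algebra_simps)
    also have "\<dots> = (C * M * L) * \<bar>u - c\<bar> * (1 + \<bar>s\<bar>)\<^sup>2"
      by (simp add: power2_eq_square)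
    finally have 1: "cmod (y (p u + q u * s) - y (p c + q c * s)) \<le> (C * M * L) * \<bar>u - c\<bar> * (1 + \<bar>s\<bar>)\<^sup>2" .
    have "cmod (cis (r u * s) - cis (r c * s)) \<le> \<bar>r u - r c\<bar> * \<bar>s\<bar>"
      using cmod_cis_diff_le[of "r u * s" "r c * s"] by (simp add: abs_mult flip: left_diff_distrib)
    also have "\<dots> \<le> L * \<bar>u - c\<bar> * (1 + \<bar>s\<bar>)\<^sup>2"
      using lip(3)[OF u] L by (intro mult_mono) (auto simp: power2_eq_square algebra_simps)
    finally have 2: "B * cmod (cis (r u * s) - cis (r c * s)) \<le> B * (L * \<bar>u - c\<bar> * (1 + \<bar>s\<bar>)\<^sup>2)"
      using B(1) by (rule mult_left_mono)
    have "y (p u + q u * s) * w s * cis (r u * s) - y (p c + q c * s) * w s * cis (r c * s)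
        = ((y (p u + q u * s) - y (p c + q c * s)) * cis (r u * s)
          + y (p c + q c * s) * (cis (r u * s) - cis (r c * s))) * w s"
      by (simp add: algebra_simps)
    also have "cmod \<dots> \<le> (cmod (y (p u + q u * s) - y (p c + q c * s))
        + B * cmod (cis (r u * s) - cis (r c * s))) * cmod (w s)"
      unfolding norm_mult
      by (intro mult_right_mono order_trans[OF norm_triangle_ineq] add_mono)
         (auto simp: norm_mult B(2) mult_right_mono)
    also have "\<dots> \<le> ((C * M * L) * \<bar>u - c\<bar> * (1 + \<bar>s\<bar>)\<^sup>2 + B * (L * \<bar>u - c\<bar> * (1 + \<bar>s\<bar>)\<^sup>2)) * cmod (w s)"
      using 1 2 by (intro mult_right_mono add_mono) auto
    also have "\<dots> = \<bar>u - c\<bar> * G s"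
      by (simp add: G_def algebra_simps)
    finally show "cmod (y (p u + q u * s) * w s * cis (r u * s)
        - y (p c + q c * s) * w s * cis (r c * s)) \<le> \<bar>u - c\<bar> * G s" .
  qed
qed

lemma has_vector_derivative_osc:
  assumes "tame y y'" "schwartz w"
  shows "((\<lambda>p. osc y w p r) has_vector_derivative osc y' (\<lambda>s. of_real s * w s) p r) (at p)"
  using has_vector_derivative_modulated[OF assms, of "\<lambda>_. 0" 0 p "\<lambda>u. u" 1 "\<lambda>_. - (2 * pi * r)" 0]
  by (simp add: osc_def mult_ac)

text \<open>The product of signal, window and oscillation has integrable derivative and vanishes at
  both ends, because \<open>y\<close> is bounded and \<open>v\<close> decays; so its derivative
  integrates to zero.\<close>

lemma osc_by_parts:
  assumes y: "tame y y'" and v: "schwartz v"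
  shows "of_real p * osc y' v p r = 2 * pi * \<i> * of_real r * osc y v p r - osc y (vderiv v) p r"
proof -
  let ?e = "\<lambda>s. cis (- (2 * pi * r * s))"
  define F where "F s = y (p * s) * v s * ?e s" for s
  define f1 where "f1 s = y' (p * s) * v s * ?e s" for s
  define f2 where "f2 s = y (p * s) * vderiv v s * ?e s" for s
  define f where "f s = of_real p * f1 s + f2 s - 2 * pi * \<i> * of_real r * F s" for s
  have lg: "lin_growth y" "lin_growth y'" "schwartz (vderiv v)"
    using tame_lin_growth[OF y] tameD(2)[OF y] schwartz_vderiv[OF v] by auto
  have int: "integrable lborel F" "integrable lborel f1" "integrable lborel f2"
    unfolding F_def f1_def f2_def by (intro osc_integrable lg v)+
  have intf: "integrable lborel f"
    unfolding f_def using int by simp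
  have F: "(F has_vector_derivative f s) (at s)" for s
  proof -
    have 1: "((\<lambda>s. y (p * s)) has_vector_derivative p *\<^sub>R y' (p * s)) (at s)"
    proof -
      have "((\<lambda>s. p * s) has_vector_derivative p) (at s)"
        by (auto intro!: derivative_eq_intros)
      from vector_diff_chain_at[OF this tameD(1)[OF y]] show ?thesis
        by (simp add: comp_def)
    qed
    have "((\<lambda>s. - (2 * pi * r * s)) has_derivative (\<lambda>h. - (2 * pi * r * h))) (at s)"
      by (auto intro!: derivative_eq_intros)
    from has_derivative_cis[OF this]
    have 2: "(?e has_vector_derivative (- (2 * pi * r)) *\<^sub>R (\<i> * ?e s)) (at s)"
      unfolding has_vector_derivative_def by (simp add: mult_ac)
    show ?thesis
      unfolding F_def f_def f1_def f2_def
      by (rule has_vector_derivative_eq_rhs,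
          rule has_vector_derivative_mult[OF has_vector_derivative_mult[OF 1 schwartz_has_vderiv[OF v]] 2])
         (simp add: scaleR_conv_of_real algebra_simps)
  qed
  have cont: "continuous_on UNIV f"
  proof -
    have "continuous_on UNIV y" "continuous_on UNIV y'" "continuous_on UNIV v" "continuous_on UNIV (vderiv v)"
      using lg v schwartz_continuous by (auto simp: lin_growth_def)
    then show ?thesis
      unfolding f_def f1_def f2_def F_def
      by (auto intro!: continuous_intros continuous_on_compose2[of UNIV y] continuous_on_compose2[of UNIV y'])
  qed
  obtain B where B: "0 \<le> B" "\<And>u. cmod (y u) \<le> B"
    using tame_boundE[OF y] by blast
  have "(F \<longlongrightarrow> 0) at_infinity"
  proof (rule Lim_null_comparison)
    show "\<forall>\<^sub>F s in at_infinity. cmod (F s) \<le> B * cmod (v s)"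
      by (simp add: F_def norm_mult B(2) mult_right_mono)
    show "((\<lambda>s. B * cmod (v s)) \<longlongrightarrow> 0) at_infinity"
      by (intro tendsto_mult_right_zero tendsto_norm_zero schwartz_tendsto_0 v)
  qed
  then have lim: "(F \<longlongrightarrow> 0) at_top" "(F \<longlongrightarrow> 0) at_bot"
    by (auto intro: tendsto_mono[OF at_top_le_at_infinity] tendsto_mono[OF at_bot_le_at_infinity])
  have "(LBINT s=-\<infinity>..\<infinity>. f s) = 0 - 0"
    using F cont intf lim
    by (intro interval_integral_FTC_integrable[where F = F])
       (auto simp: continuous_on_eq_continuous_at set_integrable_def ereal_tendsto_simps)
  then have "integral\<^sup>L lborel f = 0"
    by (simp add: interval_lebesgue_integral_def set_lebesgue_integral_def)
  moreover have "integral\<^sup>L lborel f = of_real p * osc y' v p r + osc y (vderiv v) p r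
      - 2 * pi * \<i> * of_real r * osc y v p r"
  proof -
    have "integral\<^sup>L lborel f = of_real p * integral\<^sup>L lborel f1 + integral\<^sup>L lborel f2
        - 2 * pi * \<i> * of_real r * integral\<^sup>L lborel F"
      unfolding f_def using int by simp
    then show ?thesis
      by (simp add: osc_def F_def[abs_def] f1_def[abs_def] f2_def[abs_def])
  qed
  ultimately show ?thesis
    by (simp add: algebra_simps)
qed

lemma continuous_on_osc:
  assumes "tame y y'" "schwartz w"
  shows "continuous_on A (\<lambda>p. osc y w p r)"
  using has_vector_derivative_osc[OF assms]
  by (meson continuous_at_imp_continuous_on has_vector_derivative_continuous)

section \<open>The transforms as oscillatory integrals\<close>

text \<open>The chain rule produces \<open>y'\<close> against the window \<open>s * w\<close>;
  integration by parts removes \<open>y'\<close> again. The result contains transforms of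
  \<open>y\<close> alone and can be differentiated once more, although \<open>y'\<close> need not be
  tame.\<close>

lemma has_vector_derivative_osc_scale:
  assumes y: "tame y y'" and w: "schwartz w" and "a \<noteq> 0" "\<sigma> \<noteq> 0"
  shows "((\<lambda>a. osc y w (a * \<sigma>) r) has_vector_derivative
    (2 * pi * \<i> * of_real r * osc y (\<lambda>s. of_real s * w s) (a * \<sigma>) r
      - osc y w (a * \<sigma>) r - osc y (\<lambda>s. of_real s * vderiv w s) (a * \<sigma>) r) / of_real a) (at a)"
proof -
  have "((\<lambda>a. a * \<sigma>) has_vector_derivative \<sigma>) (at a)"
    by (auto intro!: derivative_eq_intros)
  from vector_diff_chain_at[OF this has_vector_derivative_osc[OF y w]]
  have 1: "((\<lambda>a. osc y w (a * \<sigma>) r) has_vector_derivative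
      of_real \<sigma> * osc y' (\<lambda>s. of_real s * w s) (a * \<sigma>) r) (at a)"
    by (simp add: comp_def scaleR_conv_of_real)
  have "osc y (vderiv (\<lambda>s. of_real s * w s)) (a * \<sigma>) r
      = osc y w (a * \<sigma>) r + osc y (\<lambda>s. of_real s * vderiv w s) (a * \<sigma>) r"
    unfolding vderiv_times_id[OF w]
    by (intro osc_window_add tame_lin_growth[OF y] w schwartz_times_id schwartz_vderiv)
  with osc_by_parts[OF y schwartz_times_id[OF w], of "a * \<sigma>" r]
  have "of_real \<sigma> * osc y' (\<lambda>s. of_real s * w s) (a * \<sigma>) r
      = (2 * pi * \<i> * of_real r * osc y (\<lambda>s. of_real s * w s) (a * \<sigma>) r
      - osc y w (a * \<sigma>) r - osc y (\<lambda>s. of_real s * vderiv w s) (a * \<sigma>) r) / of_real a"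
    using assms(3) by (simp add: field_simps)
  with 1 show ?thesis
    by simp
qed

definition chirp :: "real \<Rightarrow> real \<Rightarrow> real \<Rightarrow> complex" where
  "chirp \<alpha> \<beta> u = cis (2 * pi * (\<alpha> * u + 1/2 * \<beta> * u\<^sup>2))"

lemma norm_chirp [simp]: "norm (chirp \<alpha> \<beta> u) = 1"
  by (simp add: chirp_def)

definition chirp' :: "real \<Rightarrow> real \<Rightarrow> real \<Rightarrow> complex" where
  "chirp' \<alpha> \<beta> u = 2 * pi * \<i> * (of_real \<alpha> * chirp \<alpha> \<beta> u + of_real \<beta> * (of_real u * chirp \<alpha> \<beta> u))"

lemma tame_chirp: "tame (chirp \<alpha> \<beta>) (chirp' \<alpha> \<beta>)"
proof -
  have der: "(chirp \<alpha> \<beta> has_vector_derivative chirp' \<alpha> \<beta> u) (at u)" for u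
  proof -
    have "((\<lambda>u. 2 * pi * (\<alpha> * u + 1/2 * \<beta> * u\<^sup>2)) has_derivative (*) (2 * pi * (\<alpha> + \<beta> * u))) (at u)"
      by (auto intro!: derivative_eq_intros simp: fun_eq_iff algebra_simps)
    from has_derivative_cis[OF this] show ?thesis
      unfolding has_vector_derivative_def chirp_def[abs_def] chirp'_def
      by (rule has_derivative_eq_rhs) (simp add: fun_eq_iff scaleR_conv_of_real algebra_simps)
  qed
  have "cmod (chirp' \<alpha> \<beta> u) \<le> (2 * pi * (\<bar>\<alpha>\<bar> + \<bar>\<beta>\<bar>)) * (1 + \<bar>u\<bar>)" for u
  proof -
    have "cmod (of_real \<alpha> * chirp \<alpha> \<beta> u + of_real \<beta> * (of_real u * chirp \<alpha> \<beta> u)) \<le> \<bar>\<alpha>\<bar> + \<bar>\<beta>\<bar> * \<bar>u\<bar>"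
      by (rule order_trans[OF norm_triangle_ineq]) (simp add: norm_mult)
    also have "\<dots> \<le> (\<bar>\<alpha>\<bar> + \<bar>\<beta>\<bar>) * (1 + \<bar>u\<bar>)"
      by (simp add: algebra_simps)
    finally show ?thesis
      by (simp add: chirp'_def norm_mult mult.assoc)
  qed
  moreover have "continuous_on UNIV (chirp' \<alpha> \<beta>)"
    unfolding chirp'_def[abs_def] chirp_def by (intro continuous_intros)
  ultimately have "lin_growth (chirp' \<alpha> \<beta>)"
    by (rule lin_growthI[rotated])
  then show ?thesis
    unfolding tame_def using der by (auto intro: exI[of _ 1])
qed

lemma lin_growth_chirp: "lin_growth (chirp \<alpha> \<beta>)"
  using tame_chirp by (rule tame_lin_growth)

lemma lin_growth_times_id_chirp: "lin_growth (\<lambda>u. of_real u * chirp \<alpha> \<beta> u)"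
  by (rule lin_growthI[of _ 1])
     (auto simp: norm_mult chirp_def intro!: continuous_intros)

lemma osc_chirp':
  assumes "schwartz w"
  shows "osc (chirp' \<alpha> \<beta>) w p r = 2 * pi * \<i> * (of_real \<alpha> * osc (chirp \<alpha> \<beta>) w p r
      + of_real (\<beta> * p) * osc (chirp \<alpha> \<beta>) (\<lambda>s. of_real s * w s) p r)"
  unfolding chirp'_def[abs_def]
  by (simp add: osc_cmult osc_add osc_times_id lin_growth_cmult lin_growth_chirp
      lin_growth_times_id_chirp assms mult.assoc)

text \<open>For a chirp the derivative is explicit, so it is kept as higher moments instead of being
  integrated by parts; this is the shape of \<open>sumE\<close> and \<open>sumF\<close>.\<close>

lemma has_vector_derivative_osc_chirp:
  assumes "schwartz w"
  shows "((\<lambda>a. osc (chirp \<alpha> \<beta>) w (a * \<sigma>) r) has_vector_derivative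
    of_real \<sigma> * (2 * pi * \<i> * (of_real \<alpha> * osc (chirp \<alpha> \<beta>) (\<lambda>s. of_real s * w s) (a * \<sigma>) r
      + of_real (\<beta> * (a * \<sigma>)) * osc (chirp \<alpha> \<beta>) (\<lambda>s. of_real s * (of_real s * w s)) (a * \<sigma>) r))) (at a)"
proof -
  have "((\<lambda>a. a * \<sigma>) has_vector_derivative \<sigma>) (at a)"
    by (auto intro!: derivative_eq_intros)
  from vector_diff_chain_at[OF this has_vector_derivative_osc[OF tame_chirp assms]]
  show ?thesis
    by (simp add: comp_def scaleR_conv_of_real osc_chirp' schwartz_times_id assms)
qed

lemma lborel_integral_dilate:
  fixes f :: "real \<Rightarrow> complex"
  assumes "0 < \<sigma>"
  shows "(LBINT t. f t) = (LBINT s. of_real \<sigma> * f (\<sigma> * s))"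
  using lborel_integral_real_affine[of \<sigma> f 0] assms by (simp add: scaleR_conv_of_real)

lemma acwt_eq_osc:
  assumes "0 < sig S b"
  shows "acwt S w a b = osc (\<lambda>u. signal S (b + u)) w (a * sig S b) (freq S * sig S b)"
  unfolding acwt_def osc_def using assms
  by (subst lborel_integral_dilate[OF assms]) (simp add: mult_ac)

text \<open>The residual \<open>xres\<close> depends on \<open>a\<close> and \<open>t\<close> only
  through \<open>a * t\<close>. As a function of this product it is independent of the scale, and
  \<open>a\<close> enters only through the dilation in \<open>osc\<close>.\<close>

definition resid :: "awsst \<Rightarrow> real \<Rightarrow> real \<Rightarrow> complex" where
  "resid S b u = signal S (b + u)
    - (\<Sum>k=1..ncomp S. xcomp S k b * chirp (phs1 S k b) (phs2 S k b) u)"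

lemma res_eq_osc:
  assumes "0 < sig S b"
  shows "res S w a b = osc (resid S b) w (a * sig S b) (freq S * sig S b)"
  unfolding res_def osc_def resid_def xres_def chirp_def using assms
  by (subst lborel_integral_dilate[OF assms]) (simp add: mult_ac)

lemma chirpG_eq_osc:
  assumes "0 < sig S b"
  shows "chirpG S j k a b = osc (chirp (phs1 S k b) (phs2 S k b))
    (\<lambda>s. of_real (s ^ j) * win S s) (a * sig S b) (freq S * sig S b)"
  unfolding chirpG_def osc_def chirp_def using assms
  by (subst lborel_integral_dilate[OF assms])
     (simp add: mult_ac power_mult_distrib)

definition xcomp' :: "awsst \<Rightarrow> nat \<Rightarrow> real \<Rightarrow> complex" where
  "xcomp' S k t = (of_real (deriv (amp S k) t) + 2 * pi * \<i> * of_real (amp S k t * phs1 S k t))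
     * cis (2 * pi * phs S k t)"

definition signal' :: "awsst \<Rightarrow> real \<Rightarrow> complex" where
  "signal' S t = (\<Sum>k=1..ncomp S. xcomp' S k t)"

definition resid' :: "awsst \<Rightarrow> real \<Rightarrow> real \<Rightarrow> complex" where
  "resid' S b u = signal' S (b + u)
    - (\<Sum>k=1..ncomp S. xcomp S k b * chirp' (phs1 S k b) (phs2 S k b) u)"

lemma C_diff_3D:
  assumes "C_diff 3 (phs S k)"
  shows "(phs S k has_real_derivative phs1 S k t) (at t)"
    and "(phs1 S k has_real_derivative phs2 S k t) (at t)"
    and "(phs2 S k has_real_derivative phs3 S k t) (at t)"
proof -
  have d: "(deriv ^^ j) (phs S k) field_differentiable (at t)" if "j < 3" for j
    using assms that unfolding C_diff_def by blast
  show "(phs S k has_real_derivative phs1 S k t) (at t)"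
    using d[of 0] by (simp add: phs1_def DERIV_deriv_iff_field_differentiable)
  show "(phs1 S k has_real_derivative phs2 S k t) (at t)"
    using d[of 1] by (simp add: phs1_def phs2_def DERIV_deriv_iff_field_differentiable numeral_2_eq_2)
  show "(phs2 S k has_real_derivative phs3 S k t) (at t)"
    using d[of 2] by (simp add: phs2_def phs3_def DERIV_deriv_iff_field_differentiable
        numeral_2_eq_2 numeral_3_eq_3)
qed

lemma C_diff_2D:
  assumes "C_diff 2 f"
  shows "(f has_real_derivative deriv f t) (at t)" "continuous_on UNIV (deriv f)"
proof -
  have d: "(deriv ^^ j) f field_differentiable (at t)" if "j < 2" for j t
    using assms that unfolding C_diff_def by blast
  show "(f has_real_derivative deriv f t) (at t)"
    using d[of 0] by (simp add: DERIV_deriv_iff_field_differentiable)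
  have "deriv f field_differentiable (at t)" for t
    using d[of 1] by simp
  then show "continuous_on UNIV (deriv f)"
    by (intro continuous_at_imp_continuous_on ballI field_differentiable_imp_continuous_at)
qed

lemma bounded_derivative_lin_growth:
  fixes f :: "real \<Rightarrow> real"
  assumes "\<And>t. (f has_real_derivative f' t) (at t)" and "\<And>t. \<bar>f' t\<bar> \<le> B"
  shows "\<bar>f v - f u\<bar> \<le> B * \<bar>v - u\<bar>"
  using field_differentiable_bound[of UNIV f f' B v u] assms by simp

text \<open>The bound on the second phase derivative makes the frequency grow at most linearly; the
  amplitude and its derivative are bounded.\<close>

lemma tame_xcomp:
  assumes A: "C_diff 2 (amp S k)" "bounded (range (amp S k))" and A': "\<And>t. \<bar>deriv (amp S k) t\<bar> \<le> E"
    and phi: "C_diff 3 (phs S k)" "bounded (range (phs2 S k))"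
  shows "tame (xcomp S k) (xcomp' S k)"
proof -
  obtain C where C: "\<And>t. \<bar>amp S k t\<bar> \<le> C"
    using A(2) by (auto simp: bounded_iff)
  have "0 \<le> C" using C[of 0] by linarith
  have "0 \<le> E" using A'[of 0] by linarith
  obtain M where M: "\<And>t. \<bar>phs2 S k t\<bar> \<le> M"
    using phi(2) by (auto simp: bounded_iff)
  have "0 \<le> M" using M[of 0] by linarith
  have der: "(xcomp S k has_vector_derivative xcomp' S k t) (at t)" for t
  proof -
    have "((\<lambda>t. 2 * pi * phs S k t) has_derivative (*) (2 * pi * phs1 S k t)) (at t)"
      using DERIV_cmult[OF C_diff_3D(1)[OF phi(1)], of "2 * pi"] by (simp add: has_field_derivative_def)
    from has_derivative_cis[OF this]
    have 2: "((\<lambda>t. cis (2 * pi * phs S k t)) has_vector_derivative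
        (2 * pi * phs1 S k t) *\<^sub>R (\<i> * cis (2 * pi * phs S k t))) (at t)"
      unfolding has_vector_derivative_def by (simp add: mult_ac)
    show ?thesis
      unfolding xcomp_def[abs_def] xcomp'_def
      by (rule has_vector_derivative_eq_rhs,
          rule has_vector_derivative_mult[OF has_vector_derivative_of_real[OF C_diff_2D(1)[OF A(1)]] 2])
         (simp add: scaleR_conv_of_real algebra_simps)
  qed
  have bd: "cmod (xcomp S k t) \<le> C" for t
    using C[of t] by (simp add: xcomp_def norm_mult)
  have cont: "continuous_on UNIV (xcomp' S k)"
  proof -
    have "continuous_on UNIV (amp S k)" "continuous_on UNIV (phs S k)" "continuous_on UNIV (phs1 S k)"
      using C_diff_2D(1)[OF A(1)] C_diff_3D[OF phi(1)]
      by (auto intro!: continuous_at_imp_continuous_on intro: DERIV_isCont)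
    then show ?thesis
      unfolding xcomp'_def[abs_def] using C_diff_2D(2)[OF A(1)] by (intro continuous_intros)
  qed
  have "cmod (xcomp' S k t) \<le> (E + 2 * pi * C * (\<bar>phs1 S k 0\<bar> + M)) * (1 + \<bar>t\<bar>)" for t
  proof -
    have "\<bar>phs1 S k t\<bar> \<le> \<bar>phs1 S k 0\<bar> + M * \<bar>t\<bar>"
      using bounded_derivative_lin_growth[OF C_diff_3D(2)[OF phi(1)] M, of t 0] by simp
    then have "\<bar>amp S k t\<bar> * \<bar>phs1 S k t\<bar> \<le> C * (\<bar>phs1 S k 0\<bar> + M * \<bar>t\<bar>)"
      using C[of t] \<open>0 \<le> C\<close> by (intro mult_mono) auto
    also have "\<dots> \<le> C * ((\<bar>phs1 S k 0\<bar> + M) * (1 + \<bar>t\<bar>))"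
      using \<open>0 \<le> C\<close> \<open>0 \<le> M\<close> by (intro mult_left_mono) (auto simp: algebra_simps)
    finally have "2 * pi * (\<bar>amp S k t\<bar> * \<bar>phs1 S k t\<bar>)
        \<le> 2 * pi * (C * ((\<bar>phs1 S k 0\<bar> + M) * (1 + \<bar>t\<bar>)))"
      by (intro mult_left_mono) auto
    moreover have "\<bar>deriv (amp S k) t\<bar> \<le> E * (1 + \<bar>t\<bar>)"
      using A'[of t] \<open>0 \<le> E\<close> mult_nonneg_nonneg[of E "\<bar>t\<bar>"] unfolding distrib_left by linarith
    moreover have "cmod (xcomp' S k t) \<le> \<bar>deriv (amp S k) t\<bar> + 2 * pi * (\<bar>amp S k t\<bar> * \<bar>phs1 S k t\<bar>)"
      unfolding xcomp'_def norm_mult norm_cis mult_1_right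
      by (rule order_trans[OF norm_triangle_ineq]) (simp add: norm_mult abs_mult)
    ultimately show ?thesis
      by (simp add: algebra_simps)
  qed
  then have "lin_growth (xcomp' S k)"
    using cont by (rule lin_growthI[rotated])
  then show ?thesis
    unfolding tame_def using der bd by blast
qed

section \<open>Decomposition of the transforms at a fixed time and their derivatives in the
  scale\<close>

locale awsst_setup =
  fixes S :: awsst and \<alpha> \<tau>0 \<epsilon>1 \<epsilon>3 b :: real
  assumes window: "window_setting S \<alpha> \<tau>0" and signals: "signal_class S \<tau>0 \<epsilon>1 \<epsilon>3"
begin

abbreviation "\<mu> \<equiv> freq S"
abbreviation "\<sigma> \<equiv> sig S b"
abbreviation "g \<equiv> win S"
abbreviation "x \<equiv> \<lambda>u. signal S (b + u)"
abbreviation "x' \<equiv> \<lambda>u. signal' S (b + u)"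
abbreviation "T y w a \<equiv> osc y w (a * \<sigma>) (\<mu> * \<sigma>)"

lemma sig_pos: "0 < sig S t"
  using window unfolding window_setting_def by (smt (verit) divide_pos_pos)

lemma sig_nz [simp]: "sig S t \<noteq> 0"
  using sig_pos[of t] by simp

lemma schwartz_win: "schwartz g"
  using window unfolding window_setting_def by blast

lemma schwartz_win_moment: "schwartz (\<lambda>t. of_real (t ^ j) * (vderiv ^^ d) g t)"
  by (intro schwartz_times_power schwartz_funpow_vderiv schwartz_win)

lemma schwartz_win_power: "schwartz (\<lambda>t. of_real (t ^ j) * g t)"
  by (intro schwartz_times_power schwartz_win)

lemma class_comp:
  assumes "k \<in> {1..ncomp S}"
  shows "0 < amp S k t" "0 < phs1 S k t" "C_diff 2 (amp S k)" "bounded (range (amp S k))"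
    "C_diff 3 (phs S k)" "bounded (range (phs2 S k))" "\<bar>deriv (amp S k) t\<bar> \<le> \<epsilon>1"
    "\<bar>phs3 S k t\<bar> \<le> \<epsilon>3" "0 < lo S k t" "lo S k t < up S k t"
    "0 < a \<Longrightarrow> (a, t) \<notin> zone S k \<Longrightarrow> cmod (chirpG S 0 k a t) \<le> \<tau>0"
  using signals assms unfolding signal_class_def by blast+

lemma tame_signal0: "tame (signal S) (signal' S)"
proof -
  have "tame (\<lambda>t. \<Sum>k=1..ncomp S. xcomp S k t) (\<lambda>t. \<Sum>k=1..ncomp S. xcomp' S k t)"
    by (intro tame_sum tame_xcomp[where E = \<epsilon>1] class_comp) auto
  then show ?thesis
    by (simp add: signal_def[abs_def] signal'_def[abs_def])
qed

lemma tame_signal: "tame x x'"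
  by (intro tame_shift tame_signal0)

lemma tame_resid: "tame (resid S b) (resid' S b)"
  unfolding resid_def[abs_def] resid'_def[abs_def]
  by (intro tame_diff tame_signal tame_sum tame_cmult tame_chirp) auto

lemma acwt_eq: "acwt S w a b = T x w a"
  using acwt_eq_osc[OF sig_pos] .

lemma resd_eq: "resd S j d a b = T (resid S b) (\<lambda>t. of_real (t ^ j) * (vderiv ^^ d) g t) a"
  using res_eq_osc[OF sig_pos] by (simp add: resd_def)

lemma chirpG_eq: "chirpG S j k a b
    = T (chirp (phs1 S k b) (phs2 S k b)) (\<lambda>s. of_real (s ^ j) * g s) a"
  using chirpG_eq_osc[OF sig_pos] .

lemma W_eq: "W S a b = T x g a" and Wg1_eq: "Wg1 S a b = T x (\<lambda>t. of_real t * g t) a"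
  and Wg3_eq: "Wg3 S a b = T x (\<lambda>t. of_real t * vderiv g t) a"
  by (simp_all add: acwt_eq Wg1_def Wg3_def)

lemma osc_signal_decomp:
  assumes "schwartz w"
  shows "T x w a = (\<Sum>l=1..ncomp S. xcomp S l b * T (chirp (phs1 S l b) (phs2 S l b)) w a)
      + T (resid S b) w a"
proof -
  have "T x w a = T (\<lambda>u. (\<Sum>l=1..ncomp S. xcomp S l b * chirp (phs1 S l b) (phs2 S l b) u)
      + resid S b u) w a"
    by (simp add: resid_def)
  also have "\<dots> = (\<Sum>l=1..ncomp S. xcomp S l b * T (chirp (phs1 S l b) (phs2 S l b)) w a)
      + T (resid S b) w a"
    by (simp add: osc_add osc_sum osc_cmult lin_growth_sum lin_growth_cmult lin_growth_chirp
        tame_lin_growth[OF tame_resid] assms)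
  finally show ?thesis .
qed

lemma W_decomp: "W S a b = (\<Sum>l=1..ncomp S. xcomp S l b * chirpG S 0 l a b) + resd S 0 0 a b"
  using osc_signal_decomp[OF schwartz_win, of a] by (simp add: W_eq chirpG_eq resd_eq)

lemma Wg1_decomp: "Wg1 S a b = (\<Sum>l=1..ncomp S. xcomp S l b * chirpG S 1 l a b) + resd S 1 0 a b"
  using osc_signal_decomp[OF schwartz_times_id[OF schwartz_win], of a]
  by (simp add: Wg1_eq chirpG_eq resd_eq)

definition Wx' :: "real \<Rightarrow> complex" where
  "Wx' a = T x' g a"

lemma Wx'_by_parts:
  assumes "a \<noteq> 0"
  shows "Wx' a = 2 * pi * \<i> * of_real (\<mu> / a) * W S a b - T x (vderiv g) a / of_real (a * \<sigma>)"
  using osc_by_parts[OF tame_signal schwartz_win, of "a * \<sigma>" "\<mu> * \<sigma>"] assms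
  by (simp add: Wx'_def W_eq field_simps)

text \<open>Differentiating each chirp brings down its frequency and chirp rate. The derivative of
  the residual is integrated by parts, whence the term with \<open>freq S / a\<close> and the
  derivative of the window.\<close>

lemma Wx'_decomp:
  assumes "a \<noteq> 0"
  shows "Wx' a = (\<Sum>l=1..ncomp S. xcomp S l b * (2 * pi * \<i> *
        (of_real (phs1 S l b) * chirpG S 0 l a b + of_real (phs2 S l b * (a * \<sigma>)) * chirpG S 1 l a b)))
      + 2 * pi * \<i> * of_real (\<mu> / a) * resd S 0 0 a b - resd S 0 1 a b / of_real (a * \<sigma>)"
proof -
  have "Wx' a = T (\<lambda>u. (\<Sum>l=1..ncomp S. xcomp S l b * chirp' (phs1 S l b) (phs2 S l b) u)
      + resid' S b u) g a"
    by (simp add: resid'_def Wx'_def)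
  also have "\<dots> = (\<Sum>l=1..ncomp S. xcomp S l b * T (chirp' (phs1 S l b) (phs2 S l b)) g a)
      + T (resid' S b) g a"
    by (simp add: osc_add osc_sum osc_cmult lin_growth_sum lin_growth_cmult tameD(2)[OF tame_chirp]
        tameD(2)[OF tame_resid] schwartz_win)
  also have "T (resid' S b) g a
      = 2 * pi * \<i> * of_real (\<mu> / a) * resd S 0 0 a b - resd S 0 1 a b / of_real (a * \<sigma>)"
    using osc_by_parts[OF tame_resid schwartz_win, of "a * \<sigma>" "\<mu> * \<sigma>"] assms
    by (simp add: resd_eq field_simps)
  finally show ?thesis
    by (simp add: osc_chirp' schwartz_win chirpG_eq mult.assoc)
qed

text \<open>In \<open>sumB\<close> and \<open>sumD\<close> the summand of index \<open>k\<close>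
  would have the factor zero, so the sums may run over all components and be compared with
  \<open>W\<close> and \<open>Wg1\<close>.\<close>

lemma sum_drop_self:
  assumes "k \<in> {1..ncomp S}" "f k = (0::complex)"
  shows "(\<Sum>l\<in>{1..ncomp S} - {k}. f l) = (\<Sum>l=1..ncomp S. f l)"
  using assms by (intro sum.mono_neutral_left) auto

text \<open>Replace the frequency and chirp rate of every component by those of component
  \<open>k\<close>. The differences are \<open>sumB\<close> and \<open>sumD\<close>; the common
  factors rebuild \<open>W\<close> and \<open>Wg1\<close> up to residuals, which explains the
  negative residual terms in \<open>Res1\<close>.\<close>

lemma Wx'_eq_Res1:
  assumes "k \<in> {1..ncomp S}" "a \<noteq> 0"
  shows "Wx' a = 2 * pi * \<i> * of_real (phs1 S k b) * W S a b
      + 2 * pi * \<i> * of_real (phs2 S k b) * of_real (a * \<sigma>) * Wg1 S a b + Res1 S k a b"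
proof -
  have B: "sumB S k a b = (\<Sum>l=1..ncomp S. xcomp S l b * (of_real (phs1 S l b) * chirpG S 0 l a b))
      - of_real (phs1 S k b) * (\<Sum>l=1..ncomp S. xcomp S l b * chirpG S 0 l a b)"
    unfolding sumB_def
    by (subst sum_drop_self[OF assms(1)])
       (simp_all add: sum_distrib_left algebra_simps flip: sum_subtractf)
  have D: "sumD S k a b = (\<Sum>l=1..ncomp S. xcomp S l b * (of_real (phs2 S l b) * chirpG S 1 l a b))
      - of_real (phs2 S k b) * (\<Sum>l=1..ncomp S. xcomp S l b * chirpG S 1 l a b)"
    unfolding sumD_def
    by (subst sum_drop_self[OF assms(1)])
       (simp_all add: sum_distrib_left algebra_simps flip: sum_subtractf)
  have "(\<Sum>l=1..ncomp S. xcomp S l b * (2 * pi * \<i> *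
        (of_real (phs1 S l b) * chirpG S 0 l a b + of_real (phs2 S l b * (a * \<sigma>)) * chirpG S 1 l a b)))
      = 2 * pi * \<i> * (\<Sum>l=1..ncomp S. xcomp S l b * (of_real (phs1 S l b) * chirpG S 0 l a b))
      + 2 * pi * \<i> * of_real (a * \<sigma>) * (\<Sum>l=1..ncomp S. xcomp S l b * (of_real (phs2 S l b) * chirpG S 1 l a b))"
    by (simp add: sum_distrib_left algebra_simps flip: sum.distrib)
  then show ?thesis
    unfolding Wx'_decomp[OF assms(2)] W_decomp Wg1_decomp Res1_def B D
    by (simp add: algebra_simps)
qed

lemma has_vector_derivative_chirpG:
  "((\<lambda>a. chirpG S j k a b) has_vector_derivative
    2 * pi * \<i> * of_real \<sigma> * (of_real (phs1 S k b) * chirpG S (j + 1) k a b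
      + of_real (phs2 S k b * a * \<sigma>) * chirpG S (j + 2) k a b)) (at a)"
proof -
  have "(\<lambda>s. of_real s * (of_real (s ^ j) * g s)) = (\<lambda>s. of_real (s ^ (j + 1)) * g s)"
    "(\<lambda>s. of_real s * (of_real s * (of_real (s ^ j) * g s))) = (\<lambda>s. of_real (s ^ (j + 2)) * g s)"
    by (auto simp: mult_ac)
  with has_vector_derivative_osc_chirp[OF schwartz_win_power, of "phs1 S k b" "phs2 S k b" j \<sigma> "\<mu> * \<sigma>" a]
  show ?thesis
    by (simp add: chirpG_eq algebra_simps)
qed

lemma has_vector_derivative_sumB:
  "((\<lambda>a. sumB S k a b) has_vector_derivative 2 * pi * \<i> * of_real \<sigma> * sumE S k a b) (at a)"
  unfolding sumB_def sumE_def
  by (rule has_vector_derivative_eq_rhs,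
      rule has_vector_derivative_sum[OF has_vector_derivative_mult_right[OF has_vector_derivative_chirpG]])
     (simp add: sum_distrib_left mult_ac numeral_2_eq_2)

lemma has_vector_derivative_sumD:
  "((\<lambda>a. sumD S k a b) has_vector_derivative 2 * pi * \<i> * of_real \<sigma> * sumF S k a b) (at a)"
  unfolding sumD_def sumF_def
  by (rule has_vector_derivative_eq_rhs,
      rule has_vector_derivative_sum[OF has_vector_derivative_mult_right[OF has_vector_derivative_chirpG]])
     (simp add: sum_distrib_left mult_ac numeral_2_eq_2 numeral_3_eq_3)

lemma has_vector_derivative_resd:
  assumes "a \<noteq> 0"
  shows "((\<lambda>a. resd S 0 0 a b) has_vector_derivative
      (2 * pi * \<i> * of_real (\<mu> * \<sigma>) * resd S 1 0 a b - resd S 0 0 a b - resd S 1 1 a b) / of_real a) (at a)"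
    and "((\<lambda>a. resd S 0 1 a b) has_vector_derivative
      (2 * pi * \<i> * of_real (\<mu> * \<sigma>) * resd S 1 1 a b - resd S 0 1 a b - resd S 1 2 a b) / of_real a) (at a)"
    and "((\<lambda>a. resd S 1 0 a b) has_vector_derivative
      (2 * pi * \<i> * of_real (\<mu> * \<sigma>) * resd S 2 0 a b - 2 * resd S 1 0 a b - resd S 2 1 a b) / of_real a) (at a)"
proof -
  note D = has_vector_derivative_osc_scale[OF tame_resid _ assms sig_nz[of b], where r = "\<mu> * \<sigma>"]
  show "((\<lambda>a. resd S 0 0 a b) has_vector_derivative
      (2 * pi * \<i> * of_real (\<mu> * \<sigma>) * resd S 1 0 a b - resd S 0 0 a b - resd S 1 1 a b) / of_real a) (at a)"
    using D[OF schwartz_win] by (simp add: resd_eq)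
  show "((\<lambda>a. resd S 0 1 a b) has_vector_derivative
      (2 * pi * \<i> * of_real (\<mu> * \<sigma>) * resd S 1 1 a b - resd S 0 1 a b - resd S 1 2 a b) / of_real a) (at a)"
    using D[OF schwartz_vderiv[OF schwartz_win]] by (simp add: resd_eq numeral_2_eq_2)
  \<comment> \<open>The derivative of \<open>s * g\<close> contains \<open>g\<close> again, so after
    multiplication by \<open>s\<close> the residual with window \<open>s * g\<close> occurs a second
    time; hence its coefficient \<open>2\<close>.\<close>
  have "T (resid S b) (\<lambda>s. of_real s * (g s + of_real s * vderiv g s)) a = resd S 1 0 a b + resd S 2 1 a b"
    using osc_window_add[OF tame_lin_growth[OF tame_resid] schwartz_win_moment[of 1 0]
        schwartz_win_moment[of 2 1], of "a * \<sigma>" "\<mu> * \<sigma>"]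
    by (simp add: resd_eq algebra_simps power2_eq_square)
  then show "((\<lambda>a. resd S 1 0 a b) has_vector_derivative
      (2 * pi * \<i> * of_real (\<mu> * \<sigma>) * resd S 2 0 a b - 2 * resd S 1 0 a b - resd S 2 1 a b) / of_real a) (at a)"
    using D[OF schwartz_times_id[OF schwartz_win]]
    by (simp add: resd_eq vderiv_times_id[OF schwartz_win] power2_eq_square mult.assoc algebra_simps)
qed

end

section \<open>Phase transformations and their errors\<close>

lemma has_vector_derivative_quotient:
  fixes f h :: "real \<Rightarrow> complex"
  assumes "(f has_vector_derivative f') (at a)" "(h has_vector_derivative h') (at a)" "h a \<noteq> 0"
  shows "((\<lambda>a. f a / h a) has_vector_derivative (f' * h a - f a * h') / (h a)\<^sup>2) (at a)"
  using has_derivative_divide'[OF assms(1,2)[unfolded has_vector_derivative_def] assms(3)]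
  unfolding has_vector_derivative_def
  by (rule has_derivative_eq_rhs)
     (simp add: fun_eq_iff scaleR_conv_of_real power2_eq_square algebra_simps)

text \<open>Applied with \<open>d\<close> the threshold denominator and \<open>D\<close> the actual
  one, this is the source of the strict inequalities.\<close>

lemma divide_less_or_zero:
  fixes y :: real
  assumes "0 \<le> y" "0 < d" "d < D"
  shows "y / D \<le> y / d" "y = 0 \<or> y / D < y / d"
  using assms by (auto intro!: divide_left_mono divide_strict_left_mono mult_pos_pos)

text \<open>One strict term makes the sum strict; if none is strict, all \<open>q\<close> vanish and
  force \<open>z\<close> to be zero.\<close>

lemma three_terms_less_or_zero:
  fixes p1 p2 p3 :: real
  assumes "z \<le> p1 + p2 + p3" "0 \<le> z" "p1 \<le> q1" "p2 \<le> q2" "p3 \<le> q3"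
    and "q1 = 0 \<or> p1 < q1" "q2 = 0 \<or> p2 < q2" "q3 = 0 \<or> p3 < q3"
  shows "z < q1 + q2 + q3 \<or> q1 + q2 + q3 = 0 \<and> z = 0"
  using assms by linarith

lemma less_or_zero_trans:
  fixes z :: real
  assumes "z < q \<or> q = 0 \<and> z = 0" "q \<le> B"
  shows "z < B \<or> B = 0 \<and> z = 0"
  using assms by linarith

context awsst_setup
begin

lemma has_vector_derivative_Res1:
  assumes "a \<noteq> 0"
  shows "((\<lambda>a. Res1 S k a b) has_vector_derivative Res2 S k a b) (at a)"
proof -
  note dr = has_vector_derivative_resd[OF assms]
  have id: "((\<lambda>a. complex_of_real a) has_vector_derivative 1) (at a)"
    by (auto intro!: derivative_eq_intros)
  have "((\<lambda>a. 1 / a) has_real_derivative - 1 / a\<^sup>2) (at a)"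
    using assms by (auto intro!: derivative_eq_intros simp: power2_eq_square)
  from has_vector_derivative_of_real[OF this]
  have inv: "((\<lambda>a. complex_of_real (1 / a)) has_vector_derivative of_real (- 1 / a\<^sup>2)) (at a)" .
  let ?J = "2 * pi * \<i>"
  note d = has_vector_derivative_diff[OF has_vector_derivative_diff[OF has_vector_derivative_add[OF
      has_vector_derivative_add[OF
        has_vector_derivative_mult_right[OF has_vector_derivative_sumB[of k a], where a = ?J]
        has_vector_derivative_mult_right[OF has_vector_derivative_mult[OF id has_vector_derivative_sumD[of k a]],
          where a = "?J * of_real \<sigma>"]]
      has_vector_derivative_mult_right[OF has_vector_derivative_mult[OF
          has_vector_derivative_diff[OF has_vector_derivative_mult_right[OF inv, where a = "of_real \<mu>"]
            has_vector_derivative_const[of "of_real (phs1 S k b)"]] dr(1)], where a = ?J]]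
      has_vector_derivative_mult_right[OF has_vector_derivative_mult[OF inv dr(2)], where a = "of_real (1 / \<sigma>)"]]
      has_vector_derivative_mult_right[OF has_vector_derivative_mult[OF id dr(3)],
        where a = "?J * of_real (phs2 S k b * \<sigma>)"]]
  have eq: "(\<lambda>a. Res1 S k a b) = (\<lambda>a. ?J * sumB S k a b + ?J * of_real \<sigma> * (of_real a * sumD S k a b)
      + ?J * ((of_real \<mu> * of_real (1 / a) - of_real (phs1 S k b)) * resd S 0 0 a b)
      - of_real (1 / \<sigma>) * (of_real (1 / a) * resd S 0 1 a b)
      - ?J * of_real (phs2 S k b * \<sigma>) * (of_real a * resd S 1 0 a b))"
    by (simp add: Res1_def fun_eq_iff mult_ac)
  define E F D r0 r01 r11 r1 r12 r2 r21 where abbr: "E = sumE S k a b" "F = sumF S k a b" "D = sumD S k a b"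
    "r0 = resd S 0 0 a b" "r01 = resd S 0 1 a b" "r11 = resd S 1 1 a b" "r1 = resd S 1 0 a b"
    "r12 = resd S 1 2 a b" "r2 = resd S 2 0 a b" "r21 = resd S 2 1 a b"
  \<comment> \<open>Naming the analytic quantities reduces the comparison of the product rule with
    \<open>Res2\<close> to a rational identity.\<close>
  define J where "J = ?J"
  define A s m f1 f2 where A: "A = complex_of_real a" "s = complex_of_real \<sigma>" "m = complex_of_real \<mu>"
    "f1 = complex_of_real (phs1 S k b)" "f2 = complex_of_real (phs2 S k b)"
  have nz: "A \<noteq> 0" "s \<noteq> 0"
    using assms by (auto simp: A)
  have "J * (J * s * E) + J * s * (A * (J * s * F) + 1 * D)
      + J * ((m * (1 / A) - f1) * ((J * (m * s) * r1 - r0 - r11) / A) + (m * (- 1 / A\<^sup>2) - 0) * r0)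
      - 1 / s * (1 / A * ((J * (m * s) * r11 - r01 - r12) / A) + (- 1 / A\<^sup>2) * r01)
      - J * (f2 * s) * (A * ((J * (m * s) * r2 - 2 * r1 - r21) / A) + 1 * r1)
    = J * J * s * E + J * s * D + J * J * (A * s\<^sup>2) * F
      + J / A\<^sup>2 * (A * f1 - 2 * m) * (r0 + r11)
      + J * s * (f2 - J * m / A\<^sup>2 * (A * f1 - m)) * r1
      - J * (s * f2) * (J * (m * s) * r2 - r21) + 1 / (A\<^sup>2 * s) * (2 * r01 + r12)"
  proof -
    \<comment> \<open>The groups with inner denominators are cleared separately, leaving
      \<open>J / A^2\<close> and \<open>1 / (A^2 * s)\<close> as the only quotients; the rest is a
      polynomial identity in them.\<close>
    have t1: "J * ((m * (1 / A) - f1) * ((J * (m * s) * r1 - r0 - r11) / A) + (m * (- 1 / A\<^sup>2) - 0) * r0)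
        = J / A\<^sup>2 * ((A * f1 - 2 * m) * r0 + (A * f1 - m) * r11 - (A * f1 - m) * J * m * s * r1)"
      using nz(1) by (simp add: field_simps power2_eq_square)
    have t2: "1 / s * (1 / A * ((J * (m * s) * r11 - r01 - r12) / A) + (- 1 / A\<^sup>2) * r01)
        = J / A\<^sup>2 * (m * r11) - 1 / (A\<^sup>2 * s) * (2 * r01 + r12)"
      using nz by (simp add: field_simps power2_eq_square)
    have t3: "A * ((J * (m * s) * r2 - 2 * r1 - r21) / A) + 1 * r1 = J * (m * s) * r2 - r1 - r21"
      using nz(1) by simp
    have t4: "J * m / A\<^sup>2 = J / A\<^sup>2 * m"
      by simp
    show ?thesis
      unfolding t1 t2 t3 t4 by (simp only: power2_eq_square[of s]) algebra
  qed
  also have "\<dots> = Res2 S k a b"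
    unfolding Res2_def abbr A J_def by (simp add: algebra_simps power2_eq_square)
  finally have main: "J * (J * s * E) + J * s * (A * (J * s * F) + 1 * D)
      + J * ((m * (1 / A) - f1) * ((J * (m * s) * r1 - r0 - r11) / A) + (m * (- 1 / A\<^sup>2) - 0) * r0)
      - 1 / s * (1 / A * ((J * (m * s) * r11 - r01 - r12) / A) + (- 1 / A\<^sup>2) * r01)
      - J * (f2 * s) * (A * ((J * (m * s) * r2 - 2 * r1 - r21) / A) + 1 * r1) = Res2 S k a b" .
  show ?thesis
    unfolding eq
    by (rule has_vector_derivative_eq_rhs[OF d], rule trans[OF _ main])
       (simp only: abbr A J_def of_real_mult of_real_divide of_real_1 of_real_minus of_real_power)
qed

lemma has_vector_derivative_transform_nz:
  assumes "a \<noteq> 0" "\<And>a. a \<noteq> (0::real) \<Longrightarrow> f a = h a" "(f has_vector_derivative D) (at a)"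
  shows "(h has_vector_derivative D) (at a)"
  using has_vector_derivative_transform_within_open[OF assms(3), of "- {0}" h] assms(1,2) by auto

definition dT :: "(real \<Rightarrow> complex) \<Rightarrow> real \<Rightarrow> complex" where
  "dT w a = (2 * pi * \<i> * of_real (\<mu> * \<sigma>) * T x (\<lambda>s. of_real s * w s) a
      - T x w a - T x (\<lambda>s. of_real s * vderiv w s) a) / of_real a"

lemma has_vector_derivative_T:
  assumes "schwartz w" "a \<noteq> 0"
  shows "(T x w has_vector_derivative dT w a) (at a)"
  unfolding dT_def by (rule has_vector_derivative_osc_scale[OF tame_signal assms sig_nz])

lemma Wda_eq: "a \<noteq> 0 \<Longrightarrow> Wda S a b = dT g a"
  unfolding Wda_def W_eq by (intro vderiv_eqI has_vector_derivative_T schwartz_win)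

definition Wx'' :: "real \<Rightarrow> complex" where
  "Wx'' a = 2 * pi * \<i> * of_real \<mu> * (dT g a / of_real a - T x g a / of_real (a\<^sup>2))
     - (dT (vderiv g) a / of_real a - T x (vderiv g) a / of_real (a\<^sup>2)) / of_real \<sigma>"

text \<open>The integrated form \<open>Wx'_by_parts\<close> is differentiated, since it involves the
  tame signal only.\<close>

lemma has_vector_derivative_Wx':
  assumes "a \<noteq> 0"
  shows "(Wx' has_vector_derivative Wx'' a) (at a)"
proof -
  have id: "((\<lambda>a. complex_of_real a) has_vector_derivative 1) (at a)"
    by (auto intro!: derivative_eq_intros)
  have q: "((\<lambda>a. T x w a / of_real a) has_vector_derivative
      dT w a / of_real a - T x w a / of_real (a\<^sup>2)) (at a)" if "schwartz w" for w
    using has_vector_derivative_quotient[OF has_vector_derivative_T[OF that assms] id] assms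
    by (simp add: diff_divide_distrib power2_eq_square)
  have "((\<lambda>a. 2 * pi * \<i> * of_real \<mu> * (T x g a / of_real a) - T x (vderiv g) a / of_real a / of_real \<sigma>)
      has_vector_derivative Wx'' a) (at a)"
    unfolding Wx''_def
    by (intro has_vector_derivative_diff has_vector_derivative_mult_right has_vector_derivative_divide
          q schwartz_win schwartz_vderiv)
  then show ?thesis
    by (rule has_vector_derivative_transform_nz[OF assms, rotated]) (simp add: Wx'_by_parts W_eq)
qed

text \<open>After the dilation, \<open>b\<close> occurs in the shift, the scale and the modulation.
  The shift contributes \<open>Wx'\<close>; the other two are proportional to the derivative of the
  width and combine by parts with the window \<open>s * g\<close>.\<close>

lemma has_vector_derivative_Wdb:
  assumes "a \<noteq> 0"
  shows "((\<lambda>b. W S a b) has_vector_derivative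
    Wx' a - of_real (deriv (sig S) b / \<sigma>) * (W S a b + Wg3 S a b)) (at b)"
proof -
  define s' where "s' = deriv (sig S) b"
  have sig: "(sig S has_real_derivative s') (at b)"
  proof -
    have "sig S differentiable (at b)"
      using window unfolding window_setting_def by blast
    then show ?thesis
      unfolding s'_def using DERIV_deriv_iff_real_differentiable by blast
  qed
  let ?e = "\<lambda>s. cis (- (2 * pi * (\<mu> * \<sigma>) * s))"
  have W: "(\<lambda>b. W S a b) = (\<lambda>u. LBINT s. signal S (u + a * sig S u * s) * g s * cis (- (2 * pi * \<mu> * sig S u) * s))"
    using acwt_eq_osc[OF sig_pos] by (simp add: osc_def fun_eq_iff mult.assoc)
  have "((\<lambda>u. a * sig S u) has_real_derivative a * s') (at b)"
    "((\<lambda>u. - (2 * pi * \<mu> * sig S u)) has_real_derivative - (2 * pi * \<mu> * s')) (at b)"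
    by (auto intro!: derivative_eq_intros sig)
  from has_vector_derivative_modulated[OF tame_signal0 schwartz_win DERIV_ident this]
  have 1: "((\<lambda>b. W S a b) has_vector_derivative
      (LBINT s. (of_real (1 + a * s' * s) * x' (a * \<sigma> * s)
        + \<i> * of_real (- (2 * pi * \<mu> * s') * s) * x (a * \<sigma> * s)) * g s * ?e s)) (at b)"
    unfolding W by (simp add: mult.assoc)
  have int: "integrable lborel (\<lambda>s. x' (a * \<sigma> * s) * g s * ?e s)"
    "integrable lborel (\<lambda>s. x' (a * \<sigma> * s) * (of_real s * g s) * ?e s)"
    "integrable lborel (\<lambda>s. x (a * \<sigma> * s) * (of_real s * g s) * ?e s)"
    by (intro osc_integrable[of x'] osc_integrable[of x] tameD(2)[OF tame_signal]
          tame_lin_growth[OF tame_signal] schwartz_win schwartz_times_id)+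
  have "(\<lambda>s. (of_real (1 + a * s' * s) * x' (a * \<sigma> * s)
        + \<i> * of_real (- (2 * pi * \<mu> * s') * s) * x (a * \<sigma> * s)) * g s * ?e s)
      = (\<lambda>s. x' (a * \<sigma> * s) * g s * ?e s
        + of_real (a * s') * (x' (a * \<sigma> * s) * (of_real s * g s) * ?e s)
        - 2 * pi * \<i> * of_real (\<mu> * s') * (x (a * \<sigma> * s) * (of_real s * g s) * ?e s))"
    by (simp add: fun_eq_iff algebra_simps)
  then have 2: "(LBINT s. (of_real (1 + a * s' * s) * x' (a * \<sigma> * s)
        + \<i> * of_real (- (2 * pi * \<mu> * s') * s) * x (a * \<sigma> * s)) * g s * ?e s)
      = Wx' a + of_real (a * s') * T x' (\<lambda>s. of_real s * g s) a
        - 2 * pi * \<i> * of_real (\<mu> * s') * T x (\<lambda>s. of_real s * g s) a"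
    using int by (simp only: Bochner_Integration.integral_diff Bochner_Integration.integral_add
        Bochner_Integration.integrable_add integrable_mult_right integral_mult_right_zero
        osc_def Wx'_def)
  \<comment> \<open>The derivative of \<open>s * g\<close> is \<open>g + s * g'\<close>: this is
    where the window \<open>t * g'\<close> of \<open>Wg3\<close> enters.\<close>
  have "osc x (vderiv (\<lambda>s. of_real s * g s)) (a * \<sigma>) (\<mu> * \<sigma>) = W S a b + Wg3 S a b"
    unfolding vderiv_times_id[OF schwartz_win] W_eq Wg3_eq
    by (intro osc_window_add tame_lin_growth[OF tame_signal] schwartz_win schwartz_times_id schwartz_vderiv)
  with osc_by_parts[OF tame_signal schwartz_times_id[OF schwartz_win], of "a * \<sigma>" "\<mu> * \<sigma>"]
  have 3: "of_real (a * \<sigma>) * T x' (\<lambda>s. of_real s * g s) a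
      = 2 * pi * \<i> * of_real (\<mu> * \<sigma>) * T x (\<lambda>s. of_real s * g s) a - (W S a b + Wg3 S a b)"
    by simp
  have "of_real (a * s') * T x' (\<lambda>s. of_real s * g s) a
      = of_real (s' / \<sigma>) * (of_real (a * \<sigma>) * T x' (\<lambda>s. of_real s * g s) a)"
    by simp
  also have "\<dots> = 2 * pi * \<i> * of_real (\<mu> * s') * T x (\<lambda>s. of_real s * g s) a
      - of_real (s' / \<sigma>) * (W S a b + Wg3 S a b)"
    unfolding 3 by (simp add: field_simps)
  finally show ?thesis
    using 1 unfolding 2 s'_def[symmetric] by simp
qed

lemma Wdb_eq:
  assumes "a \<noteq> 0"
  shows "Wdb S a b = Wx' a - of_real (deriv (sig S) b / \<sigma>) * (W S a b + Wg3 S a b)"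
  unfolding Wdb_def by (rule vderiv_eqI[OF has_vector_derivative_Wdb[OF assms]])

text \<open>The correction terms of the phase transformation cancel exactly the contribution of the
  varying width to \<open>Wdb\<close>.\<close>

lemma omega1c_eq:
  assumes "a \<noteq> 0" "W S a b \<noteq> 0"
  shows "omega1c S a b = Wx' a / (\<i> * 2 * pi * W S a b)"
  unfolding omega1c_def Wdb_eq[OF assms(1)] using assms by (simp add: field_simps)

lemma omega1c_identity:
  assumes "k \<in> {1..ncomp S}" "a \<noteq> 0" "W S a b \<noteq> 0"
  shows "omega1c S a b - of_real (phs1 S k b) =
    of_real (phs2 S k b * a * \<sigma>) * (Wg1 S a b / W S a b) + Res1 S k a b / (\<i> * 2 * pi * W S a b)"
  unfolding omega1c_eq[OF assms(2,3)] Wx'_eq_Res1[OF assms(1,2)] using assms by (simp add: field_simps)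

text \<open>The quotient rule with denominator \<open>W\<close>, the derivative of the numerator
  being supplied separately; as an explicit expression it also serves for measurability.\<close>

definition dquot :: "(real \<Rightarrow> complex) \<Rightarrow> (real \<Rightarrow> complex) \<Rightarrow> real \<Rightarrow> complex" where
  "dquot f f' a = (f' a * W S a b - f a * dT g a) / (W S a b)\<^sup>2"

lemma has_vector_derivative_over_W:
  assumes "(f has_vector_derivative f' a) (at a)" "a \<noteq> 0" "W S a b \<noteq> 0"
  shows "((\<lambda>a. f a / W S a b) has_vector_derivative dquot f f' a) (at a)"
  unfolding dquot_def W_eq
  using assms by (intro has_vector_derivative_quotient has_vector_derivative_T schwartz_win) (simp_all add: W_eq)

lemma has_vector_derivative_aWg1:
  assumes "a \<noteq> 0"
  shows "((\<lambda>a. of_real a * Wg1 S a b) has_vector_derivative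
    Wg1 S a b + of_real a * dT (\<lambda>s. of_real s * g s) a) (at a)"
proof -
  have "((\<lambda>a. complex_of_real a) has_vector_derivative 1) (at a)"
    by (auto intro!: derivative_eq_intros)
  from has_vector_derivative_mult[OF this has_vector_derivative_T[OF schwartz_times_id[OF schwartz_win] assms]]
  show ?thesis
    by (simp add: Wg1_eq add.commute)
qed

lemma dratio_eq:
  assumes "a \<noteq> 0" "W S a b \<noteq> 0"
  shows "dratio S a b = dquot (\<lambda>a. of_real a * Wg1 S a b)
    (\<lambda>a. Wg1 S a b + of_real a * dT (\<lambda>s. of_real s * g s) a) a"
  unfolding dratio_def
  by (intro vderiv_eqI has_vector_derivative_over_W[where f = "\<lambda>a. of_real a * Wg1 S a b"]
        has_vector_derivative_aWg1 assms)

lemma continuous_on_T: "schwartz w \<Longrightarrow> continuous_on A (T x w)"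
  by (intro continuous_on_compose2[OF continuous_on_osc[OF tame_signal]] continuous_intros) auto

lemma continuous_on_W: "continuous_on A (\<lambda>a. W S a b)"
  unfolding W_eq by (intro continuous_on_T schwartz_win)

text \<open>The explicit formulas hold where neither \<open>a\<close> nor \<open>W\<close> vanishes.
  This set is open by continuity of \<open>W\<close>, so derivatives carry over.\<close>

lemma has_vector_derivative_transform_W:
  assumes "a \<noteq> 0" "W S a b \<noteq> 0"
    and "\<And>a. a \<noteq> 0 \<Longrightarrow> W S a b \<noteq> 0 \<Longrightarrow> f a = h a" "(f has_vector_derivative D) (at a)"
  shows "(h has_vector_derivative D) (at a)"
proof (rule has_vector_derivative_transform_within_open[OF assms(4)])
  show "open ({a. W S a b \<noteq> 0} - {0})"
    by (intro open_Diff open_Collect_neq continuous_on_W continuous_intros closed_singleton)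
qed (use assms in auto)

text \<open>In \<open>Wdb / W\<close> the part of \<open>W\<close> in the width correction becomes a
  constant and drops out under differentiation; the part of \<open>Wg3\<close> is cancelled by the
  second term of \<open>R0\<close>.\<close>

lemma R0_eq:
  assumes "a \<noteq> 0" "W S a b \<noteq> 0"
  shows "R0 S a b = dquot Wx' Wx'' a / dratio S a b"
proof -
  let ?c = "complex_of_real (deriv (sig S) b / \<sigma>)"
  let ?w = "\<lambda>t. of_real t * vderiv g t"
  have w: "schwartz ?w"
    by (intro schwartz_times_id schwartz_vderiv schwartz_win)
  have 3: "((\<lambda>a. Wg3 S a b / W S a b) has_vector_derivative dquot (T x ?w) (dT ?w) a) (at a)"
    unfolding Wg3_eq by (intro has_vector_derivative_over_W has_vector_derivative_T w assms)
  have "((\<lambda>a. Wx' a / W S a b - ?c - ?c * (Wg3 S a b / W S a b)) has_vector_derivative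
      dquot Wx' Wx'' a - 0 - ?c * dquot (T x ?w) (dT ?w) a) (at a)"
    by (intro has_vector_derivative_diff has_vector_derivative_mult_right has_vector_derivative_const 3
          has_vector_derivative_over_W has_vector_derivative_Wx' assms)
  then have "((\<lambda>a. Wdb S a b / W S a b) has_vector_derivative
      dquot Wx' Wx'' a - ?c * dquot (T x ?w) (dT ?w) a) (at a)"
    by (rule has_vector_derivative_transform_W[OF assms, rotated, THEN has_vector_derivative_eq_rhs])
       (simp_all add: Wdb_eq field_simps)
  from vderiv_eqI[OF this] vderiv_eqI[OF 3] show ?thesis
    unfolding R0_def by simp
qed

lemma omega2c_eq:
  assumes "a \<noteq> 0" "W S a b \<noteq> 0"
  shows "omega2c S a b = Wx' a / (\<i> * 2 * pi * W S a b)
    - of_real a * (Wg1 S a b / (\<i> * 2 * pi * W S a b)) * (dquot Wx' Wx'' a / dratio S a b)"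
proof -
  have "omega2c S a b = omega1c S a b - of_real a * (Wg1 S a b / (\<i> * 2 * pi * W S a b)) * R0 S a b"
    unfolding omega2c_def omega1c_def by (simp add: field_simps)
  then show ?thesis
    by (simp only: omega1c_eq[OF assms] R0_eq[OF assms])
qed

text \<open>The leading error of the first-order transform is the chirp rate times
  \<open>a * Wg1 / W\<close> and the width. The factor \<open>dratio\<close> differentiates this
  ratio, so the second-order correction removes that error and leaves residuals only.\<close>

lemma omega2c_identity:
  assumes k: "k \<in> {1..ncomp S}" and a: "a \<noteq> 0" "W S a b \<noteq> 0" and nz: "dratio S a b \<noteq> 0"
  shows "omega2c S a b - of_real (phs1 S k b) = Res1 S k a b / (\<i> * 2 * pi * W S a b)
    - of_real a * (Wg1 S a b / (\<i> * 2 * pi * W S a b))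
      * (dquot (\<lambda>a. Res1 S k a b) (\<lambda>a. Res2 S k a b) a / dratio S a b)"
proof -
  let ?J = "2 * pi * \<i>"
  let ?r = "\<lambda>a. of_real a * Wg1 S a b"
  define c1 c2 where c: "c1 = complex_of_real (phs1 S k b)" "c2 = complex_of_real (phs2 S k b * \<sigma>)"
  have "((\<lambda>a. ?J * c1 + ?J * c2 * (?r a / W S a b) + Res1 S k a b / W S a b) has_vector_derivative
      0 + ?J * c2 * dratio S a b + dquot (\<lambda>a. Res1 S k a b) (\<lambda>a. Res2 S k a b) a) (at a)"
    unfolding dratio_eq[OF a]
    by (intro has_vector_derivative_add has_vector_derivative_mult_right has_vector_derivative_const
          has_vector_derivative_over_W[where f = ?r] has_vector_derivative_aWg1
          has_vector_derivative_over_W[where f = "\<lambda>a. Res1 S k a b"] has_vector_derivative_Res1 a)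
  then have "((\<lambda>a. Wx' a / W S a b) has_vector_derivative
      0 + ?J * c2 * dratio S a b + dquot (\<lambda>a. Res1 S k a b) (\<lambda>a. Res2 S k a b) a) (at a)"
    by (rule has_vector_derivative_transform_W[OF a, rotated])
       (simp add: Wx'_eq_Res1[OF k] c field_simps)
  \<comment> \<open>Two expressions for the derivative of \<open>Wx' / W\<close> at the same scale
    are compared.\<close>
  from vector_derivative_unique_at[OF this has_vector_derivative_over_W[where f' = Wx'',
      OF has_vector_derivative_Wx'[OF a(1)] a]] a
  have Q: "dquot Wx' Wx'' a = ?J * c2 * dratio S a b + dquot (\<lambda>a. Res1 S k a b) (\<lambda>a. Res2 S k a b) a"
    by simp
  have "omega2c S a b - c1 = Res1 S k a b / (\<i> * 2 * pi * W S a b)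
      + c2 * of_real a * Wg1 S a b / W S a b
      - of_real a * (Wg1 S a b / (\<i> * 2 * pi * W S a b)) * (dquot Wx' Wx'' a / dratio S a b)"
    unfolding omega2c_eq[OF a] Wx'_eq_Res1[OF k a(1)] c using a by (simp add: field_simps)
  also have "dquot Wx' Wx'' a / dratio S a b
      = ?J * c2 + dquot (\<lambda>a. Res1 S k a b) (\<lambda>a. Res2 S k a b) a / dratio S a b"
    using nz by (simp add: Q field_simps)
  also have "of_real a * (Wg1 S a b / (\<i> * 2 * pi * W S a b)) * (?J * c2 + q)
      = c2 * of_real a * Wg1 S a b / W S a b + of_real a * (Wg1 S a b / (\<i> * 2 * pi * W S a b)) * q" for q
    using a by (simp add: field_simps)
  finally show ?thesis
    unfolding c(1) by simp
qed

section \<open>Pointwise errors against the suprema in \<open>Bd1\<close> and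
  \<open>Bd2\<close>\<close>

lemma zone_pos: "k \<in> {1..ncomp S} \<Longrightarrow> (a, b) \<in> zone S k \<Longrightarrow> 0 < a"
  using class_comp(9)[of k b] by (auto simp: zone_def)

text \<open>A supremum is useful only for a set bounded above. This comes from continuity on the
  compact closure of the zone, and is the purpose of the continuity lemmas below.\<close>

lemma sup0_upper:
  assumes "k \<in> {1..ncomp S}" "continuous_on {lo S k b..up S k b} f"
    and "V \<subseteq> {a. (a, b) \<in> zone S k}" "a \<in> V"
  shows "f a \<le> sup0 (f ` V)"
proof -
  have "bdd_above (f ` {lo S k b..up S k b})"
    by (intro bounded_imp_bdd_above compact_imp_bounded compact_continuous_image assms(2)) auto
  then have "bdd_above (f ` V)"
    by (rule bdd_above_mono) (use assms(3) in \<open>auto simp: zone_def\<close>)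
  with assms(4) show ?thesis
    by (auto simp: sup0_def intro!: cSup_upper)
qed

lemma Max_upper:
  fixes f :: "nat \<Rightarrow> real"
  shows "k \<in> {1..ncomp S} \<Longrightarrow> f k \<le> (MAX k\<in>{1..ncomp S}. f k)"
  by (intro Max_ge) auto

lemma continuous_on_chirpG: "continuous_on A (\<lambda>a. chirpG S j k a b)"
  using has_vector_derivative_chirpG
  by (meson continuous_at_imp_continuous_on has_vector_derivative_continuous)

lemma continuous_on_resd: "continuous_on A (\<lambda>a. resd S j d a b)"
  unfolding resd_eq
  by (intro continuous_on_compose2[OF continuous_on_osc[OF tame_resid schwartz_win_moment]] continuous_intros) auto

lemma continuous_on_Res1:
  assumes "0 \<notin> A"
  shows "continuous_on A (\<lambda>a. Res1 S k a b)"
proof (rule continuous_at_imp_continuous_on, rule ballI)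
  fix a assume "a \<in> A"
  then have "a \<noteq> 0"
    using assms by blast
  from has_vector_derivative_continuous[OF has_vector_derivative_Res1[OF this]]
  show "isCont (\<lambda>a. Res1 S k a b) a" .
qed

lemma continuous_on_Res2:
  assumes "0 \<notin> A"
  shows "continuous_on A (\<lambda>a. Res2 S k a b)"
  unfolding Res2_def sumD_def sumE_def sumF_def using assms
  by (intro continuous_intros continuous_on_chirpG continuous_on_resd) auto

lemma continuous_on_Wg1: "continuous_on A (\<lambda>a. Wg1 S a b)"
  unfolding Wg1_eq by (intro continuous_on_T schwartz_times_id schwartz_win)

lemma continuous_on_dT: "schwartz w \<Longrightarrow> 0 \<notin> A \<Longrightarrow> continuous_on A (dT w)"
  unfolding dT_def[abs_def]
  by (intro continuous_intros continuous_on_T schwartz_times_id schwartz_vderiv) auto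

lemma continuous_on_Wda: "0 \<notin> A \<Longrightarrow> continuous_on A (\<lambda>a. Wda S a b)"
proof -
  assume A: "0 \<notin> A"
  have "dT g a = Wda S a b" if "a \<in> A" for a
    using that A Wda_eq[of a] by (cases "a = 0") auto
  then show "continuous_on A (\<lambda>a. Wda S a b)"
    by (rule continuous_on_eq[OF continuous_on_dT[OF schwartz_win A]])
qed

lemma lo_nz: "k \<in> {1..ncomp S} \<Longrightarrow> 0 \<notin> {lo S k b..up S k b}"
  using class_comp(9)[of k b] by auto

text \<open>The error is at most a sum of three quotients, with powers of
  \<open>cmod (W S a b)\<close> and \<open>cmod (dratio S a b)\<close> in the denominators. The
  summand of \<open>Bd1\<close> at \<open>a\<close> has the same numerators over the thresholds,
  which are strictly smaller.\<close>

lemma omega2_error: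
  assumes k: "k \<in> {1..ncomp S}" and "0 < e1" "0 < e2" and a: "a \<in> Vset S e1 e2 k b"
  shows "\<bar>omega2 S a b - phs1 S k b\<bar> < Bd1 S e1 e2 b \<or>
    Bd1 S e1 e2 b = 0 \<and> \<bar>omega2 S a b - phs1 S k b\<bar> = 0"
proof -
  define f where "f k a = cmod (Res1 S k a b) / (2 * pi * e1)
        + 1 / (2 * pi * e1 ^ 3 * e2) * a * cmod (Wg1 S a b)
            * (cmod (Wda S a b) * cmod (Res1 S k a b) + e1 * cmod (Res2 S k a b))" for k a
  have W: "e1 < cmod (W S a b)" and dr: "e2 < cmod (dratio S a b)" and z: "(a, b) \<in> zone S k"
    using a by (auto simp: Vset_def)
  have a0: "0 < a"
    using zone_pos[OF k z] .
  have nz: "a \<noteq> 0" "W S a b \<noteq> 0" "dratio S a b \<noteq> 0"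
    using a0 W dr \<open>0 < e1\<close> \<open>0 < e2\<close> by auto
  have "f k a \<le> sup0 (f k ` Vset S e1 e2 k b)"
  proof (rule sup0_upper[OF k _ _ a])
    show "continuous_on {lo S k b..up S k b} (f k)"
      unfolding f_def[abs_def] using \<open>0 < e1\<close> \<open>0 < e2\<close>
      by (intro continuous_intros continuous_on_Res1 continuous_on_Res2 continuous_on_Wg1
            continuous_on_Wda lo_nz k) auto
  qed (auto simp: Vset_def)
  also have "\<dots> \<le> Bd1 S e1 e2 b"
    unfolding Bd1_def f_def[abs_def] by (rule Max_upper[OF k])
  finally have fB: "f k a \<le> Bd1 S e1 e2 b" .
  define n d G r1 r2 w where abbr: "n = cmod (W S a b)" "d = cmod (dratio S a b)"
    "G = a * cmod (Wg1 S a b)" "r1 = cmod (Res1 S k a b)" "r2 = cmod (Res2 S k a b)"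
    "w = cmod (Wda S a b)"
  have n: "e1 < n" "0 < n" and d: "e2 < d" "0 < d" and nn: "0 \<le> G" "0 \<le> r1" "0 \<le> r2" "0 \<le> w"
    using W dr \<open>0 < e1\<close> \<open>0 < e2\<close> a0 by (auto simp: abbr)
  have "\<bar>omega2 S a b - phs1 S k b\<bar> \<le> cmod (omega2c S a b - of_real (phs1 S k b))"
    using abs_Re_le_cmod[of "omega2c S a b - of_real (phs1 S k b)"] by (simp add: omega2_def)
  also have "\<dots> \<le> cmod (Res1 S k a b / (\<i> * 2 * pi * W S a b))
      + cmod (of_real a * (Wg1 S a b / (\<i> * 2 * pi * W S a b))
        * (dquot (\<lambda>a. Res1 S k a b) (\<lambda>a. Res2 S k a b) a / dratio S a b))"
    unfolding omega2c_identity[OF k nz] by (rule norm_triangle_ineq4)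
  also have "\<dots> = r1 / (2 * pi * n) + G / (2 * pi * n * d) * cmod (dquot (\<lambda>a. Res1 S k a b) (\<lambda>a. Res2 S k a b) a)"
    using a0 by (simp add: norm_mult norm_divide abbr)
  also have "\<dots> \<le> r1 / (2 * pi * n) + G / (2 * pi * n * d) * ((r2 * n + r1 * w) / n\<^sup>2)"
  proof -
    have "cmod (Res2 S k a b * W S a b - Res1 S k a b * dT g a) \<le> r2 * n + r1 * w"
      unfolding abbr Wda_eq[OF nz(1)] norm_mult[symmetric] by (rule norm_triangle_ineq4)
    then have "cmod (dquot (\<lambda>a. Res1 S k a b) (\<lambda>a. Res2 S k a b) a) \<le> (r2 * n + r1 * w) / n\<^sup>2"
      by (simp add: dquot_def norm_divide norm_power abbr(1) divide_right_mono)
    then show ?thesis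
      using nn n d by (intro add_left_mono mult_left_mono) auto
  qed
  \<comment> \<open>The quotient rule brings \<open>n^2\<close> beside the factor \<open>n\<close>
    already present: the cube remains with the derivative of \<open>W\<close>, and one power cancels
    for \<open>Res2\<close>.\<close>
  also have "\<dots> = r1 / (2 * pi * n) + G * w * r1 / (2 * pi * n ^ 3 * d) + G * r2 / (2 * pi * n\<^sup>2 * d)"
    using n d by (simp add: field_simps power2_eq_square power3_eq_cube)
  finally have ub: "\<bar>omega2 S a b - phs1 S k b\<bar>
      \<le> r1 / (2 * pi * n) + G * w * r1 / (2 * pi * n ^ 3 * d) + G * r2 / (2 * pi * n\<^sup>2 * d)" .
  have "f k a = r1 / (2 * pi * e1) + G * w * r1 / (2 * pi * e1 ^ 3 * e2) + G * r2 / (2 * pi * e1\<^sup>2 * e2)"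
    using \<open>0 < e1\<close> \<open>0 < e2\<close>
    by (simp add: f_def abbr field_simps power2_eq_square power3_eq_cube)
  moreover have "\<bar>omega2 S a b - phs1 S k b\<bar>
        < r1 / (2 * pi * e1) + G * w * r1 / (2 * pi * e1 ^ 3 * e2) + G * r2 / (2 * pi * e1\<^sup>2 * e2) \<or>
      r1 / (2 * pi * e1) + G * w * r1 / (2 * pi * e1 ^ 3 * e2) + G * r2 / (2 * pi * e1\<^sup>2 * e2) = 0 \<and>
      \<bar>omega2 S a b - phs1 S k b\<bar> = 0"
  proof (rule three_terms_less_or_zero[OF ub abs_ge_zero])
    have 1: "0 < 2 * pi * e1" "2 * pi * e1 < 2 * pi * n"
      using n \<open>0 < e1\<close> by auto
    have 2: "0 < 2 * pi * e1 ^ 3 * e2" "2 * pi * e1 ^ 3 * e2 < 2 * pi * n ^ 3 * d"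
      "0 < 2 * pi * e1\<^sup>2 * e2" "2 * pi * e1\<^sup>2 * e2 < 2 * pi * n\<^sup>2 * d"
      using n d \<open>0 < e1\<close> \<open>0 < e2\<close>
      by (auto intro!: mult_strict_mono mult_strict_left_mono power_strict_mono mult_pos_pos simp: mult.assoc)
    note D = divide_less_or_zero[OF _ 1] divide_less_or_zero[OF _ 2(1,2)] divide_less_or_zero[OF _ 2(3,4)]
    have nn': "0 \<le> G * w * r1" "0 \<le> G * r2"
      using nn by auto
    show "r1 / (2 * pi * n) \<le> r1 / (2 * pi * e1)"
      "G * w * r1 / (2 * pi * n ^ 3 * d) \<le> G * w * r1 / (2 * pi * e1 ^ 3 * e2)"
      "G * r2 / (2 * pi * n\<^sup>2 * d) \<le> G * r2 / (2 * pi * e1\<^sup>2 * e2)"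
      using D(1)[OF nn(2)] D(3)[OF nn'(1)] D(5)[OF nn'(2)] by blast+
    show "r1 / (2 * pi * e1) = 0 \<or> r1 / (2 * pi * n) < r1 / (2 * pi * e1)"
      "G * w * r1 / (2 * pi * e1 ^ 3 * e2) = 0 \<or>
        G * w * r1 / (2 * pi * n ^ 3 * d) < G * w * r1 / (2 * pi * e1 ^ 3 * e2)"
      "G * r2 / (2 * pi * e1\<^sup>2 * e2) = 0 \<or> G * r2 / (2 * pi * n\<^sup>2 * d) < G * r2 / (2 * pi * e1\<^sup>2 * e2)"
      using D(2)[OF nn(2)] D(4)[OF nn'(1)] D(6)[OF nn'(2)] by (metis div_0)+
  qed
  ultimately show ?thesis
    using fB less_or_zero_trans by metis
qed

lemma omega1_error:
  assumes k: "k \<in> {1..ncomp S}" and "0 < e1" and a: "a \<in> Uset S e1 e2 k b"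
  shows "\<bar>omega1 S a b - phs1 S k b\<bar> < Bd2 S e1 e2 b \<or>
    Bd2 S e1 e2 b = 0 \<and> \<bar>omega1 S a b - phs1 S k b\<bar> = 0"
proof -
  define f where "f k a = 1 / e1 * \<bar>phs2 S k b\<bar> * a * sig S b * cmod (Wg1 S a b)
        + 1 / (2 * pi * e1) * cmod (Res1 S k a b)" for k a
  have W: "e1 < cmod (W S a b)" and z: "(a, b) \<in> zone S k"
    using a by (auto simp: Uset_def)
  have a0: "0 < a"
    using zone_pos[OF k z] .
  have nz: "a \<noteq> 0" "W S a b \<noteq> 0"
    using a0 W \<open>0 < e1\<close> by auto
  have "f k a \<le> sup0 (f k ` Uset S e1 e2 k b)"
  proof (rule sup0_upper[OF k _ _ a])
    show "continuous_on {lo S k b..up S k b} (f k)"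
      unfolding f_def[abs_def] using \<open>0 < e1\<close>
      by (intro continuous_intros continuous_on_Res1 continuous_on_Wg1 lo_nz k) auto
  qed (auto simp: Uset_def)
  also have "\<dots> \<le> Bd2 S e1 e2 b"
    unfolding Bd2_def f_def[abs_def] by (rule Max_upper[OF k])
  finally have fB: "f k a \<le> Bd2 S e1 e2 b" .
  define n p r where abbr: "n = cmod (W S a b)" "p = \<bar>phs2 S k b\<bar> * a * \<sigma> * cmod (Wg1 S a b)"
    "r = cmod (Res1 S k a b)"
  have n: "e1 < n" "0 < n" and nn: "0 \<le> p" "0 \<le> r"
    using W \<open>0 < e1\<close> a0 sig_pos[of b] by (auto simp: abbr)
  have "\<bar>omega1 S a b - phs1 S k b\<bar> \<le> cmod (omega1c S a b - of_real (phs1 S k b))"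
    using abs_Re_le_cmod[of "omega1c S a b - of_real (phs1 S k b)"] by (simp add: omega1_def)
  also have "\<dots> \<le> p / n + r / (2 * pi * n)"
    unfolding omega1c_identity[OF k nz] abbr
    by (rule order_trans[OF norm_triangle_ineq])
       (use a0 sig_pos[of b] in \<open>simp add: norm_mult norm_divide abs_mult\<close>)
  \<comment> \<open>The zero summand fits the two terms to
    \<open>three_terms_less_or_zero\<close>.\<close>
  finally have ub: "\<bar>omega1 S a b - phs1 S k b\<bar> \<le> p / n + r / (2 * pi * n) + 0"
    by simp
  have "f k a = p / e1 + r / (2 * pi * e1) + 0"
    by (simp add: f_def abbr)
  moreover have "\<bar>omega1 S a b - phs1 S k b\<bar> < p / e1 + r / (2 * pi * e1) + 0 \<or>
      p / e1 + r / (2 * pi * e1) + 0 = 0 \<and> \<bar>omega1 S a b - phs1 S k b\<bar> = 0"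
  proof (rule three_terms_less_or_zero[OF ub abs_ge_zero])
    have 1: "0 < 2 * pi * e1" "2 * pi * e1 < 2 * pi * n"
      using n \<open>0 < e1\<close> by auto
    note D = divide_less_or_zero[OF nn(1) \<open>0 < e1\<close> n(1)] divide_less_or_zero[OF nn(2) 1]
    show "p / n \<le> p / e1" "r / (2 * pi * n) \<le> r / (2 * pi * e1)"
      using D by blast+
    show "p / e1 = 0 \<or> p / n < p / e1" "r / (2 * pi * e1) = 0 \<or> r / (2 * pi * n) < r / (2 * pi * e1)"
      using D by (metis div_0)+
  qed auto
  ultimately show ?thesis
    using fB less_or_zero_trans by metis
qed

end

section \<open>Recovery of the components\<close>

lemma continuous_compact_support_integrable:
  fixes h :: "real \<Rightarrow> complex"
  assumes "continuous_on UNIV h" "compact (closure {t. h t \<noteq> 0})"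
  shows "integrable lborel h"
proof -
  have "integrable lborel (\<lambda>t. indicator (closure {t. h t \<noteq> 0}) t *\<^sub>R h t)"
    using assms by (intro borel_integrable_compact) (auto intro: continuous_on_subset)
  also have "(\<lambda>t. indicator (closure {t. h t \<noteq> 0}) t *\<^sub>R h t) = h"
    using closure_subset[of "{t. h t \<noteq> 0}"] by (auto simp: fun_eq_iff indicator_def)
  finally show ?thesis .
qed

text \<open>A scale \<open>a\<close> contributes \<open>f a\<close> times the share of the rescaled
  \<open>h\<close>, placed at \<open>w a\<close>, that falls into the frequency band. This share
  tends to \<open>1\<close> inside and to \<open>0\<close> outside; \<open>sep\<close> excludes the
  boundary.\<close>

lemma synchrosqueezing_limit:
  fixes f h :: "real \<Rightarrow> complex" and w :: "real \<Rightarrow> real"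
  assumes f: "integrable lborel f" and w [measurable]: "w \<in> borel_measurable borel"
    and h: "integrable lborel h" "(LBINT t. h t) = 1"
    and sep: "\<And>a. f a \<noteq> 0 \<Longrightarrow> \<bar>w a - c\<bar> \<noteq> e"
  shows "((\<lambda>\<delta>. LBINT \<xi>:{\<xi>. \<bar>\<xi> - c\<bar> < e}. LBINT a. f a * of_real (1 / \<delta>) * h ((\<xi> - w a) / \<delta>))
    \<longlongrightarrow> (LBINT a:{a. \<bar>w a - c\<bar> < e}. f a)) (at_right 0)"
proof -
  define q where "q \<delta> a = (LBINT \<eta>. indicator {\<eta>. \<bar>w a + \<delta> * \<eta> - c\<bar> < e} \<eta> *\<^sub>R h \<eta>)" for \<delta> a
  have [measurable]: "f \<in> borel_measurable borel" "h \<in> borel_measurable borel"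
    using f h(1) by auto
  have hn: "integrable lborel (\<lambda>t. cmod (h t))"
    using h(1) by (rule integrable_norm)
  have subst: "(LBINT \<xi>. F ((\<xi> - v) / \<delta>) (\<xi>)) = (LBINT \<eta>. \<delta> *\<^sub>R F \<eta> (v + \<delta> * \<eta>))"
    if "0 < \<delta>" for v \<delta> :: real and F :: "real \<Rightarrow> real \<Rightarrow> complex"
    using lborel_integral_real_affine[of \<delta> "\<lambda>\<xi>. F ((\<xi> - v) / \<delta>) \<xi>" v] that by simp
  have fub: "(LBINT \<xi>:{\<xi>. \<bar>\<xi> - c\<bar> < e}. LBINT a. f a * of_real (1 / \<delta>) * h ((\<xi> - w a) / \<delta>))
      = (LBINT a. f a * q \<delta> a)" if d: "0 < \<delta>" for \<delta>
  proof -
    let ?I = "{\<xi>. \<bar>\<xi> - c\<bar> < e}"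
    let ?F = "\<lambda>a \<xi>. indicator ?I \<xi> *\<^sub>R (f a * of_real (1 / \<delta>) * h ((\<xi> - w a) / \<delta>))"
    have hint: "integrable lborel (\<lambda>\<xi>. h ((\<xi> - v) / \<delta>))" for v
      using lborel_integrable_real_affine[OF h(1), of "1 / \<delta>" "- v / \<delta>"] d
      by (simp add: diff_divide_distrib)
    have Fint: "integrable lborel (?F a)" for a
    proof -
      have "integrable lborel (\<lambda>\<xi>. indicator ?I \<xi> *\<^sub>R (f a * of_real (1 / \<delta>) * h ((\<xi> - w a) / \<delta>)))"
        by (intro integrable_mult_indicator integrable_mult_right hint) measurable
      then show ?thesis .
    qed
    have inner: "(LBINT \<xi>. ?F a \<xi>) = f a * q \<delta> a" for a
    proof -
      define H where "H \<eta> \<xi> = indicator ?I \<xi> *\<^sub>R (f a * of_real (1 / \<delta>) * h \<eta>)" for \<eta> \<xi>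
      have "(LBINT \<xi>. ?F a \<xi>) = (LBINT \<eta>. \<delta> *\<^sub>R H \<eta> (w a + \<delta> * \<eta>))"
        unfolding subst[where F = H and v = "w a", OF d, symmetric] by (simp add: H_def)
      also have "\<dots> = (LBINT \<eta>. f a * (indicator ?I (w a + \<delta> * \<eta>) *\<^sub>R h \<eta>))"
        using d by (intro Bochner_Integration.integral_cong) (auto simp: H_def scaleR_conv_of_real)
      also have "\<dots> = f a * (LBINT \<eta>. indicator ?I (w a + \<delta> * \<eta>) *\<^sub>R h \<eta>)"
        by (rule integral_mult_right_zero)
      also have "\<dots> = f a * q \<delta> a"
        by (simp add: q_def indicator_def)
      finally show ?thesis .
    qed
    have "integrable (lborel \<Otimes>\<^sub>M lborel) (case_prod ?F)"
    proof (rule lborel_pair.Fubini_integrable)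
      show "case_prod ?F \<in> borel_measurable (lborel \<Otimes>\<^sub>M lborel)"
        by measurable
      show "AE a in lborel. integrable lborel (\<lambda>\<xi>. case_prod ?F (a, \<xi>))"
        using Fint by simp
      have bd: "(LBINT \<xi>. norm (?F a \<xi>)) \<le> cmod (f a) * (LBINT t. cmod (h t))" for a
      proof -
        have "(LBINT \<xi>. norm (?F a \<xi>)) \<le> (LBINT \<xi>. cmod (f a * of_real (1 / \<delta>) * h ((\<xi> - w a) / \<delta>)))"
          by (intro integral_mono integrable_norm integrable_mult_right hint Fint)
             (auto simp: indicator_def)
        also have "\<dots> = cmod (f a) * (LBINT t. cmod (h t))"
        proof -
          have "(LBINT \<xi>. cmod (f a * of_real (1 / \<delta>) * h ((\<xi> - w a) / \<delta>)))
              = \<bar>\<delta>\<bar> *\<^sub>R (LBINT t. cmod (f a * of_real (1 / \<delta>) * h ((w a + \<delta> * t - w a) / \<delta>)))"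
            using d by (intro lborel_integral_real_affine) simp
          then show ?thesis
            using d by (simp add: norm_mult norm_divide)
        qed
        finally show ?thesis .
      qed
      show "integrable lborel (\<lambda>a. LBINT \<xi>. norm (case_prod ?F (a, \<xi>)))"
      proof (rule Bochner_Integration.integrable_bound)
        show "integrable lborel (\<lambda>a. cmod (f a) * (LBINT t. cmod (h t)))"
          by (intro integrable_mult_left integrable_norm f)
        show "(\<lambda>a. LBINT \<xi>. norm (case_prod ?F (a, \<xi>))) \<in> borel_measurable lborel"
          by measurable
        show "AE a in lborel. norm (LBINT \<xi>. norm (case_prod ?F (a, \<xi>)))
            \<le> norm (cmod (f a) * (LBINT t. cmod (h t)))"
          using bd by (intro AE_I2) (auto intro!: order_trans[OF _ abs_ge_self])
      qed
    qed
    from lborel_pair.Fubini_integral[OF this]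
    have "(LBINT \<xi>. LBINT a. ?F a \<xi>) = (LBINT a. f a * q \<delta> a)"
      by (simp only: inner)
    then show ?thesis
      by (simp only: integral_scaleR_right set_lebesgue_integral_def)
  qed
  \<comment> \<open>A bound uniform in the squeezing width: a multiple of \<open>cmod (f a)\<close>
    dominates the integrand in the limit below.\<close>
  have qb: "cmod (q \<delta> a) \<le> (LBINT t. cmod (h t))" for \<delta> a
    unfolding q_def
  proof (rule Bochner_Integration.integral_norm_bound_integral[OF _ hn])
    show "integrable lborel (\<lambda>\<eta>. indicator {\<eta>. \<bar>w a + \<delta> * \<eta> - c\<bar> < e} \<eta> *\<^sub>R h \<eta>)"
      by (intro integrable_mult_indicator h(1)) measurable
  qed (simp add: indicator_def)
  have qm: "q \<delta> \<in> borel_measurable borel" for \<delta>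
    unfolding q_def[abs_def] by measurable
  have "((\<lambda>\<delta>. LBINT a. f a * q \<delta> a) \<longlongrightarrow> (LBINT a. indicator {a. \<bar>w a - c\<bar> < e} a *\<^sub>R f a)) (at_right 0)"
    unfolding tendsto_at_iff_sequentially comp_def
  proof (intro allI impI)
    fix X :: "nat \<Rightarrow> real"
    assume X: "X \<longlonglongrightarrow> 0"
    have qlim: "(\<lambda>n. q (X n) a) \<longlonglongrightarrow> indicator {a. \<bar>w a - c\<bar> < e} a" if "\<bar>w a - c\<bar> \<noteq> e" for a
    proof -
      have "(\<lambda>n. q (X n) a) \<longlonglongrightarrow> (LBINT \<eta>. indicator {a. \<bar>w a - c\<bar> < e} a *\<^sub>R h \<eta>)"
        unfolding q_def
      proof (rule integral_dominated_convergence[OF _ _ hn])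
        have "(\<lambda>n. indicator {\<eta>. \<bar>w a + X n * \<eta> - c\<bar> < e} \<eta> *\<^sub>R h \<eta>)
            \<longlonglongrightarrow> indicator {a. \<bar>w a - c\<bar> < e} a *\<^sub>R h \<eta>" for \<eta>
        proof -
          have lim: "(\<lambda>n. \<bar>w a + X n * \<eta> - c\<bar>) \<longlonglongrightarrow> \<bar>w a + 0 * \<eta> - c\<bar>"
            by (intro tendsto_intros X)
          \<comment> \<open>The distance converges to a value different from \<open>e\<close>, so
            its comparison with \<open>e\<close> is eventually constant.\<close>
          have "\<forall>\<^sub>F n in sequentially. (\<bar>w a + X n * \<eta> - c\<bar> < e) = (\<bar>w a - c\<bar> < e)"
          proof (cases "\<bar>w a - c\<bar> < e")
            case True
            then show ?thesis
              using order_tendstoD(2)[OF lim, of e] by simp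
          next
            case False
            then have "e < \<bar>w a - c\<bar>"
              using that by simp
            then have "\<forall>\<^sub>F n in sequentially. e < \<bar>w a + X n * \<eta> - c\<bar>"
              using order_tendstoD(1)[OF lim, of e] by simp
            then show ?thesis
              using False by (auto elim!: eventually_mono)
          qed
          then show ?thesis
            by (intro tendsto_eventually) (auto elim!: eventually_mono simp: indicator_def)
        qed
        then show "AE \<eta> in lborel. (\<lambda>n. indicator {\<eta>. \<bar>w a + X n * \<eta> - c\<bar> < e} \<eta> *\<^sub>R h \<eta>)
            \<longlonglongrightarrow> indicator {a. \<bar>w a - c\<bar> < e} a *\<^sub>R h \<eta>"
          by simp
        show "AE \<eta> in lborel. norm (indicator {\<eta>. \<bar>w a + X n * \<eta> - c\<bar> < e} \<eta> *\<^sub>R h \<eta>)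
            \<le> cmod (h \<eta>)" for n
          by (simp add: indicator_def)
      qed measurable
      then show ?thesis
        using h(2) by (cases "\<bar>w a - c\<bar> < e") (simp_all add: indicator_def)
    qed
    show "(\<lambda>n. LBINT a. f a * q (X n) a) \<longlonglongrightarrow> (LBINT a. indicator {a. \<bar>w a - c\<bar> < e} a *\<^sub>R f a)"
    proof (rule integral_dominated_convergence[where w = "\<lambda>a. cmod (f a) * (LBINT t. cmod (h t))"])
      show "integrable lborel (\<lambda>a. cmod (f a) * (LBINT t. cmod (h t)))"
        by (intro integrable_mult_left integrable_norm f)
      have "(\<lambda>n. f a * q (X n) a) \<longlonglongrightarrow> indicator {a. \<bar>w a - c\<bar> < e} a *\<^sub>R f a" for a
      proof (cases "f a = 0")
        case False
        from tendsto_mult_left[OF qlim[OF sep[OF this]], of "f a"] show ?thesis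
          by (cases "\<bar>w a - c\<bar> < e") (simp_all add: indicator_def)
      qed simp
      then show "AE a in lborel. (\<lambda>n. f a * q (X n) a) \<longlonglongrightarrow> indicator {a. \<bar>w a - c\<bar> < e} a *\<^sub>R f a"
        by simp
      show "AE a in lborel. norm (f a * q (X n) a) \<le> cmod (f a) * (LBINT t. cmod (h t))" for n
        using qb by (simp add: norm_mult mult_left_mono)
      show "(\<lambda>a. f a * q (X n) a) \<in> borel_measurable lborel" for n
        using qm[of "X n"] by simp
      show "(\<lambda>a. indicator {a. \<bar>w a - c\<bar> < e} a *\<^sub>R f a) \<in> borel_measurable lborel"
        by measurable
    qed
  qed
  moreover have "\<forall>\<^sub>F \<delta> in at_right 0. (LBINT a. f a * q \<delta> a)
      = (LBINT \<xi>:{\<xi>. \<bar>\<xi> - c\<bar> < e}. LBINT a. f a * of_real (1 / \<delta>) * h ((\<xi> - w a) / \<delta>))"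
    unfolding eventually_at_filter by (rule always_eventually, intro allI impI, rule fub[symmetric]) simp
  ultimately show ?thesis
    unfolding set_lebesgue_integral_def[of lborel "{a. \<bar>w a - c\<bar> < e}"]
    by (rule Lim_transform_eventually)
qed

section \<open>Size of the residual, order of the zones, separation of the frequencies\<close>

lemma cubic_taylor_bound:
  assumes "C_diff 3 (phs S k)" "\<And>t. \<bar>phs3 S k t\<bar> \<le> M"
  shows "\<bar>phs S k (b + u) - phs S k b - phs1 S k b * u - 1/2 * phs2 S k b * u\<^sup>2\<bar> \<le> M / 6 * \<bar>u\<bar> ^ 3"
proof -
  have d: "((deriv ^^ m) (phs S k) has_real_derivative (deriv ^^ Suc m) (phs S k) t) (at t)"
    if "m < 3" for m t
    using assms(1) that unfolding C_diff_def by (simp add: DERIV_deriv_iff_field_differentiable)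
  have "\<exists>t. \<bar>t\<bar> \<le> \<bar>u\<bar> \<and> phs S k (b + u)
      = (\<Sum>m<3. (deriv ^^ m) (phs S k) (b + 0) / fact m * u ^ m)
        + (deriv ^^ 3) (phs S k) (b + t) / fact 3 * u ^ 3"
  proof (intro Maclaurin_bi_le[where diff = "\<lambda>m t. (deriv ^^ m) (phs S k) (b + t)"] allI impI)
    fix m :: nat and t :: real assume "m < 3 \<and> \<bar>t\<bar> \<le> \<bar>u\<bar>"
    then have "((deriv ^^ m) (phs S k) has_real_derivative (deriv ^^ Suc m) (phs S k) (t + b)) (at (t + b))"
      using d by blast
    then show "((\<lambda>t. (deriv ^^ m) (phs S k) (b + t)) has_real_derivative
        (deriv ^^ Suc m) (phs S k) (b + t)) (at t)"
      unfolding DERIV_shift by (simp add: add.commute)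
  qed simp
  then obtain t where "phs S k (b + u)
      = (\<Sum>m<3. (deriv ^^ m) (phs S k) (b + 0) / fact m * u ^ m) + phs3 S k (b + t) / fact 3 * u ^ 3"
    unfolding phs3_def by blast
  then have "phs S k (b + u) - phs S k b - phs1 S k b * u - 1/2 * phs2 S k b * u\<^sup>2
      = phs3 S k (b + t) / 6 * u ^ 3"
    by (simp add: numeral_3_eq_3 numeral_2_eq_2 phs1_def phs2_def fact_numeral)
  also have "\<bar>\<dots>\<bar> \<le> M / 6 * \<bar>u\<bar> ^ 3"
    using mult_right_mono[OF assms(2)[of "b + t"], of "\<bar>u\<bar> ^ 3"] by (simp add: abs_mult power_abs)
  finally show ?thesis .
qed

text \<open>The amplitude contributes \<open>E * |u|\<close>. The cubic Taylor error of the phase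
  has the factor \<open>M / 6\<close>, which the frequency factor \<open>2 * pi\<close> turns into
  \<open>pi / 3\<close>.\<close>

lemma xcomp_chirp_bound:
  assumes A: "C_diff 2 (amp S k)" "\<And>t. \<bar>deriv (amp S k) t\<bar> \<le> E" "0 \<le> amp S k b"
    and phi: "C_diff 3 (phs S k)" "\<And>t. \<bar>phs3 S k t\<bar> \<le> M"
  shows "cmod (xcomp S k (b + u) - xcomp S k b * chirp (phs1 S k b) (phs2 S k b) u)
    \<le> E * \<bar>u\<bar> + pi / 3 * M * amp S k b * \<bar>u\<bar> ^ 3"
proof -
  define p where "p = phs S k b + (phs1 S k b * u + 1/2 * phs2 S k b * u\<^sup>2)"
  have e: "xcomp S k b * chirp (phs1 S k b) (phs2 S k b) u = of_real (amp S k b) * cis (2 * pi * p)"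
    by (simp add: xcomp_def chirp_def p_def cis_mult mult.assoc distrib_left)
  have "xcomp S k (b + u) - xcomp S k b * chirp (phs1 S k b) (phs2 S k b) u
      = of_real (amp S k (b + u) - amp S k b) * cis (2 * pi * phs S k (b + u))
        + of_real (amp S k b) * (cis (2 * pi * phs S k (b + u)) - cis (2 * pi * p))"
    unfolding e by (simp add: xcomp_def algebra_simps)
  also have "cmod \<dots> \<le> \<bar>amp S k (b + u) - amp S k b\<bar>
      + amp S k b * cmod (cis (2 * pi * phs S k (b + u)) - cis (2 * pi * p))"
    by (rule order_trans[OF norm_triangle_ineq]) (use A(3) in \<open>simp add: norm_mult flip: of_real_diff\<close>)
  finally have 1: "cmod (xcomp S k (b + u) - xcomp S k b * chirp (phs1 S k b) (phs2 S k b) u)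
      \<le> \<bar>amp S k (b + u) - amp S k b\<bar>
        + amp S k b * cmod (cis (2 * pi * phs S k (b + u)) - cis (2 * pi * p))" .
  have 2: "\<bar>amp S k (b + u) - amp S k b\<bar> \<le> E * \<bar>u\<bar>"
    using bounded_derivative_lin_growth[OF C_diff_2D(1)[OF A(1)] A(2), of "b + u" b] by simp
  have "cmod (cis (2 * pi * phs S k (b + u)) - cis (2 * pi * p)) \<le> 2 * pi * (M / 6 * \<bar>u\<bar> ^ 3)"
  proof -
    have "cmod (cis (2 * pi * phs S k (b + u)) - cis (2 * pi * p)) \<le> 2 * pi * \<bar>phs S k (b + u) - p\<bar>"
      using cmod_cis_diff_le[of "2 * pi * phs S k (b + u)" "2 * pi * p"]
      by (simp add: abs_mult flip: right_diff_distrib)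
    also have "\<bar>phs S k (b + u) - p\<bar> \<le> M / 6 * \<bar>u\<bar> ^ 3"
      using cubic_taylor_bound[OF phi, of b u] by (simp add: p_def algebra_simps)
    finally show ?thesis
      by simp
  qed
  from add_mono[OF 2 mult_left_mono[OF this A(3)]] 1 show ?thesis
    by (simp add: algebra_simps)
qed

lemma Lgap_half_le:
  assumes "ereal e \<le> Lgap S k b / 2"
  shows "2 \<le> k \<Longrightarrow> 2 * e \<le> phs1 S k b - phs1 S (k - 1) b"
    and "k < ncomp S \<Longrightarrow> 2 * e \<le> phs1 S (k + 1) b - phs1 S k b"
  using assms unfolding Lgap_def
  by (auto simp: min_def ereal_divide split: if_splits)

context awsst_setup
begin

lemma resid_bound:
  "cmod (resid S b u) \<le> real (ncomp S) * \<epsilon>1 * \<bar>u\<bar> + pi / 3 * \<epsilon>3 * (\<Sum>k=1..ncomp S. amp S k b) * \<bar>u\<bar> ^ 3"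
proof -
  have "resid S b u = (\<Sum>k=1..ncomp S. xcomp S k (b + u) - xcomp S k b * chirp (phs1 S k b) (phs2 S k b) u)"
    by (simp add: resid_def signal_def sum_subtractf)
  also have "cmod \<dots> \<le> (\<Sum>k=1..ncomp S. \<epsilon>1 * \<bar>u\<bar> + pi / 3 * \<epsilon>3 * amp S k b * \<bar>u\<bar> ^ 3)"
    by (intro sum_norm_le xcomp_chirp_bound class_comp less_imp_le[OF class_comp(1)])
  also have "\<dots> = real (ncomp S) * \<epsilon>1 * \<bar>u\<bar> + pi / 3 * \<epsilon>3 * (\<Sum>k=1..ncomp S. amp S k b) * \<bar>u\<bar> ^ 3"
    by (simp add: sum.distrib sum_distrib_left sum_distrib_right mult_ac)
  finally show ?thesis .
qed

text \<open>Inserting \<open>u = a * sig S b * s\<close> in \<open>resid_bound\<close> turns the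
  first and third powers of \<open>u\<close> into the moments \<open>Imom S 1\<close> and
  \<open>Imom S 3\<close>.\<close>

lemma resd00_bound:
  assumes "0 < a"
  shows "cmod (resd S 0 0 a b) \<le> a * \<sigma> * Pi0 S \<epsilon>1 \<epsilon>3 a b"
proof -
  let ?C = "real (ncomp S) * \<epsilon>1" and ?D = "pi / 3 * \<epsilon>3 * (\<Sum>k=1..ncomp S. amp S k b)"
  let ?p = "a * \<sigma>"
  have p: "0 < ?p"
    using assms sig_pos by simp
  have int: "integrable lborel (\<lambda>s. cmod (of_real (s ^ n) * g s))" for n
    by (intro integrable_norm schwartz_integrable schwartz_win_power)
  have "cmod (resd S 0 0 a b)
      \<le> (LBINT s. ?C * ?p * cmod (of_real (s ^ 1) * g s) + ?D * ?p ^ 3 * cmod (of_real (s ^ 3) * g s))"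
    unfolding resd_eq osc_def
  proof (rule Bochner_Integration.integral_norm_bound_integral)
    show "integrable lborel (\<lambda>s. resid S b (?p * s) * (of_real (s ^ 0) * (vderiv ^^ 0) g s)
        * cis (- (2 * pi * (\<mu> * \<sigma>) * s)))"
      by (intro osc_integrable tame_lin_growth[OF tame_resid] schwartz_win_moment)
    show "integrable lborel (\<lambda>s. ?C * ?p * cmod (of_real (s ^ 1) * g s) + ?D * ?p ^ 3 * cmod (of_real (s ^ 3) * g s))"
      by (intro Bochner_Integration.integrable_add integrable_mult_right int)
    fix s
    have "cmod (resid S b (?p * s)) * cmod (g s) \<le> (?C * \<bar>?p * s\<bar> + ?D * \<bar>?p * s\<bar> ^ 3) * cmod (g s)"
      by (intro mult_right_mono resid_bound) auto
    also have "\<bar>?p * s\<bar> = ?p * \<bar>s\<bar>"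
      unfolding abs_mult[of ?p s] using p by simp
    finally show "norm (resid S b (?p * s) * (of_real (s ^ 0) * (vderiv ^^ 0) g s) * cis (- (2 * pi * (\<mu> * \<sigma>) * s)))
        \<le> ?C * ?p * cmod (of_real (s ^ 1) * g s) + ?D * ?p ^ 3 * cmod (of_real (s ^ 3) * g s)"
      by (simp add: norm_mult norm_power power_mult_distrib algebra_simps)
  qed
  also have "\<dots> = ?C * ?p * Imom S 1 + ?D * ?p ^ 3 * Imom S 3"
    unfolding Imom_def using int[of 1] int[of 3] by simp
  also have "\<dots> = a * \<sigma> * Pi0 S \<epsilon>1 \<epsilon>3 a b"
    by (simp add: Pi0_def power2_eq_square power3_eq_cube algebra_simps)
  finally show ?thesis .
qed

lemma ncomp_pos: "1 \<le> ncomp S"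
  using signals unfolding signal_class_def by blast

lemma eps_nonneg: "0 \<le> \<epsilon>1" "0 \<le> \<epsilon>3"
  using class_comp(7,8)[of 1 0] ncomp_pos by (auto intro: order_trans[OF abs_ge_zero])

lemma Imom_nonneg: "0 \<le> Imom S n"
  unfolding Imom_def by simp

lemma sum_amp_nonneg: "0 \<le> (\<Sum>k=1..ncomp S. amp S k b)"
  by (intro sum_nonneg less_imp_le class_comp(1))

text \<open>The threshold is tested at the largest scale \<open>amax S b\<close> only.\<close>

lemma residual_scale_mono:
  assumes "0 < a" "a \<le> a'"
  shows "a * \<sigma> * Pi0 S \<epsilon>1 \<epsilon>3 a b \<le> a' * \<sigma> * Pi0 S \<epsilon>1 \<epsilon>3 a' b"
proof -
  have "0 \<le> pi / 3 * \<epsilon>3 * Imom S 3"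
    using eps_nonneg Imom_nonneg by simp
  moreover have "a\<^sup>2 \<le> a'\<^sup>2"
    using assms by (intro power_mono) auto
  ultimately have "Pi0 S \<epsilon>1 \<epsilon>3 a b \<le> Pi0 S \<epsilon>1 \<epsilon>3 a' b"
    unfolding Pi0_def using sum_amp_nonneg by (intro add_left_mono mult_right_mono mult_left_mono) auto
  moreover have "0 \<le> Pi0 S \<epsilon>1 \<epsilon>3 a b"
    unfolding Pi0_def using sum_amp_nonneg eps_nonneg Imom_nonneg by simp
  ultimately show ?thesis
    using assms sig_pos[of b] by (intro mult_mono) auto
qed

lemma cmod_xcomp: "k \<in> {1..ncomp S} \<Longrightarrow> cmod (xcomp S k b) = amp S k b"
  using class_comp(1)[of k b] by (simp add: xcomp_def norm_mult)

text \<open>Outside all zones every chirp transform is at most \<open>\<tau>0\<close>, so chirps and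
  residual together stay below the threshold.\<close>

lemma zone_exists:
  assumes "scale_range S" "threshold_ok S \<tau>0 \<epsilon>1 \<epsilon>3 e1 b" "a \<in> {amin S b..amax S b}" "e1 < cmod (W S a b)"
  shows "\<exists>k\<in>{1..ncomp S}. (a, b) \<in> zone S k"
proof (rule ccontr)
  assume no: "\<not> (\<exists>k\<in>{1..ncomp S}. (a, b) \<in> zone S k)"
  have a: "0 < a" "a \<le> amax S b"
    using assms(1,3) unfolding scale_range_def by (auto intro: less_le_trans)
  have "cmod (\<Sum>l=1..ncomp S. xcomp S l b * chirpG S 0 l a b) \<le> (\<Sum>l=1..ncomp S. amp S l b * \<tau>0)"
  proof (rule sum_norm_le)
    fix l assume l: "l \<in> {1..ncomp S}"
    have "cmod (chirpG S 0 l a b) \<le> \<tau>0"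
      using class_comp(11)[OF l a(1)] no l by blast
    then show "cmod (xcomp S l b * chirpG S 0 l a b) \<le> amp S l b * \<tau>0"
      using class_comp(1)[OF l, of b] by (simp add: norm_mult cmod_xcomp[OF l])
  qed
  moreover have "cmod (resd S 0 0 a b) \<le> amax S b * \<sigma> * Pi0 S \<epsilon>1 \<epsilon>3 (amax S b) b"
    using resd00_bound[OF a(1)] residual_scale_mono[OF a] by linarith
  ultimately have "cmod (W S a b) \<le> \<tau>0 * (\<Sum>l=1..ncomp S. amp S l b) + amax S b * \<sigma> * Pi0 S \<epsilon>1 \<epsilon>3 (amax S b) b"
    unfolding W_decomp
    by (intro order_trans[OF norm_triangle_ineq] add_mono) (auto simp: sum_distrib_left mult.commute)
  with assms(2,4) show False
    unfolding threshold_ok_def by linarith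
qed

lemma adjacent_zones: "k \<in> {2..ncomp S} \<Longrightarrow> up S k b \<le> lo S (k - 1) b"
  using signals unfolding signal_class_def by blast

text \<open>Higher frequencies sit at smaller scales. Hence the conditions on the zones of index
  \<open>1\<close> and \<open>ncomp S\<close> place every zone in the scale range.\<close>

lemma zone_bounds_antimono:
  assumes "1 \<le> j" "j \<le> k" "k \<le> ncomp S"
  shows "lo S k b \<le> lo S j b \<and> up S k b \<le> up S j b"
  using assms(2,1,3)
proof (induction k rule: dec_induct)
  case (step n)
  have "up S (Suc n) b \<le> lo S n b"
    using adjacent_zones[of "Suc n"] step by simp
  moreover have "lo S (Suc n) b < up S (Suc n) b" "lo S n b < up S n b"
    using class_comp(10)[of "Suc n" b] class_comp(10)[of n b] step by auto
  ultimately show ?case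
    using step by auto
qed simp

lemma zone_in_scale_range:
  assumes "scale_range S" "k \<in> {1..ncomp S}"
  shows "amin S b \<le> lo S k b" "up S k b \<le> amax S b"
  using assms zone_bounds_antimono[of k "ncomp S"] zone_bounds_antimono[of 1 k]
  unfolding scale_range_def by (auto intro: order_trans)

lemma phs1_mono:
  assumes "1 \<le> j" "j \<le> k" "k \<le> ncomp S"
  shows "phs1 S j b \<le> phs1 S k b"
  using assms(2,1,3)
proof (induction k rule: dec_induct)
  case (step n)
  have "\<forall>k\<in>{2..ncomp S}. \<forall>t. phs1 S (k - 1) t < phs1 S k t"
    using signals unfolding signal_class_def by blast
  from this[rule_format, of "Suc n" b] have "phs1 S n b < phs1 S (Suc n) b"
    using step by simp
  then show ?case
    using step by auto
qed simp

text \<open>\<open>Lgap\<close> looks at the neighbours only; monotonicity in the index extends the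
  gap to all other components.\<close>

lemma frequency_gap:
  assumes "ereal e \<le> Lgap S k b / 2" "k \<in> {1..ncomp S}" "l \<in> {1..ncomp S}" "l \<noteq> k"
  shows "2 * e \<le> \<bar>phs1 S l b - phs1 S k b\<bar>"
proof (cases "l < k")
  case True
  then have "phs1 S l b \<le> phs1 S (k - 1) b" "2 * e \<le> phs1 S k b - phs1 S (k - 1) b"
    using assms by (intro phs1_mono Lgap_half_le(1)[OF assms(1)]; force)+
  then show ?thesis
    by linarith
next
  case False
  then have "phs1 S (k + 1) b \<le> phs1 S l b" "2 * e \<le> phs1 S (k + 1) b - phs1 S k b"
    using assms by (intro phs1_mono Lgap_half_le(2)[OF assms(1)]; force)+
  then show ?thesis
    by linarith
qed

section \<open>Measurability of the phase transformation and the error over one zone\<close>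

lemma borel_measurable_T [measurable]: "schwartz w \<Longrightarrow> T x w \<in> borel_measurable borel"
  by (intro borel_measurable_continuous_onI continuous_on_T)

lemma borel_measurable_dT: "schwartz w \<Longrightarrow> dT w \<in> borel_measurable borel"
  unfolding dT_def[abs_def]
  by (intro borel_measurable_divide borel_measurable_diff borel_measurable_times borel_measurable_const
        borel_measurable_T schwartz_times_id schwartz_vderiv borel_measurable_of_real) auto

text \<open>The phase transformation is defined through derivatives, whose measurability is not
  immediate. On \<open>A\<close> it equals an explicit expression that is Borel on the whole
  line.\<close>

lemma borel_measurable_omega2_thr:
  assumes "A \<in> sets borel" "\<And>a. a \<in> A \<Longrightarrow> a \<noteq> 0 \<and> W S a b \<noteq> 0"
  shows "(\<lambda>a. if a \<in> A then omega2_thr S e2 a b else 0) \<in> borel_measurable borel"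
proof -
  note w = schwartz_win schwartz_vderiv[OF schwartz_win] schwartz_times_id[OF schwartz_win]
  have [measurable]: "(\<lambda>a. W S a b) \<in> borel_measurable borel" "(\<lambda>a. Wg1 S a b) \<in> borel_measurable borel"
    by (intro borel_measurable_continuous_onI continuous_on_W continuous_on_Wg1)+
  have [measurable]: "dT g \<in> borel_measurable borel" "dT (vderiv g) \<in> borel_measurable borel"
    "dT (\<lambda>t. of_real t * g t) \<in> borel_measurable borel"
    "T x g \<in> borel_measurable borel" "T x (vderiv g) \<in> borel_measurable borel"
    by (intro borel_measurable_dT borel_measurable_T w)+
  have [measurable]: "A \<in> sets borel"
    by fact
  \<comment> \<open>The integrated form of \<open>Wx'\<close>, built from continuous transforms of
    the tame signal; the two agree for nonzero \<open>a\<close>, hence on \<open>A\<close>.\<close>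
  define Y where "Y a = 2 * pi * \<i> * of_real (\<mu> / a) * W S a b - T x (vderiv g) a / of_real (a * \<sigma>)" for a
  have [measurable]: "Y \<in> borel_measurable borel"
    unfolding Y_def[abs_def] by measurable
  have [measurable]: "Wx'' \<in> borel_measurable borel"
    unfolding Wx''_def[abs_def] by measurable
  define DR where "DR = dquot (\<lambda>a. of_real a * Wg1 S a b) (\<lambda>a. Wg1 S a b + of_real a * dT (\<lambda>s. of_real s * g s) a)"
  have [measurable]: "DR \<in> borel_measurable borel"
    unfolding DR_def dquot_def[abs_def] by measurable
  have [measurable]: "dquot Y Wx'' \<in> borel_measurable borel"
    unfolding dquot_def[abs_def] by measurable
  have "(\<lambda>a. if a \<in> A then omega2_thr S e2 a b else 0)
      = (\<lambda>a. if a \<in> A then (if cmod (DR a) > e2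
          then Re (Y a / (\<i> * 2 * pi * W S a b)
            - of_real a * (Wg1 S a b / (\<i> * 2 * pi * W S a b)) * (dquot Y Wx'' a / DR a))
          else Re (Y a / (\<i> * 2 * pi * W S a b))) else 0)"
  proof
    fix a
    show "(if a \<in> A then omega2_thr S e2 a b else 0)
      = (if a \<in> A then (if cmod (DR a) > e2
          then Re (Y a / (\<i> * 2 * pi * W S a b)
            - of_real a * (Wg1 S a b / (\<i> * 2 * pi * W S a b)) * (dquot Y Wx'' a / DR a))
          else Re (Y a / (\<i> * 2 * pi * W S a b))) else 0)"
    proof (cases "a \<in> A")
      case True
      have nz: "a \<noteq> 0" "W S a b \<noteq> 0"
        using assms(2)[OF True] by auto
      have Y: "Wx' a = Y a"
        by (simp add: Y_def Wx'_by_parts[OF nz(1)])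
      have "dquot Wx' Wx'' a = dquot Y Wx'' a"
        by (simp add: dquot_def Y)
      then show ?thesis
        using True unfolding omega2_thr_def omega2_def omega1_def omega2c_eq[OF nz] omega1c_eq[OF nz]
          dratio_eq[OF nz] Y DR_def by simp
    qed simp
  qed
  also have "\<dots> \<in> borel_measurable borel"
    by measurable
  finally show ?thesis .
qed

text \<open>The integrand bounds the error at one scale: threshold, residual and cross terms. Its
  integral gives the four summands of \<open>Bdk\<close>.\<close>

lemma integral_zone_bound:
  assumes k: "k \<in> {1..ncomp S}"
  shows "(LBINT a:{lo S k b..up S k b}. e1 / a + \<sigma> * Pi0 S \<epsilon>1 \<epsilon>3 a b
      + (\<Sum>l\<in>{1..ncomp S} - {k}. amp S l b * (cmod (chirpG S 0 l a b) / a))) = Bdk S \<epsilon>1 \<epsilon>3 e1 k b"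
    and "set_integrable lborel {lo S k b..up S k b} (\<lambda>a. e1 / a + \<sigma> * Pi0 S \<epsilon>1 \<epsilon>3 a b
      + (\<Sum>l\<in>{1..ncomp S} - {k}. amp S l b * (cmod (chirpG S 0 l a b) / a)))"
proof -
  let ?I = "{lo S k b..up S k b}"
  have lu: "0 < lo S k b" "lo S k b < up S k b"
    using class_comp(9,10)[OF k] by auto
  define D where "D = pi / 3 * \<epsilon>3 * Imom S 3 * (\<Sum>k=1..ncomp S. amp S k b)"
  define C where "C = real (ncomp S) * \<epsilon>1 * Imom S 1"
  \<comment> \<open>An antiderivative without the cross terms; the \<open>3\<close> under the cube
    turns \<open>pi / 3\<close> into \<open>pi / 9\<close>.\<close>
  define F where "F a = e1 * ln a + \<sigma> * C * a + D * \<sigma> ^ 3 * a ^ 3 / 3" for a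
  have P: "e1 / a + \<sigma> * Pi0 S \<epsilon>1 \<epsilon>3 a b = e1 / a + \<sigma> * C + D * \<sigma> ^ 3 * a\<^sup>2" for a
    by (simp add: Pi0_def C_def D_def power3_eq_cube power2_eq_square algebra_simps)
  have cont: "continuous_on ?I (\<lambda>a. e1 / a + \<sigma> * Pi0 S \<epsilon>1 \<epsilon>3 a b)"
    unfolding P using lu by (intro continuous_intros) auto
  have "(LBINT a:?I. e1 / a + \<sigma> * Pi0 S \<epsilon>1 \<epsilon>3 a b) = F (up S k b) - F (lo S k b)"
    unfolding set_lebesgue_integral_def
  proof (rule integral_FTC_Icc[OF _ _ cont])
    fix a assume "lo S k b \<le> a" "a \<le> up S k b"
    then have "0 < a"
      using lu by linarith
    then have "(F has_real_derivative e1 / a + \<sigma> * C + D * \<sigma> ^ 3 * a\<^sup>2) (at a)"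
      unfolding F_def by (auto intro!: derivative_eq_intros)
    then show "(F has_vector_derivative e1 / a + \<sigma> * Pi0 S \<epsilon>1 \<epsilon>3 a b) (at a within ?I)"
      unfolding P by (simp add: has_real_derivative_iff_has_vector_derivative has_vector_derivative_at_within)
  qed (use lu in simp)
  also have "\<dots> = e1 * ln (up S k b / lo S k b) + \<sigma> * real (ncomp S) * \<epsilon>1 * Imom S 1 * (up S k b - lo S k b)
      + pi / 9 * \<epsilon>3 * Imom S 3 * ((up S k b) ^ 3 - (lo S k b) ^ 3) * \<sigma> ^ 3 * (\<Sum>j=1..ncomp S. amp S j b)"
    using lu by (simp add: F_def C_def D_def ln_div algebra_simps)
  finally have 1: "(LBINT a:?I. e1 / a + \<sigma> * Pi0 S \<epsilon>1 \<epsilon>3 a b) = \<dots>" .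
  have ci: "set_integrable lborel ?I (\<lambda>a. amp S l b * (cmod (chirpG S 0 l a b) / a))" for l
    using lu by (intro borel_integrable_atLeastAtMost' continuous_intros continuous_on_chirpG) auto
  have "(LBINT a:?I. \<Sum>l\<in>{1..ncomp S} - {k}. amp S l b * (cmod (chirpG S 0 l a b) / a))
      = (\<Sum>l\<in>{1..ncomp S} - {k}. LBINT a:?I. amp S l b * (cmod (chirpG S 0 l a b) / a))"
    using ci unfolding set_lebesgue_integral_def set_integrable_def scaleR_sum_right
    by (rule Bochner_Integration.integral_sum)
  then have 2: "(LBINT a:?I. \<Sum>l\<in>{1..ncomp S} - {k}. amp S l b * (cmod (chirpG S 0 l a b) / a))
      = (\<Sum>l\<in>{1..ncomp S} - {k}. amp S l b * Mcross S l k b)"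
    unfolding Mcross_def by (simp only: set_integral_mult_right)
  have s1: "set_integrable lborel ?I (\<lambda>a. e1 / a + \<sigma> * Pi0 S \<epsilon>1 \<epsilon>3 a b)"
    by (rule borel_integrable_atLeastAtMost'[OF cont])
  have s2: "set_integrable lborel ?I (\<lambda>a. \<Sum>l\<in>{1..ncomp S} - {k}. amp S l b * (cmod (chirpG S 0 l a b) / a))"
    using lu by (intro borel_integrable_atLeastAtMost' continuous_intros continuous_on_chirpG) auto
  show "(LBINT a:?I. e1 / a + \<sigma> * Pi0 S \<epsilon>1 \<epsilon>3 a b
      + (\<Sum>l\<in>{1..ncomp S} - {k}. amp S l b * (cmod (chirpG S 0 l a b) / a))) = Bdk S \<epsilon>1 \<epsilon>3 e1 k b"
    unfolding set_integral_add(2)[OF s1 s2] 1 2 Bdk_def by simp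
  show "set_integrable lborel ?I (\<lambda>a. e1 / a + \<sigma> * Pi0 S \<epsilon>1 \<epsilon>3 a b
      + (\<Sum>l\<in>{1..ncomp S} - {k}. amp S l b * (cmod (chirpG S 0 l a b) / a)))"
    by (rule set_integral_add(1)[OF s1 s2])
qed

text \<open>The division by \<open>a\<close> comes from the measure \<open>da / a\<close> and
  cancels the factor \<open>a\<close> in the residual bound.\<close>

lemma component_error:
  assumes k: "k \<in> {1..ncomp S}" and a: "0 < a"
  shows "cmod (W S a b - xcomp S k b * chirpG S 0 k a b) / a
    \<le> \<sigma> * Pi0 S \<epsilon>1 \<epsilon>3 a b + (\<Sum>l\<in>{1..ncomp S} - {k}. amp S l b * (cmod (chirpG S 0 l a b) / a))"
proof -
  have "W S a b - xcomp S k b * chirpG S 0 k a b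
      = (\<Sum>l\<in>{1..ncomp S} - {k}. xcomp S l b * chirpG S 0 l a b) + resd S 0 0 a b"
    unfolding W_decomp using k by (simp add: sum.remove[of _ k])
  also have "cmod \<dots> \<le> (\<Sum>l\<in>{1..ncomp S} - {k}. amp S l b * cmod (chirpG S 0 l a b)) + a * \<sigma> * Pi0 S \<epsilon>1 \<epsilon>3 a b"
    by (intro order_trans[OF norm_triangle_ineq] add_mono sum_norm_le resd00_bound[OF a])
       (auto simp: norm_mult cmod_xcomp)
  finally have "cmod (W S a b - xcomp S k b * chirpG S 0 k a b) / a
      \<le> ((\<Sum>l\<in>{1..ncomp S} - {k}. amp S l b * cmod (chirpG S 0 l a b)) + a * \<sigma> * Pi0 S \<epsilon>1 \<epsilon>3 a b) / a"
    using a by (intro divide_right_mono) auto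
  then show ?thesis
    using a by (simp add: add_divide_distrib sum_divide_distrib add.commute)
qed

lemma recovery:
  fixes h :: "real \<Rightarrow> complex"
  assumes range: "scale_range S"
    and h: "continuous_on UNIV h" "compact (closure {t. h t \<noteq> 0})" "(LBINT t. h t) = 1"
    and e: "0 < e1" "0 < e2" "0 < e3"
    and k: "k \<in> {1..ncomp S}"
    and thr: "threshold_ok S \<tau>0 \<epsilon>1 \<epsilon>3 e1 b" and psi: "cpsi S k b \<noteq> 0"
    and bd: "Bd1 S e1 e2 b \<le> e3" "Bd2 S e1 e2 b \<le> e3" and gap: "ereal e3 \<le> Lgap S k b / 2"
  shows "\<exists>z. ((\<lambda>\<delta>. 1 / cpsi S k b * (LBINT \<xi>:{\<xi>. \<bar>\<xi> - phs1 S k b\<bar> < e3}. sst2 S h e1 e2 \<delta> \<xi> b))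
        \<longlongrightarrow> z) (at_right 0)
      \<and> cmod (z - xcomp S k b) \<le> 1 / cmod (cpsi S k b) * Bdk S \<epsilon>1 \<epsilon>3 e1 k b"
proof -
  define A where "A = {a \<in> {amin S b..amax S b}. e1 < cmod (W S a b)}"
  define f where "f a = indicator A a *\<^sub>R (W S a b / of_real a)" for a
  \<comment> \<open>The value \<open>0\<close> off \<open>A\<close> makes \<open>w\<close> Borel and
    never matters, as \<open>f\<close> vanishes there.\<close>
  define w where "w a = (if a \<in> A then omega2_thr S e2 a b else 0)" for a
  let ?I = "{lo S k b..up S k b}"
  let ?N = "{a. \<bar>w a - phs1 S k b\<bar> < e3}"
  have amin: "0 < amin S b"
    using range unfolding scale_range_def by blast
  have [measurable]: "(\<lambda>a. W S a b) \<in> borel_measurable borel"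
    by (intro borel_measurable_continuous_onI continuous_on_W)
  have A [measurable]: "A \<in> sets borel"
    unfolding A_def by measurable
  have Anz: "a \<noteq> 0 \<and> W S a b \<noteq> 0" if "a \<in> A" for a
    using that amin e(1) by (auto simp: A_def)
  have w [measurable]: "w \<in> borel_measurable borel"
    unfolding w_def[abs_def] by (rule borel_measurable_omega2_thr[OF A Anz])
  have WI: "set_integrable lborel {p..q} (\<lambda>a. W S a b / of_real a)" if "0 < p" for p q
    using that by (intro borel_integrable_atLeastAtMost' continuous_intros continuous_on_W) auto
  have "set_integrable lborel A (\<lambda>a. W S a b / of_real a)"
  proof (rule set_integrable_subset[OF WI[OF amin]])
    show "A \<in> sets lborel"
      using A by simp
    show "A \<subseteq> {amin S b..amax S b}"
      by (auto simp: A_def)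
  qed
  then have f: "integrable lborel f"
    unfolding f_def[abs_def] set_integrable_def .
  \<comment> \<open>With \<open>0 < e3\<close>, both alternatives of the error lemmas give a strict
    bound.\<close>
  have in_zone: "\<bar>w a - phs1 S k b\<bar> < e3" if a: "a \<in> A" "(a, b) \<in> zone S k" for a
    using omega2_error[OF k e(1,2), of a] omega1_error[OF k e(1), of a e2] a bd e(3)
    by (cases "e2 < cmod (dratio S a b)") (auto simp: w_def omega2_thr_def A_def Vset_def Uset_def)
  \<comment> \<open>Such a scale lies in another zone \<open>l\<close>, so its frequency is strictly
    within \<open>e3\<close> of one that is at least \<open>2 * e3\<close> away from that of
    component \<open>k\<close>.\<close>
  have off_zone: "e3 < \<bar>w a - phs1 S k b\<bar>" if a: "a \<in> A" "(a, b) \<notin> zone S k" for a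
  proof -
    obtain l where l: "l \<in> {1..ncomp S}" "(a, b) \<in> zone S l"
      using zone_exists[OF range thr, of a] a(1) by (auto simp: A_def)
    then have "l \<noteq> k"
      using a(2) by blast
    from frequency_gap[OF gap k l(1) this] have "2 * e3 \<le> \<bar>phs1 S l b - phs1 S k b\<bar>" .
    moreover have "\<bar>w a - phs1 S l b\<bar> < e3"
      using omega2_error[OF l(1) e(1,2), of a] omega1_error[OF l(1) e(1), of a e2] a l bd e(3)
      by (cases "e2 < cmod (dratio S a b)") (auto simp: w_def omega2_thr_def A_def Vset_def Uset_def)
    ultimately show ?thesis
      by linarith
  qed
  have lim: "((\<lambda>\<delta>. LBINT \<xi>:{\<xi>. \<bar>\<xi> - phs1 S k b\<bar> < e3}. LBINT a. f a * of_real (1 / \<delta>) * h ((\<xi> - w a) / \<delta>))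
      \<longlongrightarrow> (LBINT a:?N. f a)) (at_right 0)"
  proof (rule synchrosqueezing_limit[OF f w continuous_compact_support_integrable[OF h(1,2)] h(3)])
    fix a assume "f a \<noteq> 0"
    then have "a \<in> A"
      by (auto simp: f_def indicator_def split: if_splits)
    then show "\<bar>w a - phs1 S k b\<bar> \<noteq> e3"
      using in_zone[of a] off_zone[of a] by force
  qed
  have sst: "(LBINT a. f a * of_real (1 / \<delta>) * h ((\<xi> - w a) / \<delta>)) = sst2 S h e1 e2 \<delta> \<xi> b" for \<delta> \<xi>
    unfolding sst2_def set_lebesgue_integral_def A_def[symmetric]
    by (intro Bochner_Integration.integral_cong) (auto simp: f_def w_def indicator_def)
  have lim': "((\<lambda>\<delta>. 1 / cpsi S k b * (LBINT \<xi>:{\<xi>. \<bar>\<xi> - phs1 S k b\<bar> < e3}. sst2 S h e1 e2 \<delta> \<xi> b))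
      \<longlongrightarrow> 1 / cpsi S k b * (LBINT a:?N. f a)) (at_right 0)"
    using lim unfolding sst by (rule tendsto_mult_left)
  have I: "?I \<subseteq> {amin S b..amax S b}"
    using zone_in_scale_range[OF range k] by auto
  have lo: "0 < lo S k b"
    using class_comp(9)[OF k] .
  have "(LBINT a:?N. f a) = (LBINT a:?I. f a)"
    unfolding set_lebesgue_integral_def
  proof (rule integral_cong_AE)
    \<comment> \<open>The limit selects the open zone, whereas \<open>cpsi\<close> and
      \<open>Bdk\<close> integrate over its closure; the two endpoints form a null set.\<close>
    have "AE a in lborel. a \<noteq> lo S k b \<and> a \<noteq> up S k b"
      using AE_lborel_singleton[of "lo S k b"] AE_lborel_singleton[of "up S k b"] by eventually_elim auto
    then show "AE a in lborel. indicator ?N a *\<^sub>R f a = indicator ?I a *\<^sub>R f a"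
    proof eventually_elim
      case (elim a)
      show ?case
      proof (cases "a \<in> A")
        case True
        have "a \<in> ?N \<longleftrightarrow> (a, b) \<in> zone S k"
          using in_zone[OF True] off_zone[OF True] by fastforce
        also have "\<dots> \<longleftrightarrow> a \<in> ?I"
          using elim by (auto simp: zone_def)
        finally show ?thesis
          by (simp add: indicator_def)
      qed (simp add: f_def)
    qed
    have [measurable]: "f \<in> borel_measurable borel"
      using f by auto
    show "(\<lambda>a. indicator ?N a *\<^sub>R f a) \<in> borel_measurable lborel"
      "(\<lambda>a. indicator ?I a *\<^sub>R f a) \<in> borel_measurable lborel"
      by measurable
  qed
  moreover have fI: "set_integrable lborel ?I f"
    unfolding set_integrable_def by (intro integrable_mult_indicator f) auto
  moreover have GI: "set_integrable lborel ?I (\<lambda>a. xcomp S k b * (chirpG S 0 k a b / of_real a))"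
    using lo by (intro borel_integrable_atLeastAtMost' continuous_intros continuous_on_chirpG) auto
  ultimately have eq: "(LBINT a:?N. f a) - xcomp S k b * cpsi S k b
      = (LBINT a:?I. f a - xcomp S k b * (chirpG S 0 k a b / of_real a))"
    unfolding cpsi_def by (simp only: set_integral_diff(2) set_integral_mult_right)
  have "cmod (LBINT a:?I. f a - xcomp S k b * (chirpG S 0 k a b / of_real a)) \<le> Bdk S \<epsilon>1 \<epsilon>3 e1 k b"
    unfolding integral_zone_bound(1)[OF k, symmetric] set_lebesgue_integral_def
  proof (rule Bochner_Integration.integral_norm_bound_integral)
    show "integrable lborel (\<lambda>a. indicator ?I a *\<^sub>R (f a - xcomp S k b * (chirpG S 0 k a b / of_real a)))"
      using set_integral_diff(1)[OF fI GI] unfolding set_integrable_def .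
    show "integrable lborel (\<lambda>a. indicator ?I a *\<^sub>R (e1 / a + \<sigma> * Pi0 S \<epsilon>1 \<epsilon>3 a b
      + (\<Sum>l\<in>{1..ncomp S} - {k}. amp S l b * (cmod (chirpG S 0 l a b) / a))))"
      using integral_zone_bound(2)[OF k] unfolding set_integrable_def .
    fix a
    have "cmod (f a - xcomp S k b * (chirpG S 0 k a b / of_real a)) \<le> e1 / a + \<sigma> * Pi0 S \<epsilon>1 \<epsilon>3 a b
        + (\<Sum>l\<in>{1..ncomp S} - {k}. amp S l b * (cmod (chirpG S 0 l a b) / a))" if a: "a \<in> ?I"
    proof -
      have a0: "0 < a"
        using a lo by auto
      have "cmod (W S a b / of_real a - xcomp S k b * (chirpG S 0 k a b / of_real a))
          = cmod (W S a b - xcomp S k b * chirpG S 0 k a b) / a"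
        using a0 by (simp add: norm_divide flip: diff_divide_distrib)
      also note component_error[OF k a0]
      finally have 1: "cmod (W S a b / of_real a - xcomp S k b * (chirpG S 0 k a b / of_real a))
          \<le> \<sigma> * Pi0 S \<epsilon>1 \<epsilon>3 a b + (\<Sum>l\<in>{1..ncomp S} - {k}. amp S l b * (cmod (chirpG S 0 l a b) / a))" .
      \<comment> \<open>Scales of the zone removed by thresholding have
        \<open>cmod (W S a b) <= e1\<close>; integrated, they give the logarithmic term of
        \<open>Bdk\<close>.\<close>
      have 2: "cmod (f a - W S a b / of_real a) \<le> e1 / a"
      proof (cases "a \<in> A")
        case True
        then show ?thesis
          using a0 e(1) by (simp add: f_def)
      next
        case False
        then have "cmod (W S a b) \<le> e1"
          using a I by (auto simp: A_def)
        then show ?thesis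
          using False a0 by (simp add: f_def norm_divide divide_right_mono)
      qed
      show ?thesis
        using norm_triangle_le[OF add_mono[OF 2 1]] by (simp add: algebra_simps)
    qed
    then show "norm (indicator ?I a *\<^sub>R (f a - xcomp S k b * (chirpG S 0 k a b / of_real a)))
        \<le> indicator ?I a *\<^sub>R (e1 / a + \<sigma> * Pi0 S \<epsilon>1 \<epsilon>3 a b
      + (\<Sum>l\<in>{1..ncomp S} - {k}. amp S l b * (cmod (chirpG S 0 l a b) / a)))"
      by (auto simp: indicator_def)
  qed
  then have "cmod ((LBINT a:?N. f a) - xcomp S k b * cpsi S k b) \<le> Bdk S \<epsilon>1 \<epsilon>3 e1 k b"
    unfolding eq .
  moreover have "1 / cpsi S k b * (LBINT a:?N. f a) - xcomp S k b
      = 1 / cpsi S k b * ((LBINT a:?N. f a) - xcomp S k b * cpsi S k b)"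
    using psi by (simp add: field_simps)
  ultimately have "cmod (1 / cpsi S k b * (LBINT a:?N. f a) - xcomp S k b)
      \<le> 1 / cmod (cpsi S k b) * Bdk S \<epsilon>1 \<epsilon>3 e1 k b"
    by (simp add: norm_mult norm_divide divide_right_mono)
  with lim' show ?thesis
    by blast
qed

end

theorem theorem3:
  fixes S :: awsst and h :: "real \<Rightarrow> complex" and \<alpha> \<tau>0 \<epsilon>1 \<epsilon>3 e1 e2 b :: real
  assumes "window_setting S \<alpha> \<tau>0"
    and "0 < \<epsilon>1" and "0 < \<epsilon>3" and "signal_class S \<tau>0 \<epsilon>1 \<epsilon>3"
    and "scale_range S"
    and "continuous_on UNIV h" and "compact (closure {t. h t \<noteq> 0})" and "(LBINT t. h t) = 1"
    and "0 < e1" and "0 < e2"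
  shows
    "(threshold_ok S \<tau>0 \<epsilon>1 \<epsilon>3 e1 b \<longrightarrow>
        (\<forall>a\<in>{amin S b..amax S b}. cmod (W S a b) > e1 \<longrightarrow>
           (\<exists>k\<in>{1..ncomp S}. (a, b) \<in> zone S k)))
     \<and> (\<forall>k\<in>{1..ncomp S}. \<forall>a\<in>Vset S e1 e2 k b.
          \<bar>omega2 S a b - phs1 S k b\<bar> < Bd1 S e1 e2 b
          \<or> (Bd1 S e1 e2 b = 0 \<and> omega2 S a b = phs1 S k b))
     \<and> (\<forall>k\<in>{1..ncomp S}. \<forall>a. cmod (W S a b) > e1 \<and> (a, b) \<in> zone S k \<longrightarrow>
          omega1c S a b - of_real (phs1 S k b) =
            of_real (phs2 S k b * a * sig S b) * (Wg1 S a b / W S a b)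
            + Res1 S k a b / (\<i> * 2 * pi * W S a b))
     \<and> (\<forall>k\<in>{1..ncomp S}. \<forall>a\<in>Uset S e1 e2 k b.
          \<bar>omega1 S a b - phs1 S k b\<bar> < Bd2 S e1 e2 b
          \<or> (Bd2 S e1 e2 b = 0 \<and> omega1 S a b = phs1 S k b))
     \<and> (\<forall>k\<in>{1..ncomp S}.
          threshold_ok S \<tau>0 \<epsilon>1 \<epsilon>3 e1 b \<and> cpsi S k b \<noteq> 0
          \<and> ereal (Bd1 S e1 e2 b) \<le> Lgap S k b / 2 \<and> ereal (Bd2 S e1 e2 b) \<le> Lgap S k b / 2 \<longrightarrow>
          (\<forall>e3>0. max (Bd1 S e1 e2 b) (Bd2 S e1 e2 b) \<le> e3 \<and> ereal e3 \<le> Lgap S k b / 2 \<longrightarrow>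
             (\<exists>z. ((\<lambda>\<delta>. 1 / cpsi S k b *
                        (LBINT \<xi>:{\<xi>. \<bar>\<xi> - phs1 S k b\<bar> < e3}. sst2 S h e1 e2 \<delta> \<xi> b))
                     \<longlongrightarrow> z) (at_right 0)
                \<and> cmod (z - xcomp S k b) \<le> 1 / cmod (cpsi S k b) * Bdk S \<epsilon>1 \<epsilon>3 e1 k b)))"
proof -
  interpret awsst_setup S \<alpha> \<tau>0 \<epsilon>1 \<epsilon>3 b
    by unfold_locales (use assms in auto)
  have pos: "a \<noteq> 0 \<and> W S a b \<noteq> 0" if "k \<in> {1..ncomp S}" "e1 < cmod (W S a b)" "(a, b) \<in> zone S k" for a k
    using zone_pos[OF that(1,3)] that(2) \<open>0 < e1\<close> by auto
  show ?thesis
  proof (intro conjI impI ballI allI)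
    fix a assume "threshold_ok S \<tau>0 \<epsilon>1 \<epsilon>3 e1 b" "a \<in> {amin S b..amax S b}" "e1 < cmod (W S a b)"
    then show "\<exists>k\<in>{1..ncomp S}. (a, b) \<in> zone S k"
      by (rule zone_exists[OF assms(5)])
  next
    fix k a assume "k \<in> {1..ncomp S}" "a \<in> Vset S e1 e2 k b"
    from omega2_error[OF this(1) assms(9,10) this(2)]
    show "\<bar>omega2 S a b - phs1 S k b\<bar> < Bd1 S e1 e2 b \<or>
        Bd1 S e1 e2 b = 0 \<and> omega2 S a b = phs1 S k b"
      by simp
  next
    fix k a assume k: "k \<in> {1..ncomp S}" and a: "e1 < cmod (W S a b) \<and> (a, b) \<in> zone S k"
    then show "omega1c S a b - of_real (phs1 S k b) =
        of_real (phs2 S k b * a * sig S b) * (Wg1 S a b / W S a b)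
        + Res1 S k a b / (\<i> * 2 * pi * W S a b)"
      using pos[OF k] by (intro omega1c_identity) auto
  next
    fix k a assume "k \<in> {1..ncomp S}" "a \<in> Uset S e1 e2 k b"
    from omega1_error[OF this(1) assms(9) this(2)]
    show "\<bar>omega1 S a b - phs1 S k b\<bar> < Bd2 S e1 e2 b \<or>
        Bd2 S e1 e2 b = 0 \<and> omega1 S a b = phs1 S k b"
      by simp
  next
    fix k e3
    assume "k \<in> {1..ncomp S}" "0 < e3"
      and "threshold_ok S \<tau>0 \<epsilon>1 \<epsilon>3 e1 b \<and> cpsi S k b \<noteq> 0
        \<and> ereal (Bd1 S e1 e2 b) \<le> Lgap S k b / 2 \<and> ereal (Bd2 S e1 e2 b) \<le> Lgap S k b / 2"
      and "max (Bd1 S e1 e2 b) (Bd2 S e1 e2 b) \<le> e3 \<and> ereal e3 \<le> Lgap S k b / 2"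
    then show "\<exists>z. ((\<lambda>\<delta>. 1 / cpsi S k b *
          (LBINT \<xi>:{\<xi>. \<bar>\<xi> - phs1 S k b\<bar> < e3}. sst2 S h e1 e2 \<delta> \<xi> b)) \<longlongrightarrow> z) (at_right 0)
        \<and> cmod (z - xcomp S k b) \<le> 1 / cmod (cpsi S k b) * Bdk S \<epsilon>1 \<epsilon>3 e1 k b"
      using assms(5-10) by (intro recovery) auto
  qed
qed

end
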